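(* For each integer $n\ge 6$, there is a finitely generated subgroup of $\mathrm{SL}_n(\mathbb{Z})$ that is one-ended, is not finitely presented, and is Zariski-dense in $\mathrm{SL}_n(\mathbb{R})$. *)

theory Defs
  imports "HOL-Algebra.Generated_Groups" "Jordan_Normal_Form.Determinant"
begin

definition SL_int :: "nat \<Rightarrow> int mat set" where
  "SL_int n = {A \<in> carrier_mat n n. det A = 1}"

definition SL_real :: "nat \<Rightarrow> real mat set" where
  "SL_real n = {A \<in> carrier_mat n n. det A = 1}"

definition SL_group :: "nat \<Rightarrow> int mat monoid" where
  "SL_group n = \<lparr>carrier = SL_int n, monoid.mult = (\<lambda>A B. A * B), monoid.one = 1\<^sub>m n\<rparr>"

definition fg_subgroup :: "('a, 'b) monoid_scheme \<Rightarrow> 'a set \<Rightarrow> bool" where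
  "fg_subgroup G H \<longleftrightarrow> (\<exists>S. finite S \<and> S \<subseteq> carrier G \<and> generate G S = H)"

text \<open>Words over an alphabet: letters (x, False) stand for x, (x, True) for x^{-1}.\<close>
type_synonym 'a word = "('a \<times> bool) list"

definition letter_eval :: "('a, 'b) monoid_scheme \<Rightarrow> 'a \<times> bool \<Rightarrow> 'a" where
  "letter_eval G l = (if snd l then inv\<^bsub>G\<^esub> (fst l) else fst l)"

definition word_eval :: "('a, 'b) monoid_scheme \<Rightarrow> 'a word \<Rightarrow> 'a" where
  "word_eval G w = foldr (\<lambda>l acc. letter_eval G l \<otimes>\<^bsub>G\<^esub> acc) w \<one>\<^bsub>G\<^esub>"

text \<open>Equality in the group presented by relators R: the equivalence relation on words
  generated by inserting a relator and inserting a cancelling pair x x^{-1} / x^{-1} x.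
  Thus w ~ [] iff w lies in the normal closure of R in the free group.\<close>
inductive rel_equiv :: "'a word set \<Rightarrow> 'a word \<Rightarrow> 'a word \<Rightarrow> bool" for R where
  refl: "rel_equiv R w w"
| sym: "rel_equiv R u v \<Longrightarrow> rel_equiv R v u"
| trans: "rel_equiv R u v \<Longrightarrow> rel_equiv R v w \<Longrightarrow> rel_equiv R u w"
| relator: "r \<in> R \<Longrightarrow> rel_equiv R (u @ v) (u @ r @ v)"
| cancel: "rel_equiv R (u @ v) (u @ [(x, b), (x, \<not> b)] @ v)"

definition finitely_presented :: "('a, 'b) monoid_scheme \<Rightarrow> 'a set \<Rightarrow> bool" where
  "finitely_presented G H \<longleftrightarrow>
     (\<exists>S R. finite S \<and> S \<subseteq> carrier G \<and> generate G S = H \<and> finite R \<and>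
        (\<forall>r\<in>R. fst ` set r \<subseteq> S \<and> word_eval G r = \<one>\<^bsub>G\<^esub>) \<and>
        (\<forall>w. fst ` set w \<subseteq> S \<longrightarrow> word_eval G w = \<one>\<^bsub>G\<^esub> \<longrightarrow> rel_equiv R w []))"

inductive cay_conn :: "('a, 'b) monoid_scheme \<Rightarrow> 'a set \<Rightarrow> 'a set \<Rightarrow> 'a set \<Rightarrow> 'a \<Rightarrow> 'a \<Rightarrow> bool"
  for G H S K where
  start: "g \<in> H \<Longrightarrow> g \<notin> K \<Longrightarrow> cay_conn G H S K g g"
| step: "cay_conn G H S K g h \<Longrightarrow> s \<in> S \<Longrightarrow>
         h' = h \<otimes>\<^bsub>G\<^esub> s \<or> h' = h \<otimes>\<^bsub>G\<^esub> inv\<^bsub>G\<^esub> s \<Longrightarrow> h' \<notin> K \<Longrightarrow> cay_conn G H S K g h'"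

definition one_ended :: "('a, 'b) monoid_scheme \<Rightarrow> 'a set \<Rightarrow> bool" where
  "one_ended G H \<longleftrightarrow>
     (\<forall>S. finite S \<and> S \<subseteq> carrier G \<and> generate G S = H \<longrightarrow>
       (\<forall>K. finite K \<and> K \<subseteq> H \<longrightarrow>
          (\<exists>g\<in>H - K. infinite {h. cay_conn G H S K g h} \<and>
             (\<forall>g'\<in>H - K. infinite {h. cay_conn G H S K g' h} \<longrightarrow> cay_conn G H S K g g'))))"

inductive poly_fun :: "nat \<Rightarrow> (real mat \<Rightarrow> real) \<Rightarrow> bool" for n where
  const: "poly_fun n (\<lambda>A. c)"
| entry: "i < n \<Longrightarrow> j < n \<Longrightarrow> poly_fun n (\<lambda>A. A $$ (i, j))"
| add: "poly_fun n f \<Longrightarrow> poly_fun n g \<Longrightarrow> poly_fun n (\<lambda>A. f A + g A)"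
| mult: "poly_fun n f \<Longrightarrow> poly_fun n g \<Longrightarrow> poly_fun n (\<lambda>A. f A * g A)"

definition zariski_dense_SL :: "nat \<Rightarrow> int mat set \<Rightarrow> bool" where
  "zariski_dense_SL n H \<longleftrightarrow>
     (\<forall>f. poly_fun n f \<longrightarrow> (\<forall>A\<in>H. f (map_mat real_of_int A) = 0) \<longrightarrow> (\<forall>B\<in>SL_real n. f B = 0))"

end

theory Submission
  imports Defs "HOL-Computational_Algebra.Polynomial"
begin

text \<open>A right-angled reflection group W on \<open>\<int>\<^sup>n\<close> is generated by \<open>n + 1\<close> reflections: the first three and
  the next \<open>n - 3\<close> generate commuting free products P and Q of groups of order two, and the last one
  commutes with exactly two reflections of Q. By ping-pong on the signs of the coordinates, every word
  that is trivial in W is trivial for any family of involutions satisfying the same commutation rules.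
  The group H is generated by a in P, some elements of Q including y, an element d of \<open>P \<times> Q\<close>, and a
  product t of the last reflection with one of P.

  Not finitely presented: y commutes with all conjugates of a by powers of d, and H maps onto
  wreath products \<open>\<int> wr \<int>\<close> in two ways, so no finite set of relations implies all these commutations.
  One-ended: a commutes with every conjugate of y by a generator, and each such pair spans \<open>\<int>\<^sup>2\<close>.
  Zariski-dense: the generators are unipotent, the tangent space of the Zariski closure is stable under
  brackets with their logarithms, and these generate the special linear Lie algebra.\<close>

section \<open>One-endedness from chains of commuting elements\<close>

text \<open>Why n is at least 6: the involutions \<open>\<rho> 0\<close>, \<open>\<rho> 1\<close>,
  \<open>\<rho> 2\<close> of integer sequences are what it takes to build Z wr Z, so P and Q need
  three reflections each. Why there is one reflection more than coordinates: P and Q alone act on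
  separate blocks, and the extra root ties the blocks together, without which no density is
  possible. The product t = r_n r_1 is chosen to disturb nothing else. In the first wreath quotient
  r_n and r_1 have the same image and in the second both are trivial, so t dies in both; and t
  commutes with y = r_3 r_4. For the symmetric form on P the coefficients (-1, 2, 2) of the last
  root have norm 2, while its part in Q is isotropic and orthogonal to the roots 3 and 4; this gives
  the zeros at 3 and 4 and the entries -2 between n and 1. Two reflections with both Cartan entries
  -2 have a unipotent product whose logarithm has cube zero, and every generator is such a product
  or a product of two commuting ones. Finite presentability is refuted by actions of Heisenberg
  type: in the k-th one y and the conjugate of a by d^i commute except for i = k + 1.\<close>

locale cayley = group G for G :: "('a, 'b) monoid_scheme" (structure) +
  fixes H S K :: "'a set"
  assumes H: "subgroup H G" and S: "S \<subseteq> carrier G" "generate G S = H" and K: "finite K"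
begin

abbreviation conn where "conn \<equiv> cay_conn G H S K"

lemma in_carrier: "g \<in> H \<Longrightarrow> g \<in> carrier G"
  using H subgroup.mem_carrier by fast

lemma mult_in: "g \<in> H \<Longrightarrow> h \<in> H \<Longrightarrow> g \<otimes> h \<in> H"
  using H subgroup.m_closed by fast

lemma inv_in: "g \<in> H \<Longrightarrow> inv g \<in> H"
  using H subgroup.m_inv_closed by fast

lemma pow_in: "g \<in> H \<Longrightarrow> g [^] (i::int) \<in> H"
  using H subgroup_int_pow_closed by blast

lemma S_in: "s \<in> S \<Longrightarrow> s \<in> H"
  using S(2) generate.incl by fast

lemma cancel:
  assumes "x \<in> carrier G" "z \<in> carrier G"
  shows "inv x \<otimes> (x \<otimes> z) = z" "x \<otimes> (inv x \<otimes> z) = z"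
  using assms by (simp_all flip: m_assoc)

lemma commutes_int_pow:
  assumes "s \<in> carrier G" "t \<in> carrier G" "s \<otimes> t = t \<otimes> s"
  shows "t [^] (j::int) \<otimes> s = s \<otimes> t [^] j"
proof (cases j rule: int_cases2)
  case (nonneg n)
  then show ?thesis using group_commutes_pow[of t s n] assms by (simp add: int_pow_int)
next
  case (nonpos n)
  have u: "t [^] n \<otimes> s = s \<otimes> t [^] n" using group_commutes_pow[of t s n] assms by simp
  have "inv (t [^] n) \<otimes> s = inv (t [^] n) \<otimes> (s \<otimes> t [^] n) \<otimes> inv (t [^] n)"
    using assms by (simp add: m_assoc)
  also have "\<dots> = s \<otimes> inv (t [^] n)"
    using assms by (simp add: m_assoc flip: u) (simp flip: m_assoc)
  finally show ?thesis using nonpos assms by (simp add: int_pow_neg_int)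
qed

lemma conn_in: "conn g h \<Longrightarrow> g \<in> H - K \<and> h \<in> H - K"
  by (induction rule: cay_conn.induct) (auto simp: mult_in inv_in S_in)

lemma conn_trans: "conn h k \<Longrightarrow> conn g h \<Longrightarrow> conn g k"
  by (induction rule: cay_conn.induct) (auto intro: cay_conn.step)

lemma conn_sym: "conn g h \<Longrightarrow> conn h g"
proof (induction rule: cay_conn.induct)
  case (start g)
  then show ?case by (rule cay_conn.start)
next
  case (step g h s h')
  note h = conn_in[OF step.hyps(1)]
  have sc: "s \<in> carrier G" "h \<in> carrier G" using step.hyps(2) S(1) h in_carrier by auto
  have "h' \<in> H" using step.hyps h by (auto simp: mult_in inv_in S_in)
  then have "conn h' h'" using step.hyps(4) by (rule cay_conn.start)
  moreover have "h = h' \<otimes> s \<or> h = h' \<otimes> inv s"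
    using step.hyps(3) sc by (auto simp: m_assoc)
  ultimately have "conn h' h" using step.hyps(2) h by (auto intro: cay_conn.step)
  then show ?case using step.IH conn_trans by blast
qed

text \<open>For a product h1 h2 the exceptional set is that of h1 together with the translate of
  that of h2 by \<open>inv h1\<close>. The result holds for every h in H, whatever S is, so the
  later argument can use a generating set D of its own although one-endedness quantifies over all
  S.\<close>

lemma conn_translate:
  assumes "h \<in> H"
  shows "\<exists>B. finite B \<and> (\<forall>g\<in>H - B. conn g (g \<otimes> h))"
  using assms[folded S(2)]
proof (induction rule: generate.induct)
  case one
  then show ?case using K by (intro exI[of _ K]) (auto simp: in_carrier intro: cay_conn.start)
next
  case (incl s)
  have "finite (K \<union> (\<lambda>k. k \<otimes> inv s) ` K)" using K by simp
  moreover have "conn g (g \<otimes> s)" if g: "g \<in> H - (K \<union> (\<lambda>k. k \<otimes> inv s) ` K)" for g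
  proof -
    have "g = (g \<otimes> s) \<otimes> inv s" using g incl S(1) by (auto simp: m_assoc in_carrier)
    then have "g \<otimes> s \<notin> K" using g by auto
    then show ?thesis using g incl by (auto intro: cay_conn.intros)
  qed
  ultimately show ?case by blast
next
  case (inv s)
  have "finite (K \<union> (\<lambda>k. k \<otimes> s) ` K)" using K by simp
  moreover have "conn g (g \<otimes> inv s)" if g: "g \<in> H - (K \<union> (\<lambda>k. k \<otimes> s) ` K)" for g
  proof -
    have "g = (g \<otimes> inv s) \<otimes> s" using g inv S(1) by (auto simp: m_assoc in_carrier)
    then have "g \<otimes> inv s \<notin> K" using g by auto
    then show ?thesis using g inv by (auto intro: cay_conn.intros)
  qed
  ultimately show ?case by blast
next
  case (eng h1 h2)
  then obtain B1 B2 where B: "finite B1" "\<And>g. g \<in> H - B1 \<Longrightarrow> conn g (g \<otimes> h1)"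
    "finite B2" "\<And>g. g \<in> H - B2 \<Longrightarrow> conn g (g \<otimes> h2)" by blast
  have h: "h1 \<in> H" "h2 \<in> H" using eng S(2) by auto
  have "finite (B1 \<union> (\<lambda>k. k \<otimes> inv h1) ` B2)" using B by simp
  moreover have "conn g (g \<otimes> (h1 \<otimes> h2))" if g: "g \<in> H - (B1 \<union> (\<lambda>k. k \<otimes> inv h1) ` B2)" for g
  proof -
    have "g = (g \<otimes> h1) \<otimes> inv h1" using g h by (auto simp: m_assoc in_carrier)
    then have "g \<otimes> h1 \<notin> B2" using g by auto
    then have "conn (g \<otimes> h1) ((g \<otimes> h1) \<otimes> h2)" using B(4) g h by (auto simp: mult_in)
    then show ?thesis using B(2)[of g] conn_trans g h by (auto simp: m_assoc in_carrier)
  qed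
  ultimately show ?case by blast
qed

lemma conn_int_chain:
  fixes f :: "int \<Rightarrow> 'a"
  assumes "\<And>i. conn (f i) (f (i + 1))"
  shows "conn (f i) (f j)"
proof -
  have up: "conn (f i) (f (i + int m))" for i m
  proof (induction m)
    case 0
    then show ?case using conn_in[OF assms[of i]] by (auto intro: cay_conn.start)
  next
    case (Suc m)
    have "f (i + int (Suc m)) = f ((i + int m) + 1)" by (simp add: algebra_simps)
    then show ?case using Suc conn_trans assms by metis
  qed
  show ?thesis
  proof (cases "i \<le> j")
    case True
    then show ?thesis using up[of i "nat (j - i)"] by simp
  next
    case False
    then show ?thesis using up[of j "nat (i - j)"] conn_sym by simp
  qed
qed

text \<open>The condition on powers says that s and t generate a free abelian group of rank 2: both
  have infinite order and their cyclic groups meet trivially.\<close>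

definition free_pair where
  "free_pair s t \<longleftrightarrow> s \<in> H \<and> t \<in> H \<and> s \<otimes> t = t \<otimes> s \<and>
     (\<forall>(i::int) (j::int). s [^] i = t [^] j \<longrightarrow> i = 0 \<and> j = 0)"

lemma free_pair_sym: "free_pair s t \<Longrightarrow> free_pair t s"
  unfolding free_pair_def by metis

lemma free_pair_pow_inj:
  assumes "free_pair s t" "s [^] (i::int) \<otimes> t [^] (j::int) = s [^] (i'::int) \<otimes> t [^] (j'::int)"
  shows "i = i' \<and> j = j'"
proof -
  have c: "s \<in> carrier G" "t \<in> carrier G" using assms(1) in_carrier by (auto simp: free_pair_def)
  have "s [^] (i - i') = inv (s [^] i') \<otimes> s [^] i"
    using int_pow_mult[OF c(1), of "-i'" i] c by (simp add: int_pow_neg)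
  also have "\<dots> = inv (s [^] i') \<otimes> ((s [^] i \<otimes> t [^] j) \<otimes> inv (t [^] j))"
    using c by (simp add: m_assoc)
  also have "\<dots> = (inv (s [^] i') \<otimes> s [^] i') \<otimes> (t [^] j' \<otimes> inv (t [^] j))"
    using c by (simp only: assms(2)) (simp add: m_assoc cancel)
  also have "\<dots> = t [^] (j' - j)" using c by (simp add: int_pow_diff)
  finally have "i - i' = 0 \<and> j' - j = 0" using assms(1) unfolding free_pair_def by blast
  then show ?thesis by simp
qed

text \<open>Outside a large square, the orbit of the free abelian group generated by s and t is
  connected: \<open>\<int>\<^sup>2\<close> has one end.\<close>
lemma plane_conn:
  assumes st: "free_pair s t" and g: "g \<in> H"
  shows "\<exists>N. \<forall>(i::int) (j::int) (i'::int) (j'::int). (\<bar>i\<bar> \<ge> N \<or> \<bar>j\<bar> \<ge> N) \<longrightarrow> (\<bar>i'\<bar> \<ge> N \<or> \<bar>j'\<bar> \<ge> N) \<longrightarrow>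
     conn (g \<otimes> (s [^] i \<otimes> t [^] j)) (g \<otimes> (s [^] i' \<otimes> t [^] j'))"
proof -
  have st_in: "s \<in> H" "t \<in> H" and comm: "s \<otimes> t = t \<otimes> s" using st by (auto simp: free_pair_def)
  note c = in_carrier[OF g] st_in[THEN in_carrier]
  define p where "p = (\<lambda>(i::int) (j::int). g \<otimes> (s [^] i \<otimes> t [^] j))"
  have p_in: "p i j \<in> H" for i j unfolding p_def using g st_in by (simp add: mult_in pow_in)
  have p_inj: "inj (\<lambda>(i, j). p i j)"
    using free_pair_pow_inj[OF st] c by (auto simp: inj_def p_def)
  obtain B where B: "finite B" "\<And>x. x \<in> H - B \<Longrightarrow> conn x (x \<otimes> s)"
    using conn_translate[OF st_in(1)] by blast
  obtain C where C: "finite C" "\<And>x. x \<in> H - C \<Longrightarrow> conn x (x \<otimes> t)"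
    using conn_translate[OF st_in(2)] by blast
  define F where "F = (\<lambda>(i, j). p i j) -` (B \<union> C)"
  have "finite F" unfolding F_def using B(1) C(1) by (intro finite_vimageI p_inj) auto
  then have fin: "finite ((\<lambda>(i, j). max \<bar>i\<bar> \<bar>j\<bar>) ` F)" by simp
  define N where "N = Max (insert 0 ((\<lambda>(i, j). max \<bar>i\<bar> \<bar>j\<bar>) ` F)) + 1"
  have N: "p i j \<notin> B \<union> C" if "\<bar>i\<bar> \<ge> N \<or> \<bar>j\<bar> \<ge> N" for i j
  proof
    assume "p i j \<in> B \<union> C"
    then have "(i, j) \<in> F" by (simp add: F_def)
    then have "max \<bar>i\<bar> \<bar>j\<bar> \<in> insert 0 ((\<lambda>(i, j). max \<bar>i\<bar> \<bar>j\<bar>) ` F)" by force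
    from Max_ge[OF _ this] fin show False using that by (auto simp: N_def)
  qed
  have ps: "p i j \<otimes> s = p (i + 1) j" for i j
  proof -
    have "t [^] j \<otimes> s = s \<otimes> t [^] j"
      using commutes_int_pow c comm by blast
    then show ?thesis using c by (simp add: p_def m_assoc int_pow_mult)
  qed
  have pt: "p i j \<otimes> t = p i (j + 1)" for i j
    using c by (simp add: p_def m_assoc int_pow_mult)
  have h: "conn (p i j) (p i' j)" if "\<bar>j\<bar> \<ge> N" for i i' j
    by (rule conn_int_chain) (use that N B(2) p_in in \<open>simp flip: ps\<close>)
  have v: "conn (p i j) (p i j')" if "\<bar>i\<bar> \<ge> N" for i j j'
    by (rule conn_int_chain) (use that N C(2) p_in in \<open>simp flip: pt\<close>)
  \<comment> \<open>A row or column whose fixed coordinate is large never enters the square; two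
    such moves reach the corner.\<close>
  have corner: "conn (p i j) (p N N)" if "\<bar>i\<bar> \<ge> N \<or> \<bar>j\<bar> \<ge> N" for i j
  proof (cases "\<bar>i\<bar> \<ge> N")
    case True
    then show ?thesis using conn_trans[OF h[of N i N] v[of i j N]] by simp
  next
    case False
    then show ?thesis using that conn_trans[OF v[of N j N] h[of j i N]] by simp
  qed
  have "conn (p i j) (p i' j')" if "\<bar>i\<bar> \<ge> N \<or> \<bar>j\<bar> \<ge> N" "\<bar>i'\<bar> \<ge> N \<or> \<bar>j'\<bar> \<ge> N" for i j i' j'
    using corner[OF that(1)] corner[OF that(2)] conn_sym conn_trans by blast
  then show ?thesis unfolding p_def by blast
qed

text \<open>Both ends of the line through g in direction s lie in the component of x.\<close>

definition tends where "tends x g s \<longleftrightarrow> (\<exists>N. \<forall>i::int. \<bar>i\<bar> \<ge> N \<longrightarrow> conn x (g \<otimes> s [^] i))"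

lemma tends_free_pair:
  assumes st: "free_pair s t" and g: "g \<in> H" and x: "tends x g s"
  shows "tends x g t"
proof -
  have c: "s \<in> carrier G" "t \<in> carrier G" using st in_carrier by (auto simp: free_pair_def)
  obtain N where N: "\<And>(i::int) (j::int) (i'::int) (j'::int). (\<bar>i\<bar> \<ge> N \<or> \<bar>j\<bar> \<ge> N) \<Longrightarrow> (\<bar>i'\<bar> \<ge> N \<or> \<bar>j'\<bar> \<ge> N) \<Longrightarrow>
     conn (g \<otimes> (s [^] i \<otimes> t [^] j)) (g \<otimes> (s [^] i' \<otimes> t [^] j'))"
    using plane_conn[OF st g] by blast
  obtain M where M: "\<And>i::int. \<bar>i\<bar> \<ge> M \<Longrightarrow> conn x (g \<otimes> s [^] i)" using x tends_def by blast
  define m where "m = \<bar>M\<bar> + \<bar>N\<bar>"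
  have "conn x (g \<otimes> t [^] j)" if "\<bar>j\<bar> \<ge> N" for j :: int
  proof -
    have m: "N \<le> \<bar>m\<bar>" "M \<le> \<bar>m\<bar>" unfolding m_def by linarith+
    have "conn (g \<otimes> s [^] m) (g \<otimes> t [^] j)" using N[of m 0 0 j] that c m by simp
    moreover have "conn x (g \<otimes> s [^] m)" using M m by simp
    ultimately show ?thesis by (rule conn_trans)
  qed
  then show ?thesis unfolding tends_def by blast
qed

text \<open>The i-th point of the new line is g s^i h, so the two lines are parallel: they differ by
  right multiplication with h, which changes the component only at finitely many points.\<close>

lemma tends_shift:
  assumes st: "free_pair s t" and g: "g \<in> H" and h: "h \<in> H" and x: "tends x g s"
  shows "tends x (g \<otimes> h) (inv h \<otimes> s \<otimes> h)"
proof -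
  note c = in_carrier[OF g] in_carrier[OF h]
  have s: "s \<in> H" "t \<in> H" "s \<in> carrier G" "t \<in> carrier G" using st in_carrier by (auto simp: free_pair_def)
  obtain B where B: "finite B" "\<And>x. x \<in> H - B \<Longrightarrow> conn x (x \<otimes> h)"
    using conn_translate[OF h] by blast
  obtain M where M: "\<And>i::int. \<bar>i\<bar> \<ge> M \<Longrightarrow> conn x (g \<otimes> s [^] i)" using x tends_def by blast
  have "inj (\<lambda>i::int. g \<otimes> s [^] i)"
    using free_pair_pow_inj[OF st, of _ 0 _ 0] c s by (auto simp: inj_def)
  then have fin: "finite ((\<lambda>i::int. g \<otimes> s [^] i) -` B)" using B(1) by (intro finite_vimageI)
  define N where "N = Max (insert M (abs ` ((\<lambda>i::int. g \<otimes> s [^] i) -` B))) + 1"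
  have conj: "(inv h \<otimes> s \<otimes> h) [^] i = inv h \<otimes> s [^] i \<otimes> h" for i :: int
  proof -
    have n: "(inv h \<otimes> s \<otimes> h) [^] k = inv h \<otimes> s [^] k \<otimes> h" for k :: nat
    proof (induction k)
      case 0
      then show ?case using c by simp
    next
      case (Suc k)
      have "h \<otimes> (inv h \<otimes> (s \<otimes> h)) = s \<otimes> h" using c s by (simp flip: m_assoc)
      then show ?case using Suc c s by (simp add: m_assoc)
    qed
    show ?thesis
      by (cases i rule: int_cases2)
        (use c s n in \<open>auto simp: int_pow_int int_pow_neg inv_mult_group m_assoc\<close>)
  qed
  have "conn x ((g \<otimes> h) \<otimes> (inv h \<otimes> s \<otimes> h) [^] i)" if i: "\<bar>i\<bar> \<ge> N" for i :: int
  proof -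
    have "\<bar>i\<bar> > Max (insert M (abs ` ((\<lambda>i::int. g \<otimes> s [^] i) -` B)))" using i by (simp add: N_def)
    then have 1: "\<bar>i\<bar> \<ge> M" "g \<otimes> s [^] i \<notin> B" using fin by auto
    have "conn (g \<otimes> s [^] i) (g \<otimes> s [^] i \<otimes> h)" using 1 B(2) g s by (simp add: mult_in pow_in)
    moreover have "(g \<otimes> h) \<otimes> (inv h \<otimes> s \<otimes> h) [^] i = g \<otimes> s [^] i \<otimes> h"
    proof -
      show ?thesis using c s by (simp only: conj) (simp add: m_assoc cancel)
    qed
    ultimately show ?thesis using M[OF 1(1)] conn_trans by simp
  qed
  then show ?thesis unfolding tends_def by blast
qed

text \<open>Two lines through one point that span a plane end in the same component. Going from
  direction y to a, from a to d y d^-1, and then shifting by d, the line of g in direction y is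
  carried to that of g d. As D generates H, all lines in direction y end in the component of
  x.\<close>

lemma one_end:
  assumes D: "D \<subseteq> carrier G" "generate G D = H" and ya: "free_pair y a"
    and Dya: "\<And>g. g \<in> D \<Longrightarrow> free_pair (g \<otimes> y \<otimes> inv g) a"
  shows "\<exists>g\<in>H - K. infinite {h. conn g h} \<and> (\<forall>g'\<in>H - K. infinite {h. conn g' h} \<longrightarrow> conn g g')"
proof -
  have ya_in: "y \<in> H" "a \<in> H" using ya by (auto simp: free_pair_def)
  note c = ya_in[THEN in_carrier]
  have one: "\<one> \<in> H" using H subgroup.one_closed by blast
  obtain N where plane: "\<And>(i::int) (j::int) (i'::int) (j'::int). (\<bar>i\<bar> \<ge> N \<or> \<bar>j\<bar> \<ge> N) \<Longrightarrow> (\<bar>i'\<bar> \<ge> N \<or> \<bar>j'\<bar> \<ge> N) \<Longrightarrow>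
     conn (\<one> \<otimes> (y [^] i \<otimes> a [^] j)) (\<one> \<otimes> (y [^] i' \<otimes> a [^] j'))"
    using plane_conn[OF ya one] by blast
  have N: "conn (y [^] i) (y [^] i')" if "\<bar>i\<bar> \<ge> N" "\<bar>i'\<bar> \<ge> N" for i i' :: int
    using plane[of i 0 i' 0] that c by simp
  define x where "x = y [^] N"
  have x1: "tends x \<one> y" unfolding tends_def x_def using N[of N] c by (auto intro!: exI[of _ N])
  have step: "tends x (g \<otimes> d) y \<longleftrightarrow> tends x g y" if g: "g \<in> H" and d: "d \<in> D" for g d
  proof -
    have dH: "d \<in> H" using d D generate.incl by fast
    note dc = in_carrier[OF dH] in_carrier[OF g]
    have y: "inv d \<otimes> (d \<otimes> y \<otimes> inv d) \<otimes> d = y"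
      using dc c by (simp add: m_assoc cancel)
    have "tends x (g \<otimes> d) y" if "tends x g y"
      using tends_shift[OF Dya[OF d] g dH, of x] tends_free_pair[OF free_pair_sym[OF Dya[OF d]] g, of x]
        tends_free_pair[OF ya g that] by (simp add: y)
    moreover have "tends x g y" if t: "tends x (g \<otimes> d) y"
    proof -
      have "tends x (g \<otimes> d \<otimes> inv d) (inv (inv d) \<otimes> y \<otimes> inv d)"
        by (rule tends_shift[OF ya _ _ t]) (use g dH in \<open>auto simp: mult_in inv_in\<close>)
      then have "tends x g (d \<otimes> y \<otimes> inv d)" using dc by (simp add: m_assoc)
      then show ?thesis using tends_free_pair[OF Dya[OF d] g] tends_free_pair[OF free_pair_sym[OF ya] g] by blast
    qed
    ultimately show ?thesis by blast
  qed
  have "\<forall>g\<in>H. tends x (g \<otimes> h) y \<longleftrightarrow> tends x g y" if "h \<in> H" for h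
    using that[folded D(2)]
  proof (induction rule: generate.induct)
    case (inv d)
    show ?case
    proof
      fix g assume g: "g \<in> H"
      have dH: "d \<in> H" using inv D generate.incl by fast
      have "g \<otimes> inv d \<otimes> d = g" using g dH by (simp add: m_assoc in_carrier)
      then show "tends x (g \<otimes> inv d) y \<longleftrightarrow> tends x g y"
        using step[of "g \<otimes> inv d" d] g inv dH by (simp add: mult_in inv_in)
    qed
  next
    case (eng h1 h2)
    then have "h1 \<in> H" "h2 \<in> H" using D by auto
    then have "g \<otimes> (h1 \<otimes> h2) = (g \<otimes> h1) \<otimes> h2 \<and> g \<otimes> h1 \<in> H" if "g \<in> H" for g
      using that by (simp add: m_assoc in_carrier mult_in)
    then show ?case using eng.IH by metis
  qed (use step in_carrier in auto)
  then have xg: "tends x g y" if "g \<in> H" for g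
    using bspec[of H _ \<one>] that one x1 in_carrier by (metis l_one)
  have inj_y: "inj (\<lambda>i::int. y [^] i)"
    using free_pair_pow_inj[OF ya, of _ 0 _ 0] c by (auto simp: inj_def)
  have x_in: "x \<in> H - K" 
    using conn_in[OF N[OF abs_ge_self abs_ge_self]] by (simp add: x_def)
  have "infinite ((\<lambda>i::int. y [^] i) ` {\<bar>N\<bar>..})"
    using infinite_Ici finite_imageD[OF _ inj_on_subset[OF inj_y subset_UNIV]] by metis
  moreover have "(\<lambda>i::int. y [^] i) ` {\<bar>N\<bar>..} \<subseteq> {h. conn x h}"

  proof
    fix h assume "h \<in> (\<lambda>i::int. y [^] i) ` {\<bar>N\<bar>..}"
    then obtain i :: int where i: "h = y [^] i" "\<bar>N\<bar> \<le> i" by auto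
    then have "N \<le> \<bar>i\<bar>" by linarith
    then show "h \<in> {h. conn x h}" using N[OF abs_ge_self, of i] i by (simp add: x_def)
  qed
  ultimately have inf: "infinite {h. conn x h}" using finite_subset by blast
  obtain B where B: "finite B" "\<And>x. x \<in> H - B \<Longrightarrow> conn x (x \<otimes> y)"
    using conn_translate[OF ya_in(1)] by blast
  obtain C where C: "finite C" "\<And>x. x \<in> H - C \<Longrightarrow> conn x (x \<otimes> a)"
    using conn_translate[OF ya_in(2)] by blast
  have xh: "conn x h" if h: "h \<in> H" and s: "free_pair s t" "tends x h s"
    and E: "\<And>x. x \<in> H - E \<Longrightarrow> conn x (x \<otimes> s)" and nE: "\<And>i::int. h \<otimes> s [^] i \<notin> E" for h s t E
  proof -
    have sH: "s \<in> H" using s by (simp add: free_pair_def)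
    have "conn (h \<otimes> s [^] i) (h \<otimes> s [^] (i + 1))" for i :: int
      using E[of "h \<otimes> s [^] i"] nE[of i] h sH by (simp add: mult_in pow_in in_carrier m_assoc int_pow_mult)
    then have "conn (h \<otimes> s [^] i) (h \<otimes> s [^] (0::int))" for i :: int
      using conn_int_chain[of "\<lambda>i. h \<otimes> s [^] i"] by blast
    moreover obtain M where "conn x (h \<otimes> s [^] (M::int))" using s(2) unfolding tends_def by (metis abs_ge_self)
    ultimately show ?thesis using conn_trans h by (metis in_carrier int_pow_0 r_one)
  qed
  \<comment> \<open>Any other vertex reaches the component of x along its y-line or its a-line. A
    bad vertex is determined by one obstructed point on each of its two lines, since the powers of y
    and of a meet trivially; so there are finitely many.\<close>
  define bad where "bad = {h \<in> H. (\<exists>i::int. h \<otimes> y [^] i \<in> B) \<and> (\<exists>j::int. h \<otimes> a [^] j \<in> C)}"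
  have "finite bad"
  proof -
    have "\<forall>h\<in>bad. \<exists>b c. b \<in> B \<and> c \<in> C \<and> (\<exists>i::int. h \<otimes> y [^] i = b) \<and> (\<exists>j::int. h \<otimes> a [^] j = c)"
      unfolding bad_def by blast
    then obtain \<beta> \<gamma> where bc: "\<And>h. h \<in> bad \<Longrightarrow> \<beta> h \<in> B \<and> \<gamma> h \<in> C \<and>
        (\<exists>i::int. h \<otimes> y [^] i = \<beta> h) \<and> (\<exists>j::int. h \<otimes> a [^] j = \<gamma> h)" by metis
    have "inj_on (\<lambda>h. (\<beta> h, \<gamma> h)) bad"
    proof (rule inj_onI)
      fix h h' assume h: "h \<in> bad" "h' \<in> bad" "(\<beta> h, \<gamma> h) = (\<beta> h', \<gamma> h')"
      obtain i j i' j' :: int where e: "h \<otimes> y [^] i = h' \<otimes> y [^] i'" "h \<otimes> a [^] j = h' \<otimes> a [^] j'"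
        using bc[OF h(1)] bc[OF h(2)] h(3) by (metis prod.inject)
      have hc: "h \<in> carrier G" "h' \<in> carrier G" using h by (auto simp: bad_def in_carrier)
      have q: "inv h' \<otimes> h = s [^] (k' - k)" if "h \<otimes> s [^] k = h' \<otimes> s [^] k'" "s \<in> carrier G" for s and k k' :: int
      proof -
        have "inv h' \<otimes> h = inv h' \<otimes> ((h \<otimes> s [^] k) \<otimes> inv (s [^] k))" using hc that(2) by (simp add: m_assoc)
        also have "\<dots> = (inv h' \<otimes> h') \<otimes> (s [^] k' \<otimes> inv (s [^] k))"
          using hc that(2) by (simp only: that(1)) (simp add: m_assoc cancel)
        finally show ?thesis using hc that(2) by (simp add: int_pow_diff)
      qed
      have "y [^] (i' - i) = a [^] (j' - j)" using q[OF e(1) c(1)] q[OF e(2) c(2)] by simp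
      then have "i' - i = 0" using ya unfolding free_pair_def by blast
      then show "h = h'" using e(1) hc c by simp
    qed
    moreover have "(\<lambda>h. (\<beta> h, \<gamma> h)) ` bad \<subseteq> B \<times> C" using bc by auto
    ultimately show ?thesis using B(1) C(1) finite_imageD finite_subset finite_cartesian_product by metis
  qed
  have "conn x g'" if g': "g' \<in> H - K" "infinite {h. conn g' h}" for g'
  proof -
    obtain h where h: "conn g' h" "h \<notin> bad"
      using g'(2) \<open>finite bad\<close> finite_subset[of "{h. conn g' h}" bad] by blast
    have hH: "h \<in> H" using conn_in[OF h(1)] by simp
    have "conn x h"
      using h(2) hH xh[OF hH ya xg[OF hH] B(2)] 
        xh[OF hH free_pair_sym[OF ya] tends_free_pair[OF ya hH xg[OF hH]] C(2)]
      unfolding bad_def by blast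
    then show ?thesis using h(1) conn_sym conn_trans by blast
  qed
  then show ?thesis using inf x_in by blast
qed

end

lemma one_endedI:
  assumes "group G" "D \<subseteq> carrier G" "H = generate G D"
    and "cayley.free_pair G H y a"
    and "\<And>g. g \<in> D \<Longrightarrow> cayley.free_pair G H (g \<otimes>\<^bsub>G\<^esub> y \<otimes>\<^bsub>G\<^esub> inv\<^bsub>G\<^esub> g) a"
  shows "one_ended G H"
  unfolding one_ended_def
proof (intro allI impI, elim conjE)
  fix S K assume SK: "S \<subseteq> carrier G" "generate G S = H" "finite K" "K \<subseteq> H"
  interpret cayley G H S K
    using assms(1-3) SK group.generate_is_subgroup[OF assms(1,2)]
    by (simp add: cayley_def cayley_axioms_def)
  show "\<exists>g\<in>H - K. infinite {h. cay_conn G H S K g h} \<and>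
      (\<forall>g'\<in>H - K. infinite {h. cay_conn G H S K g' h} \<longrightarrow> cay_conn G H S K g g')"
    using one_end[OF assms(2) assms(3)[symmetric]] assms(4,5) by blast
qed

section \<open>A criterion for not being finitely presented\<close>

definition word_act :: "('i \<Rightarrow> 'x \<Rightarrow> 'x) \<Rightarrow> 'i word \<Rightarrow> 'x \<Rightarrow> 'x" where
  "word_act f w = foldr (\<lambda>l g. (if snd l then Hilbert_Choice.inv (f (fst l)) else f (fst l)) \<circ> g) w id"

lemma word_act_simps [simp]: "word_act f [] = id"
  "word_act f (l # w) = (if snd l then Hilbert_Choice.inv (f (fst l)) else f (fst l)) \<circ> word_act f w"
  by (simp_all add: word_act_def)

lemma word_act_append [simp]: "word_act f (u @ v) = word_act f u \<circ> word_act f v"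
  by (induction u) (auto simp: comp_assoc)

lemma word_act_cong: "(\<And>x. x \<in> fst ` set w \<Longrightarrow> f x = g x) \<Longrightarrow> word_act f w = word_act g w"
  by (induction w) auto

lemma bij_inv_comp: "bij f \<Longrightarrow> Hilbert_Choice.inv f \<circ> f = id" "bij f \<Longrightarrow> f \<circ> Hilbert_Choice.inv f = id"
  by (rule inv_o_cancel[OF bij_is_inj], assumption) (rule surj_iff[THEN iffD1, OF bij_is_surj])

text \<open>Von Dyck's theorem: bijections that satisfy the relators define an action of the
  presented group.\<close>

lemma word_act_rel_equiv:
  assumes "rel_equiv R u v" and "\<And>x. bij (f x)" and "\<And>r. r \<in> R \<Longrightarrow> word_act f r = id"
  shows "word_act f u = word_act f v"
  using assms(1)
proof induction
  case (cancel u v x b)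
  have "word_act f [(x, b), (x, \<not> b)] = id" using assms(2)[of x] by (cases b) (simp_all add: bij_inv_comp)
  then show ?case by (simp only: word_act_append id_comp)
qed (simp_all add: assms(3))

definition word_inv :: "'i word \<Rightarrow> 'i word" where
  "word_inv w = rev (map (\<lambda>(x, b). (x, \<not> b)) w)"

lemma word_inv_simps [simp]: "word_inv [] = []" "word_inv ((x, b) # w) = word_inv w @ [(x, \<not> b)]"
  "fst ` set (word_inv w) = fst ` set w"
  by (simp_all add: word_inv_def image_image case_prod_beta)

lemma word_act_bij: "(\<And>x. bij (f x)) \<Longrightarrow> bij (word_act f w)"
  by (induction w) (auto simp: bij_comp bij_imp_bij_inv bij_id)

lemma word_act_inv:
  assumes "\<And>x. bij (f x)"
  shows "word_act f (word_inv w) \<circ> word_act f w = id"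
proof (induction w)
  case (Cons l w)
  define g where "g = word_act f [(fst l, \<not> snd l)] \<circ> word_act f [l]"
  have "g = id" using assms[of "fst l"] by (cases "snd l") (simp_all add: g_def bij_inv_comp)
  moreover have "word_act f (word_inv (l # w)) \<circ> word_act f (l # w) =
      word_act f (word_inv w) \<circ> g \<circ> word_act f w"
    by (cases l) (simp add: comp_assoc g_def)
  ultimately show ?case using Cons by (simp only: comp_id)
qed simp

lemma word_act_inv_eq:
  assumes "\<And>x. bij (f x)"
  shows "word_act f (word_inv w) = Hilbert_Choice.inv (word_act f w)"
proof -
  have "word_act f (word_inv w) \<circ> (word_act f w \<circ> Hilbert_Choice.inv (word_act f w)) = Hilbert_Choice.inv (word_act f w)"
    unfolding comp_assoc[symmetric] word_act_inv[OF assms] by simp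
  then show ?thesis by (simp add: bij_inv_comp word_act_bij assms)
qed

definition subst_word :: "('x \<Rightarrow> 'y word) \<Rightarrow> 'x word \<Rightarrow> 'y word" where
  "subst_word \<sigma> w = concat (map (\<lambda>(x, b). if b then word_inv (\<sigma> x) else \<sigma> x) w)"

lemma subst_word_simps [simp]: "subst_word \<sigma> [] = []"
  "subst_word \<sigma> ((x, b) # w) = (if b then word_inv (\<sigma> x) else \<sigma> x) @ subst_word \<sigma> w"
  by (simp_all add: subst_word_def)

lemma word_act_subst:
  assumes "\<And>x. bij (f x)"
  shows "word_act f (subst_word \<sigma> w) = word_act (\<lambda>x. word_act f (\<sigma> x)) w"
  by (induction w) (auto simp: word_act_inv_eq[OF assms])

definition gen_word :: "('i \<Rightarrow> 'a) \<Rightarrow> 'i word \<Rightarrow> 'a word" where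
  "gen_word \<gamma> w = map (\<lambda>(x, b). (\<gamma> x, b)) w"

lemma gen_word_simps [simp]: "gen_word \<gamma> [] = []" "gen_word \<gamma> ((x, b) # w) = (\<gamma> x, b) # gen_word \<gamma> w"
  "gen_word \<gamma> (u @ v) = gen_word \<gamma> u @ gen_word \<gamma> v" "gen_word \<gamma> (word_inv w) = word_inv (gen_word \<gamma> w)"
  "fst ` set (gen_word \<gamma> w) = \<gamma> ` fst ` set w"
  by (simp_all add: gen_word_def word_inv_def rev_map image_image case_prod_beta)

lemma fst_subst_word: "fst ` set (subst_word \<sigma> w) = (\<Union>x\<in>fst ` set w. fst ` set (\<sigma> x))"
proof (induction w)
  case (Cons l w)
  then show ?case by (cases l; cases "snd l") (simp_all add: image_Un)
qed simp

context group
begin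

lemma letter_eval_closed [simp]: "fst l \<in> carrier G \<Longrightarrow> letter_eval G l \<in> carrier G"
  by (simp add: letter_eval_def)

lemma word_eval_simps [simp]: "word_eval G [] = \<one>"
  "word_eval G (l # w) = letter_eval G l \<otimes> word_eval G w"
  by (simp_all add: word_eval_def)

lemma word_eval_closed [simp]: "fst ` set w \<subseteq> carrier G \<Longrightarrow> word_eval G w \<in> carrier G"
  by (induction w) auto

lemma word_eval_append [simp]:
  "fst ` set u \<subseteq> carrier G \<Longrightarrow> fst ` set v \<subseteq> carrier G \<Longrightarrow>
    word_eval G (u @ v) = word_eval G u \<otimes> word_eval G v"
  by (induction u) (auto simp: m_assoc)

lemma word_eval_inv:
  "fst ` set w \<subseteq> carrier G \<Longrightarrow> word_eval G (word_inv w) = inv (word_eval G w)"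
  by (induction w) (auto simp: inv_mult_group letter_eval_def)

lemma generate_word:
  assumes "S \<subseteq> carrier G" "h \<in> generate G S"
  shows "\<exists>w. fst ` set w \<subseteq> S \<and> word_eval G w = h"
  using assms(2)
proof (induction rule: generate.induct)
  case one
  then show ?case by (intro exI[of _ "[]"]) auto
next
  case (incl h)
  then show ?case using assms(1) by (intro exI[of _ "[(h, False)]"]) (auto simp: letter_eval_def)
next
  case (inv h)
  then show ?case using assms(1) by (intro exI[of _ "[(h, True)]"]) (auto simp: letter_eval_def)
next
  case (eng h1 h2)
  then obtain w1 w2 where "fst ` set w1 \<subseteq> S" "word_eval G w1 = h1" "fst ` set w2 \<subseteq> S" "word_eval G w2 = h2"
    by blast
  then show ?case using assms(1) by (intro exI[of _ "w1 @ w2"]) auto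
qed

lemma eval_subst_word:
  assumes "\<And>x. x \<in> fst ` set w \<Longrightarrow> fst ` set (\<sigma> x) \<subseteq> J \<and> word_eval G (gen_word \<gamma> (\<sigma> x)) = \<tau> x"
    and "\<gamma> ` J \<subseteq> carrier G"
  shows "word_eval G (gen_word \<gamma> (subst_word \<sigma> w)) = word_eval G (gen_word \<tau> w)"
  using assms(1)
proof (induction w)
  case (Cons l w)
  obtain x b where l: "l = (x, b)" by (cases l)
  have x: "fst ` set (\<sigma> x) \<subseteq> J" "word_eval G (gen_word \<gamma> (\<sigma> x)) = \<tau> x" using Cons.prems[of x] l by auto
  have c: "fst ` set (gen_word \<gamma> (\<sigma> x)) \<subseteq> carrier G" using x(1) assms(2) by auto
  have "fst ` set (subst_word \<sigma> w) \<subseteq> J" using Cons.prems by (auto simp: fst_subst_word)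
  then have d: "fst ` set (gen_word \<gamma> (subst_word \<sigma> w)) \<subseteq> carrier G" using assms(2) by auto
  have IH: "word_eval G (gen_word \<gamma> (subst_word \<sigma> w)) = word_eval G (gen_word \<tau> w)"
    by (rule Cons.IH) (use Cons.prems in auto)
  show ?case using c d IH x(2) l by (cases b) (simp_all add: word_eval_inv letter_eval_def)
qed simp

text \<open>Every relation of H persists in the k-th action for large k. Finitely many relators would make
  the whole group H act for large k, although each action violates some relation of H.\<close>
theorem not_finitely_presentedI:
  fixes \<theta> :: "nat \<Rightarrow> 'i \<Rightarrow> 'x \<Rightarrow> 'x"
  assumes J: "finite J" "\<gamma> ` J \<subseteq> carrier G" and bij: "\<And>k x. bij (\<theta> k x)"
    and limit: "\<And>w. fst ` set w \<subseteq> J \<Longrightarrow> word_eval G (gen_word \<gamma> w) = \<one> \<Longrightarrow>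
      \<exists>k0. \<forall>k\<ge>k0. word_act (\<theta> k) w = id"
    and strict: "\<And>k. \<exists>w. fst ` set w \<subseteq> J \<and> word_eval G (gen_word \<gamma> w) = \<one> \<and> word_act (\<theta> k) w \<noteq> id"
  shows "\<not> finitely_presented G (generate G (\<gamma> ` J))"
proof
  assume "finitely_presented G (generate G (\<gamma> ` J))"
  then obtain S R where SR: "finite S" "S \<subseteq> carrier G" "generate G S = generate G (\<gamma> ` J)" "finite R"
    "\<forall>r\<in>R. fst ` set r \<subseteq> S \<and> word_eval G r = \<one>"
    "\<forall>w. fst ` set w \<subseteq> S \<longrightarrow> word_eval G w = \<one> \<longrightarrow> rel_equiv R w []"
    unfolding finitely_presented_def by (elim exE conjE)
  note S = SR(1-3)
  have R: "finite R" "\<And>r. r \<in> R \<Longrightarrow> fst ` set r \<subseteq> S \<and> word_eval G r = \<one>"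
    and pres: "\<And>w. fst ` set w \<subseteq> S \<Longrightarrow> word_eval G w = \<one> \<Longrightarrow> rel_equiv R w []"
    using SR(4-6) by auto
  have "\<forall>s\<in>S. \<exists>w. fst ` set w \<subseteq> J \<and> word_eval G (gen_word \<gamma> w) = s"
  proof
    fix s assume "s \<in> S"
    then have "s \<in> generate G (\<gamma> ` J)" using S(3) generate.incl by metis
    then obtain w where w: "fst ` set w \<subseteq> \<gamma> ` J" "word_eval G w = s" using generate_word[OF J(2)] by blast
    \<comment> \<open>\<open>\<gamma>\<close> may fail to be injective, so letters are pulled back
      by a chosen section.\<close>
    define \<delta> where "\<delta> = (\<lambda>g. SOME j. j \<in> J \<and> \<gamma> j = g)"
    have d: "\<delta> g \<in> J \<and> \<gamma> (\<delta> g) = g" if "g \<in> \<gamma> ` J" for g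
      unfolding \<delta>_def by (rule someI_ex) (use that in auto)
    have "gen_word \<gamma> (gen_word \<delta> w) = w" "fst ` set (gen_word \<delta> w) \<subseteq> J"
      using w(1) d by (induction w) auto
    then show "\<exists>w. fst ` set w \<subseteq> J \<and> word_eval G (gen_word \<gamma> w) = s" using w(2) by metis
  qed
  from bchoice[OF this] obtain \<sigma> where
    "\<forall>s\<in>S. fst ` set (\<sigma> s) \<subseteq> J \<and> word_eval G (gen_word \<gamma> (\<sigma> s)) = s" ..
  then have \<sigma>: "\<And>s. s \<in> S \<Longrightarrow> fst ` set (\<sigma> s) \<subseteq> J \<and> word_eval G (gen_word \<gamma> (\<sigma> s)) = s" by (rule bspec)
  have "\<forall>j\<in>J. \<exists>w. fst ` set w \<subseteq> S \<and> word_eval G w = \<gamma> j"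
  proof
    fix j assume "j \<in> J"
    then have "\<gamma> j \<in> generate G S" unfolding S(3) by (intro generate.incl) simp
    then show "\<exists>w. fst ` set w \<subseteq> S \<and> word_eval G w = \<gamma> j" by (rule generate_word[OF S(2)])
  qed
  from bchoice[OF this] obtain \<tau> where "\<forall>j\<in>J. fst ` set (\<tau> j) \<subseteq> S \<and> word_eval G (\<tau> j) = \<gamma> j" ..
  then have \<tau>: "\<And>j. j \<in> J \<Longrightarrow> fst ` set (\<tau> j) \<subseteq> S \<and> word_eval G (\<tau> j) = \<gamma> j" by (rule bspec)
  have gid: "gen_word (\<lambda>x. x) w = w" for w :: "'a word" by (simp add: gen_word_def)
  have \<sigma>_eval: "word_eval G (gen_word \<gamma> (subst_word \<sigma> w)) = word_eval G w" if "fst ` set w \<subseteq> S" for w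
  proof -
    have "word_eval G (gen_word \<gamma> (subst_word \<sigma> w)) = word_eval G (gen_word (\<lambda>x. x) w)"
      by (rule eval_subst_word[OF _ J(2)]) (use \<sigma> that in blast)
    then show ?thesis by (simp add: gid)
  qed
  have \<tau>_eval: "word_eval G (subst_word \<tau> w) = word_eval G (gen_word \<gamma> w)" if "fst ` set w \<subseteq> J" for w
  proof -
    have "word_eval G (gen_word (\<lambda>x. x) (subst_word \<tau> w)) = word_eval G (gen_word \<gamma> w)"
      by (rule eval_subst_word[of _ _ S]) (use \<tau> that S(2) in \<open>unfold gid image_ident, blast+\<close>)
    then show ?thesis by (simp add: gid)
  qed
  have \<sigma>_J: "fst ` set (subst_word \<sigma> w) \<subseteq> J" if "fst ` set w \<subseteq> S" for w
    unfolding fst_subst_word using that \<sigma> by blast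
  have \<tau>_S: "fst ` set (subst_word \<tau> w) \<subseteq> S" if "fst ` set w \<subseteq> J" for w
    unfolding fst_subst_word using that \<tau> by blast
  \<comment> \<open>Besides the relators rewritten in the generators J, the words j^-1
    \<open>\<sigma>\<close>(\<open>\<tau>\<close> j) are included: rewriting j in S and back must
    act as j does, or the action of S would say nothing about words in J.\<close>
  define W where "W = subst_word \<sigma> ` R \<union> (\<lambda>j. (j, True) # subst_word \<sigma> (\<tau> j)) ` J"
  have "finite W" using R(1) J(1) by (simp add: W_def)
  moreover have W: "fst ` set w \<subseteq> J \<and> word_eval G (gen_word \<gamma> w) = \<one>" if "w \<in> W" for w
  proof -
    consider r where "r \<in> R" "w = subst_word \<sigma> r" | j where "j \<in> J" "w = (j, True) # subst_word \<sigma> (\<tau> j)"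
      using \<open>w \<in> W\<close> by (auto simp: W_def)
    then show ?thesis
    proof cases
      case 1
      show ?thesis unfolding 1(2) using R(2)[OF 1(1)] \<sigma>_eval[of r] \<sigma>_J[of r] by simp
    next
      case 2
      have "\<gamma> j \<in> carrier G" using 2(1) J(2) by blast
      then show ?thesis unfolding 2(2)
        using \<sigma>_eval[of "\<tau> j"] \<sigma>_J[of "\<tau> j"] \<tau>[OF 2(1)] 2(1) by (simp add: letter_eval_def)
    qed
  qed
  ultimately have "\<exists>k0. \<forall>w\<in>W. \<forall>k\<ge>k0. word_act (\<theta> k) w = id"
  proof (induction W)
    case (insert w W)
    have "\<exists>k1. \<forall>w\<in>W. \<forall>k\<ge>k1. word_act (\<theta> k) w = id"
      by (rule insert.IH) (use insert.prems in blast)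
    then obtain k1 where k1: "\<forall>w\<in>W. \<forall>k\<ge>k1. word_act (\<theta> k) w = id" ..
    obtain k2 where k2: "\<forall>k\<ge>k2. word_act (\<theta> k) w = id" using limit insert.prems by blast
    show ?case by (rule exI[of _ "max k1 k2"]) (use k1 k2 in \<open>unfold max.bounded_iff, blast\<close>)
  qed simp
  then obtain k where "\<forall>w\<in>W. \<forall>k'\<ge>k. word_act (\<theta> k') w = id" ..
  then have k: "word_act (\<theta> k) w = id" if "w \<in> W" for w using that by blast
  \<comment> \<open>S acts through its expressions in J. For the chosen k this action satisfies R,
    hence every relation of H.\<close>
  define f where "f = (\<lambda>s. word_act (\<theta> k) (\<sigma> s))"
  have f_bij: "bij (f s)" for s unfolding f_def by (rule word_act_bij[OF bij])
  have f_R: "word_act f r = id" if "r \<in> R" for r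
    using k[of "subst_word \<sigma> r"] that unfolding W_def f_def word_act_subst[OF bij, symmetric] by blast
  have f_\<tau>: "word_act f (\<tau> j) = \<theta> k j" if "j \<in> J" for j
  proof -
    have "Hilbert_Choice.inv (\<theta> k j) \<circ> word_act f (\<tau> j) = id"
      using k[of "(j, True) # subst_word \<sigma> (\<tau> j)"] that
      unfolding W_def f_def word_act_subst[OF bij, symmetric] by simp
    then have "\<theta> k j \<circ> (Hilbert_Choice.inv (\<theta> k j) \<circ> word_act f (\<tau> j)) = \<theta> k j" by simp
    then show ?thesis using bij[of k j] by (simp add: comp_assoc[symmetric] bij_inv_comp)
  qed
  obtain w where w: "fst ` set w \<subseteq> J" "word_eval G (gen_word \<gamma> w) = \<one>" "word_act (\<theta> k) w \<noteq> id"
    using strict by blast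
  have "rel_equiv R (subst_word \<tau> w) []"
    by (rule pres[OF \<tau>_S[OF w(1)]]) (simp only: \<tau>_eval[OF w(1)] w(2))
  then have "word_act f (subst_word \<tau> w) = word_act f []" by (rule word_act_rel_equiv[OF _ f_bij f_R])
  then have "word_act f (subst_word \<tau> w) = id" by simp
  moreover have "word_act f (subst_word \<tau> w) = word_act (\<theta> k) w"
    unfolding word_act_subst[OF f_bij] by (rule word_act_cong) (use w(1) f_\<tau> in blast)
  ultimately show False using w(3) by simp
qed

end

section \<open>Right-angled reflection groups\<close>

text \<open>The contragredient representation in coordinates: \<open>\<xi> j\<close> is the value of the dual vector on the
  j-th simple root and A is the generalised Cartan matrix.\<close>
definition reflect :: "('i \<Rightarrow> 'i \<Rightarrow> int) \<Rightarrow> 'i \<Rightarrow> ('i \<Rightarrow> int) \<Rightarrow> 'i \<Rightarrow> int" where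
  "reflect A i \<xi> = (\<lambda>j. \<xi> j - A i j * \<xi> i)"

text \<open>The alternative encodes a right-angled Coxeter group: two reflections commute or
  generate an infinite dihedral group. Symmetry is not imposed beyond the pattern of zeros.\<close>

definition cartan :: "'i set \<Rightarrow> ('i \<Rightarrow> 'i \<Rightarrow> int) \<Rightarrow> bool" where
  "cartan I A \<longleftrightarrow> (\<forall>i\<in>I. A i i = 2) \<and>
     (\<forall>i\<in>I. \<forall>j\<in>I. i \<noteq> j \<longrightarrow> A i j = 0 \<and> A j i = 0 \<or> A i j \<le> -2 \<and> A j i \<le> -2)"

text \<open>For a reduced word these are the left descents of the group element: letters that
  commutations alone can bring to the front.\<close>

definition first_letter :: "('i \<Rightarrow> 'i \<Rightarrow> int) \<Rightarrow> 'i \<Rightarrow> 'i list \<Rightarrow> bool" where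
  "first_letter A i u \<longleftrightarrow> (\<exists>v w. u = v @ i # w \<and> (\<forall>j\<in>set v. j \<noteq> i \<and> A i j = 0))"

definition reduced :: "('i \<Rightarrow> 'i \<Rightarrow> int) \<Rightarrow> 'i list \<Rightarrow> bool" where
  "reduced A u \<longleftrightarrow> (\<forall>v i w. u = v @ i # w \<longrightarrow> \<not> first_letter A i w)"

lemma first_letter_Cons:
  "first_letter A i (j # u) \<longleftrightarrow> i = j \<or> A i j = 0 \<and> first_letter A i u"
proof
  assume "first_letter A i (j # u)"
  then obtain v w where v: "j # u = v @ i # w" "\<forall>k\<in>set v. k \<noteq> i \<and> A i k = 0"
    unfolding first_letter_def by blast
  then show "i = j \<or> A i j = 0 \<and> first_letter A i u"
    by (cases v) (auto simp: first_letter_def)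
next
  assume r: "i = j \<or> A i j = 0 \<and> first_letter A i u"
  show "first_letter A i (j # u)"
  proof (cases "i = j")
    case True
    then show ?thesis unfolding first_letter_def by (intro exI[of _ "[]"] exI[of _ u]) auto
  next
    case False
    then have 0: "A i j = 0" "first_letter A i u" using r by auto
    then obtain v w where "u = v @ i # w" "\<forall>k\<in>set v. k \<noteq> i \<and> A i k = 0"
      unfolding first_letter_def by blast
    then show ?thesis using False 0(1) unfolding first_letter_def
      by (intro exI[of _ "j # v"] exI[of _ w]) auto
  qed
qed

lemma reduced_Cons: "reduced A (j # u) \<longleftrightarrow> reduced A u \<and> \<not> first_letter A j u"
proof
  assume r: "reduced A (j # u)"
  have "\<not> first_letter A i w" if "u = v @ i # w" for v i w
    using r[unfolded reduced_def, rule_format, of "j # v" i w] that by simp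
  then show "reduced A u \<and> \<not> first_letter A j u"
    using r[unfolded reduced_def, rule_format, of "[]" j u] by (simp add: reduced_def)
next
  assume r: "reduced A u \<and> \<not> first_letter A j u"
  have "\<not> first_letter A i w" if "j # u = v @ i # w" for v i w
    using that r by (cases v) (auto simp: reduced_def)
  then show "reduced A (j # u)" by (simp add: reduced_def)
qed

text \<open>Ping-pong: the letters that can be moved to the front of a reduced word are exactly the
  negative coordinates of the image of a positive vector.\<close>
lemma reduced_coords:
  assumes A: "cartan I A" and pos: "\<And>i. i \<in> I \<Longrightarrow> \<xi> i > 0"
    and u: "set u \<subseteq> I" "reduced A u"
  defines "\<eta> \<equiv> foldr (reflect A) u \<xi>"
  shows "(\<forall>i\<in>I. if first_letter A i u then \<eta> i < 0 else \<eta> i > 0) \<and>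
    (\<forall>i\<in>I. \<forall>j\<in>I. i \<noteq> j \<longrightarrow> A i j \<noteq> 0 \<longrightarrow> \<eta> i + \<eta> j \<ge> 0)"
  using u unfolding \<eta>_def
proof (induction u)
  case Nil
  then show ?case using pos by (auto simp: first_letter_def add_nonneg_nonneg less_imp_le)
next
  case (Cons k u)
  define \<zeta> where "\<zeta> = foldr (reflect A) u \<xi>"
  have k: "k \<in> I" "\<not> first_letter A k u" and u: "set u \<subseteq> I" "reduced A u"
    using Cons.prems by (auto simp: reduced_Cons)
  have IH1: "\<And>i. i \<in> I \<Longrightarrow> if first_letter A i u then \<zeta> i < 0 else \<zeta> i > 0"
    and IH2: "\<And>i j. i \<in> I \<Longrightarrow> j \<in> I \<Longrightarrow> i \<noteq> j \<Longrightarrow> A i j \<noteq> 0 \<Longrightarrow> \<zeta> i + \<zeta> j \<ge> 0"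
    using Cons.IH[OF u] by (auto simp: \<zeta>_def)
  have zk: "\<zeta> k > 0" using IH1[OF k(1)] k(2) by simp
  define \<theta> where "\<theta> = reflect A k \<zeta>"
  have A2: "A i i = 2" if "i \<in> I" for i using A that by (auto simp: cartan_def)
  have Az: "A i j = 0 \<and> A j i = 0 \<or> A i j \<le> -2 \<and> A j i \<le> -2" if "i \<in> I" "j \<in> I" "i \<noteq> j" for i j
    using A that by (auto simp: cartan_def)
  have tk: "\<theta> k = - \<zeta> k" using A2[OF k(1)] by (simp add: \<theta>_def reflect_def)
  have t0: "\<theta> j = \<zeta> j" if "j \<in> I" "A k j = 0" for j
    using that by (simp add: \<theta>_def reflect_def)
  \<comment> \<open>An entry at most -2 adds at least twice \<open>\<zeta> k\<close>, which
    outweighs a negative \<open>\<zeta> j\<close> because the induction hypothesis bounds it below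
    by \<open>- \<zeta> k\<close>.\<close>
  have t1: "\<theta> j \<ge> \<zeta> j + 2 * \<zeta> k" if "j \<in> I" "j \<noteq> k" "A k j \<noteq> 0" for j
  proof -
    have "A k j \<le> -2" using Az[OF k(1) that(1)] that by auto
    then have "2 * \<zeta> k \<le> (- A k j) * \<zeta> k" using zk by (intro mult_right_mono) auto
    then show ?thesis by (simp add: \<theta>_def reflect_def)
  qed
  have sign: "if first_letter A i (k # u) then \<theta> i < 0 else \<theta> i > 0" if i: "i \<in> I" for i
  proof (cases "i = k")
    case True
    then show ?thesis using tk zk by (simp add: first_letter_Cons)
  next
    case False
    show ?thesis
    proof (cases "A k i = 0")
      case True
      then show ?thesis using False IH1[OF i] t0[OF i] Az[OF i k(1)] by (auto simp: first_letter_Cons)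
    next
      case nz: False
      have "\<zeta> k + \<zeta> i \<ge> 0" using IH2[OF k(1) i] False nz by auto
      then show ?thesis using t1[OF i False nz] zk Az[OF i k(1)] False nz
        by (auto simp: first_letter_Cons)
    qed
  qed
  have up: "\<theta> j \<ge> \<zeta> j" if "j \<in> I" "j \<noteq> k" for j
    using t0[OF that(1)] t1[OF that] zk by (cases "A k j = 0") auto
  have pair_k: "\<theta> k + \<theta> j \<ge> 0" if "j \<in> I" "j \<noteq> k" "A k j \<noteq> 0" for j
    using t1[OF that] tk IH2[OF k(1) that(1)] that by auto
  have "\<theta> i + \<theta> j \<ge> 0" if ij: "i \<in> I" "j \<in> I" "i \<noteq> j" "A i j \<noteq> 0" for i j
    using pair_k[OF ij(2)] pair_k[OF ij(1)] up[OF ij(1)] up[OF ij(2)] IH2[OF ij] Az[OF ij(1-3)] ij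
    by (cases "i = k"; cases "j = k") auto
  moreover have "foldr (reflect A) (k # u) \<xi> = \<theta>" by (simp add: \<theta>_def \<zeta>_def)
  ultimately show ?case using sign by simp
qed

lemma reduced_fixing_positive:
  assumes "cartan I A" "\<And>i. i \<in> I \<Longrightarrow> \<xi> i > 0" "set u \<subseteq> I" "reduced A u"
    and fixed: "\<And>i. i \<in> I \<Longrightarrow> foldr (reflect A) u \<xi> i = \<xi> i"
  shows "u = []"
proof (cases u)
  case (Cons i v)
  then have "first_letter A i u" "i \<in> I" using assms(3) by (auto simp: first_letter_Cons)
  then have "foldr (reflect A) u \<xi> i < 0" using reduced_coords[OF assms(1-4)] by auto
  then show ?thesis using fixed[OF \<open>i \<in> I\<close>] assms(2)[OF \<open>i \<in> I\<close>] by simp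
qed

text \<open>Such an f extends to an action of the right-angled Coxeter group whose letters commute
  where A vanishes.\<close>

definition coxeter_map :: "'i set \<Rightarrow> ('i \<Rightarrow> 'i \<Rightarrow> int) \<Rightarrow> ('i \<Rightarrow> 'x \<Rightarrow> 'x) \<Rightarrow> bool" where
  "coxeter_map I A f \<longleftrightarrow> (\<forall>i\<in>I. f i \<circ> f i = id) \<and>
     (\<forall>i\<in>I. \<forall>j\<in>I. i \<noteq> j \<longrightarrow> A i j = 0 \<longrightarrow> f i \<circ> f j = f j \<circ> f i)"

definition act :: "('i \<Rightarrow> 'x \<Rightarrow> 'x) \<Rightarrow> 'i list \<Rightarrow> 'x \<Rightarrow> 'x" where
  "act f u = foldr (\<lambda>i g. f i \<circ> g) u id"

lemma act_simps [simp]: "act f [] = id" "act f (i # u) = f i \<circ> act f u"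
  by (simp_all add: act_def)

lemma act_append [simp]: "act f (u @ v) = act f u \<circ> act f v"
  by (induction u) auto

lemma act_commute:
  assumes "\<And>j. j \<in> set v \<Longrightarrow> f i \<circ> f j = f j \<circ> f i"
  shows "f i \<circ> act f v = act f v \<circ> f i"
  using assms
proof (induction v)
  case (Cons j v)
  have "f i \<circ> act f (j # v) = (f i \<circ> f j) \<circ> act f v" by (simp add: comp_assoc)
  also have "f i \<circ> f j = f j \<circ> f i" by (rule Cons.prems) simp
  also have "f j \<circ> f i \<circ> act f v = f j \<circ> (f i \<circ> act f v)" by (rule comp_assoc)
  also have "f i \<circ> act f v = act f v \<circ> f i" by (rule Cons.IH[OF Cons.prems]) simp
  finally show ?case by (simp add: comp_assoc)
qed simp

lemma act_delete:
  assumes f: "coxeter_map I A f" and I: "set (v @ i # w @ i # t) \<subseteq> I"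
    and w: "\<forall>j\<in>set w. j \<noteq> i \<and> A i j = 0"
  shows "act f (v @ i # w @ i # t) = act f (v @ w @ t)"
proof -
  have "f i \<circ> f j = f j \<circ> f i" if "j \<in> set w" for j
  proof -
    have "i \<in> I" "j \<in> I" "i \<noteq> j" "A i j = 0" using I w that by auto
    then show ?thesis using f unfolding coxeter_map_def by blast
  qed
  then have c: "f i \<circ> act f w = act f w \<circ> f i" by (rule act_commute)
  have "f i \<circ> f i = id" using f I by (simp add: coxeter_map_def)
  moreover have "act f (v @ i # w @ i # t) = act f v \<circ> (f i \<circ> act f w) \<circ> f i \<circ> act f t"
    by (simp add: comp_assoc)
  ultimately show ?thesis unfolding c by (simp add: comp_assoc)
qed

text \<open>A word that acts trivially under g is either reduced, hence empty by ping-pong, or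
  contains two equal letters that cancel without changing its image under g or f. So every action
  obeying the Coxeter relations factors through the group generated by g.\<close>

theorem trivial_word_act:
  assumes A: "cartan I A" and pos: "\<And>i. i \<in> I \<Longrightarrow> \<xi> i > 0"
    and g: "coxeter_map I A g" and g_refl: "\<And>u. set u \<subseteq> I \<Longrightarrow> act g u = id \<Longrightarrow> (\<forall>i\<in>I. foldr (reflect A) u \<xi> i = \<xi> i)"
    and f: "coxeter_map I A f" and u: "set u \<subseteq> I" "act g u = id"
  shows "act f u = id"
  using u
proof (induction "length u" arbitrary: u rule: less_induct)
  case less
  show ?case
  proof (cases "reduced A u")
    case True
    have "u = []"
      by (rule reduced_fixing_positive[OF A pos less.prems(1) True]) (use g_refl[OF less.prems] in auto)
    then show ?thesis by simp
  next
    case False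
    then obtain v i z where z: "u = v @ i # z" "first_letter A i z" unfolding reduced_def by auto
    then obtain w t where t: "z = w @ i # t" and w: "\<forall>j\<in>set w. j \<noteq> i \<and> A i j = 0"
      unfolding first_letter_def by auto
    have u: "u = v @ i # w @ i # t" using z(1) t by simp
    have I: "set (v @ i # w @ i # t) \<subseteq> I" using less.prems(1) u by simp
    have "act f (v @ w @ t) = id"
    proof (rule less.hyps)
      show "act g (v @ w @ t) = id" using less.prems(2) unfolding u act_delete[OF g I w] .
    qed (use I u in auto)
    then show ?thesis unfolding u act_delete[OF f I w] .
  qed
qed

section \<open>Zariski closures and their tangent spaces\<close>

text \<open>The second function is the formal derivative, at A in direction M. It is a relation
  because \<open>poly_fun\<close> describes functions and not polynomials: derivatives follow a
  construction of f.\<close>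

inductive poly_der :: "nat \<Rightarrow> (real mat \<Rightarrow> real) \<Rightarrow> (real mat \<Rightarrow> real mat \<Rightarrow> real) \<Rightarrow> bool" for n where
  const: "poly_der n (\<lambda>A. c) (\<lambda>A M. 0)"
| entry: "i < n \<Longrightarrow> j < n \<Longrightarrow> poly_der n (\<lambda>A. A $$ (i, j)) (\<lambda>A M. M $$ (i, j))"
| add: "poly_der n f f' \<Longrightarrow> poly_der n g g' \<Longrightarrow> poly_der n (\<lambda>A. f A + g A) (\<lambda>A M. f' A M + g' A M)"
| mult: "poly_der n f f' \<Longrightarrow> poly_der n g g' \<Longrightarrow>
    poly_der n (\<lambda>A. f A * g A) (\<lambda>A M. f' A M * g A + f A * g' A M)"

lemma poly_der_exists: "poly_fun n f \<Longrightarrow> \<exists>f'. poly_der n f f'"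
  by (induction rule: poly_fun.induct) (blast intro: poly_der.intros)+

lemma poly_der_fun: "poly_der n f f' \<Longrightarrow> poly_fun n f"
  by (induction rule: poly_der.induct) (auto intro: poly_fun.intros)

lemma poly_der_linear:
  assumes "poly_der n f f'" "M \<in> carrier_mat n n" "N \<in> carrier_mat n n"
  shows "f' A (a \<cdot>\<^sub>m M + b \<cdot>\<^sub>m N) = a * f' A M + b * f' A N"
  using assms by (induction rule: poly_der.induct) (auto simp: algebra_simps)

definition mat_deriv :: "nat \<Rightarrow> (real \<Rightarrow> real mat) \<Rightarrow> real mat \<Rightarrow> real \<Rightarrow> bool" where
  "mat_deriv n c M s \<longleftrightarrow> (\<forall>t. c t \<in> carrier_mat n n) \<and> M \<in> carrier_mat n n \<and>
    (\<forall>i<n. \<forall>j<n. ((\<lambda>t. c t $$ (i, j)) has_real_derivative M $$ (i, j)) (at s))"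

lemma mult_mat_entry:
  fixes A B :: "'a :: comm_semiring_0 mat"
  assumes "A \<in> carrier_mat n n" "B \<in> carrier_mat n n" "i < n" "j < n"
  shows "(A * B) $$ (i, j) = (\<Sum>k<n. A $$ (i, k) * B $$ (k, j))"
  using assms by (auto simp: scalar_prod_def atLeast0LessThan intro!: sum.cong)

lemma square_mult_closed [simp]:
  "A \<in> carrier_mat n n \<Longrightarrow> B \<in> carrier_mat n n \<Longrightarrow> A * B \<in> carrier_mat n n"
  by (rule mult_carrier_mat)

lemma mat_deriv_mult:
  assumes "mat_deriv n c M s" "mat_deriv n d N s"
  shows "mat_deriv n (\<lambda>t. c t * d t) (M * d s + c s * N) s"
proof -
  have car: "c t \<in> carrier_mat n n" "d t \<in> carrier_mat n n" "M \<in> carrier_mat n n" "N \<in> carrier_mat n n" for t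
    using assms by (auto simp: mat_deriv_def)
  have "((\<lambda>t. (c t * d t) $$ (i, j)) has_real_derivative (M * d s + c s * N) $$ (i, j)) (at s)"
    if ij: "i < n" "j < n" for i j
  proof -
    have "((\<lambda>t. \<Sum>k<n. c t $$ (i, k) * d t $$ (k, j)) has_real_derivative
        (\<Sum>k<n. M $$ (i, k) * d s $$ (k, j) + N $$ (k, j) * c s $$ (i, k))) (at s)"
      by (intro DERIV_sum DERIV_mult) (use assms ij in \<open>auto simp: mat_deriv_def\<close>)
    also have "(\<Sum>k<n. M $$ (i, k) * d s $$ (k, j) + N $$ (k, j) * c s $$ (i, k)) = (M * d s + c s * N) $$ (i, j)"
    proof -
      have "(M * d s + c s * N) $$ (i, j) = (M * d s) $$ (i, j) + (c s * N) $$ (i, j)"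
        using ij car(1)[of s] car(4) by (intro index_add_mat(1)) auto
      then show ?thesis using ij car by (simp add: mult_mat_entry[of _ n] sum.distrib mult.commute)
    qed
    finally show ?thesis using ij car by (simp add: mult_mat_entry[of _ n])
  qed
  then show ?thesis using car by (auto simp: mat_deriv_def)
qed

lemma mat_deriv_const: "A \<in> carrier_mat n n \<Longrightarrow> mat_deriv n (\<lambda>t. A) (0\<^sub>m n n) s"
  by (auto simp: mat_deriv_def)

lemma mat_deriv_line:
  assumes "B \<in> carrier_mat n n" "Y \<in> carrier_mat n n"
  shows "mat_deriv n (\<lambda>t. B + t \<cdot>\<^sub>m Y) Y s"
proof -
  have "(B + t \<cdot>\<^sub>m Y) $$ (i, j) = B $$ (i, j) + t * Y $$ (i, j)" if "i < n" "j < n" for i j t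
    using assms that by simp
  moreover have "((\<lambda>t. a + t * b) has_real_derivative b) (at s)" for a b :: real
    by (auto intro!: derivative_eq_intros)
  ultimately show ?thesis using assms by (simp add: mat_deriv_def)
qed

lemma poly_der_chain:
  assumes "poly_der n f f'" "mat_deriv n c M s"
  shows "((\<lambda>t. f (c t)) has_real_derivative f' (c s) M) (at s)"
  using assms(1)
proof (induction rule: poly_der.induct)
  case (entry i j)
  then show ?case using assms(2) by (auto simp: mat_deriv_def)
next
  case (mult f f' g g')
  then show ?case by (auto intro!: derivative_eq_intros)
qed (auto intro!: derivative_eq_intros)

lemma poly_der_deriv_dir:
  assumes "poly_der n f f'" "mat_deriv n c M s"
  shows "((\<lambda>t. f' A (c t)) has_real_derivative f' A M) (at s)"
  using assms(1)
proof (induction rule: poly_der.induct)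
  case (entry i j)
  then show ?case using assms(2) by (auto simp: mat_deriv_def)
qed (auto intro!: derivative_eq_intros)

lemma poly_fun_sum:
  assumes "finite K" "\<And>k. k \<in> K \<Longrightarrow> poly_fun n (f k)"
  shows "poly_fun n (\<lambda>A. \<Sum>k\<in>K. f k A)"
  using assms by (induction K) (auto intro: poly_fun.intros)

lemma poly_fun_mult_entry:
  assumes "i < n" "j < n"
  shows "poly_fun n (\<lambda>A. \<Sum>k<n. X $$ (i, k) * A $$ (k, j))"
  using assms by (intro poly_fun_sum) (auto intro: poly_fun.intros)

lemma poly_fun_left_mult:
  assumes "poly_fun n f" "X \<in> carrier_mat n n"
  shows "\<exists>g. poly_fun n g \<and> (\<forall>A\<in>carrier_mat n n. g A = f (X * A))"
  using assms(1)
proof (induction rule: poly_fun.induct)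
  case (const c)
  then show ?case by (blast intro: poly_fun.const)
next
  case (entry i j)
  then show ?case using poly_fun_mult_entry[OF entry, of X] mult_mat_entry[OF assms(2) _ entry]
    by (intro exI[of _ "\<lambda>A. \<Sum>k<n. X $$ (i, k) * A $$ (k, j)"]) auto
next
  case (add f g)
  then obtain f1 g1 where "poly_fun n f1" "poly_fun n g1"
    "\<forall>A\<in>carrier_mat n n. f1 A = f (X * A)" "\<forall>A\<in>carrier_mat n n. g1 A = g (X * A)" by blast
  then show ?case by (intro exI[of _ "\<lambda>A. f1 A + g1 A"]) (auto intro: poly_fun.intros)
next
  case (mult f g)
  then obtain f1 g1 where "poly_fun n f1" "poly_fun n g1"
    "\<forall>A\<in>carrier_mat n n. f1 A = f (X * A)" "\<forall>A\<in>carrier_mat n n. g1 A = g (X * A)" by blast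
  then show ?case by (intro exI[of _ "\<lambda>A. f1 A * g1 A"]) (auto intro: poly_fun.intros)
qed

text \<open>Differentiation along the right-invariant field that takes A to X A stays within
  polynomial functions, so that it can be iterated.\<close>

lemma poly_der_vector_field:
  assumes "poly_der n f f'" "X \<in> carrier_mat n n"
  shows "\<exists>g. poly_fun n g \<and> (\<forall>A\<in>carrier_mat n n. g A = f' A (X * A))"
  using assms(1)
proof (induction rule: poly_der.induct)
  case (const c)
  then show ?case by (blast intro: poly_fun.const)
next
  case (entry i j)
  then show ?case using poly_fun_mult_entry[OF entry, of X] mult_mat_entry[OF assms(2) _ entry]
    by (intro exI[of _ "\<lambda>A. \<Sum>k<n. X $$ (i, k) * A $$ (k, j)"]) auto
next
  case (add f f' g g')
  then obtain f1 g1 where "poly_fun n f1" "poly_fun n g1"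
    "\<forall>A\<in>carrier_mat n n. f1 A = f' A (X * A)" "\<forall>A\<in>carrier_mat n n. g1 A = g' A (X * A)" by blast
  then show ?case by (intro exI[of _ "\<lambda>A. f1 A + g1 A"]) (auto intro: poly_fun.intros)
next
  case (mult f f' g g')
  then obtain f1 g1 where "poly_fun n f1" "poly_fun n g1"
    "\<forall>A\<in>carrier_mat n n. f1 A = f' A (X * A)" "\<forall>A\<in>carrier_mat n n. g1 A = g' A (X * A)" by blast
  moreover have "poly_fun n f" "poly_fun n g" using mult.hyps poly_der_fun by blast+
  ultimately show ?case by (intro exI[of _ "\<lambda>A. f1 A * g A + f A * g1 A"]) (auto intro: poly_fun.intros)
qed

definition poly_curve :: "nat \<Rightarrow> (real \<Rightarrow> real mat) \<Rightarrow> bool" where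
  "poly_curve n c \<longleftrightarrow> (\<forall>t. c t \<in> carrier_mat n n) \<and> (\<forall>i<n. \<forall>j<n. \<exists>p. \<forall>t. c t $$ (i, j) = poly p t)"

lemma poly_fun_curve:
  assumes "poly_fun n f" "poly_curve n c"
  shows "\<exists>p. \<forall>t. f (c t) = poly p t"
  using assms(1)
proof (induction rule: poly_fun.induct)
  case (const c)
  then show ?case by (intro exI[of _ "[:c:]"]) auto
next
  case (entry i j)
  then show ?case using assms(2) by (auto simp: poly_curve_def)
next
  case (add f g)
  then show ?case by (metis poly_add)
next
  case (mult f g)
  then show ?case by (metis poly_mult)
qed

lemma poly_curve_mult:
  assumes "poly_curve n c" "A \<in> carrier_mat n n"
  shows "poly_curve n (\<lambda>t. c t * A)"
proof -
  have c: "c t \<in> carrier_mat n n" for t using assms(1) by (simp add: poly_curve_def)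
  have "\<exists>p. \<forall>t. (c t * A) $$ (i, j) = poly p t" if ij: "i < n" "j < n" for i j
  proof -
    have "\<forall>k\<in>{..<n}. \<exists>p. \<forall>t. c t $$ (i, k) = poly p t" using assms(1) ij by (auto simp: poly_curve_def)
    then obtain p where p: "\<And>k t. k < n \<Longrightarrow> c t $$ (i, k) = poly (p k) t" by (metis lessThan_iff)
    have "(c t * A) $$ (i, j) = poly (\<Sum>k<n. smult (A $$ (k, j)) (p k)) t" for t
      using mult_mat_entry[OF c assms(2) ij] p by (simp add: poly_sum mult.commute)
    then show ?thesis by blast
  qed
  then show ?thesis using c assms(2) by (auto simp: poly_curve_def)
qed

lemma poly_zero_nat:
  fixes p :: "real poly"
  assumes "\<And>m::nat. poly p (real m) = 0"
  shows "p = 0"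
proof (rule ccontr)
  assume "p \<noteq> 0"
  then have "finite {x. poly p x = 0}" by (rule poly_roots_finite)
  moreover have "range real \<subseteq> {x. poly p x = 0}" using assms by auto
  moreover have "infinite (range real)" by (simp add: range_inj_infinite inj_on_def)
  ultimately show False using finite_subset by blast
qed

section \<open>Exponentials of matrices with cube zero\<close>

definition unip :: "nat \<Rightarrow> real mat \<Rightarrow> real \<Rightarrow> real mat" where
  "unip n L s = 1\<^sub>m n + (s \<cdot>\<^sub>m L + (s\<^sup>2 / 2) \<cdot>\<^sub>m (L * L))"

locale unipotent_log =
  fixes n :: nat and L :: "real mat"
  assumes L: "L \<in> carrier_mat n n" and L3: "L * (L * L) = 0\<^sub>m n n"
begin

lemma unip_carrier [simp]: "unip n L s \<in> carrier_mat n n"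
  using L by (auto simp: unip_def)

lemma unip_0: "unip n L 0 = 1\<^sub>m n"
  using L by (auto simp: unip_def intro!: eq_matI)

lemma smult_smult: "a \<cdot>\<^sub>m (b \<cdot>\<^sub>m M) = (a * b :: real) \<cdot>\<^sub>m M"
  by (auto intro: eq_matI)

lemma unip_add: "unip n L s * unip n L t = unip n L (s + t)"
proof -
  define M where "M = L * L"
  have M: "M \<in> carrier_mat n n" using L by (simp add: M_def)
  have z: "L * M = 0\<^sub>m n n" "M * L = 0\<^sub>m n n" "M * M = 0\<^sub>m n n"
    using L L3 by (simp_all add: M_def assoc_mult_mat[of L n n L n L n] assoc_mult_mat[of L n n L n "L * L" n])
  note car = L M
  have e: "unip n L s = 1\<^sub>m n + (s \<cdot>\<^sub>m L + (s\<^sup>2 / 2) \<cdot>\<^sub>m M)" for s by (simp add: unip_def M_def)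
  have p: "(a \<cdot>\<^sub>m L) * (b \<cdot>\<^sub>m L) = (a * b) \<cdot>\<^sub>m M" "(a \<cdot>\<^sub>m L) * (b \<cdot>\<^sub>m M) = 0\<^sub>m n n"
    "(a \<cdot>\<^sub>m M) * (b \<cdot>\<^sub>m L) = 0\<^sub>m n n" "(a \<cdot>\<^sub>m M) * (b \<cdot>\<^sub>m M) = 0\<^sub>m n n" for a b
    using car z by (simp_all add: mult_smult_assoc_mat[of _ n n _ n] mult_smult_distrib[of _ n n _ n]
        M_def[symmetric] smult_smult mult.commute)
  have prod: "(s \<cdot>\<^sub>m L + (s\<^sup>2 / 2) \<cdot>\<^sub>m M) * (t \<cdot>\<^sub>m L + (t\<^sup>2 / 2) \<cdot>\<^sub>m M) = (s * t) \<cdot>\<^sub>m M"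
    using car by (simp add: add_mult_distrib_mat[of _ n n _ _ n] mult_add_distrib_mat[of _ n n _ n] p)
  have one: "(1\<^sub>m n + X) * (1\<^sub>m n + Y) = 1\<^sub>m n + (X + Y + X * Y)"
    if "X \<in> carrier_mat n n" "Y \<in> carrier_mat n n" for X Y :: "real mat"
    using that by (simp add: add_mult_distrib_mat[of _ n n _ _ n] mult_add_distrib_mat[of _ n n _ n])
      (auto intro!: eq_matI)
  have "unip n L s * unip n L t = 1\<^sub>m n + ((s \<cdot>\<^sub>m L + (s\<^sup>2 / 2) \<cdot>\<^sub>m M) + (t \<cdot>\<^sub>m L + (t\<^sup>2 / 2) \<cdot>\<^sub>m M) + (s * t) \<cdot>\<^sub>m M)"
    unfolding e by (subst one) (use car in \<open>simp_all add: prod\<close>)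
  also have "\<dots> = unip n L (s + t)"
    unfolding e using car by (auto intro!: eq_matI simp: power2_eq_square field_simps)
  finally show ?thesis .
qed

lemma unip_curve: "poly_curve n (unip n L)"
proof -
  have "unip n L t $$ (i, j) = poly [:(1\<^sub>m n) $$ (i, j), L $$ (i, j), (L * L) $$ (i, j) / 2:] t"
    if "i < n" "j < n" for i j t
    using that L by (simp add: unip_def power2_eq_square algebra_simps del: index_mult_mat(1))
  then show ?thesis unfolding poly_curve_def using unip_carrier by blast
qed

lemma unip_deriv: "mat_deriv n (unip n L) L 0" "mat_deriv n (\<lambda>s. unip n L (- s)) (- L) 0"
proof -
  have e: "unip n L t $$ (i, j) = (1\<^sub>m n) $$ (i, j) + t * L $$ (i, j) + t\<^sup>2 / 2 * (L * L) $$ (i, j)"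
    if "i < n" "j < n" for i j t
    using that L by (simp add: unip_def del: index_mult_mat(1))
  have "((\<lambda>t. a + t * b + t\<^sup>2 / 2 * d) has_real_derivative b) (at 0)"
    "((\<lambda>t. a + (-t) * b + (-t)\<^sup>2 / 2 * d) has_real_derivative -b) (at 0)" for a b d :: real
    by (auto intro!: derivative_eq_intros)
  then show "mat_deriv n (unip n L) L 0" "mat_deriv n (\<lambda>s. unip n L (- s)) (- L) 0"
    using L by (simp_all add: mat_deriv_def e del: index_mult_mat(1))
qed

end

definition lie_subalgebra :: "nat \<Rightarrow> real mat set \<Rightarrow> bool" where
  "lie_subalgebra n S \<longleftrightarrow> S \<subseteq> carrier_mat n n \<and> S \<noteq> {} \<and>
    (\<forall>X\<in>S. \<forall>Y\<in>S. \<forall>a b. a \<cdot>\<^sub>m X + b \<cdot>\<^sub>m Y \<in> S) \<and> (\<forall>X\<in>S. \<forall>Y\<in>S. X * Y - Y * X \<in> S)"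

definition mat_unit :: "nat \<Rightarrow> nat \<Rightarrow> nat \<Rightarrow> real mat" where
  "mat_unit n k l = mat n n (\<lambda>(i, j). if i = k \<and> j = l then 1 else 0)"

section \<open>The Zariski closure of a matrix monoid and its tangent fields\<close>

locale zariski_closure =
  fixes n :: nat and \<Gamma> :: "real mat set"
  assumes \<Gamma>: "\<Gamma> \<subseteq> carrier_mat n n" "1\<^sub>m n \<in> \<Gamma>" "\<And>A B. A \<in> \<Gamma> \<Longrightarrow> B \<in> \<Gamma> \<Longrightarrow> A * B \<in> \<Gamma>"
begin

definition ideal where "ideal = {f. poly_fun n f \<and> (\<forall>A\<in>\<Gamma>. f A = 0)}"

definition closure where "closure = {A \<in> carrier_mat n n. \<forall>f\<in>ideal. f A = 0}"

text \<open>X stands for the right-invariant vector field that takes A to X A. Asking it to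
  annihilate the ideal at all points of the closure, and not only at the identity, spares a proof
  that the closure is a group.\<close>

definition tangent where
  "tangent = {X \<in> carrier_mat n n. \<forall>f f'. poly_der n f f' \<longrightarrow> f \<in> ideal \<longrightarrow> (\<forall>A\<in>closure. f' A (X * A) = 0)}"

lemma \<Gamma>_closure: "\<Gamma> \<subseteq> closure"
  using \<Gamma>(1) by (auto simp: closure_def ideal_def)

lemma closure_carrier: "A \<in> closure \<Longrightarrow> A \<in> carrier_mat n n"
  by (simp add: closure_def)

lemma tangentD: "X \<in> tangent \<Longrightarrow> poly_der n f f' \<Longrightarrow> f \<in> ideal \<Longrightarrow> A \<in> closure \<Longrightarrow> f' A (X * A) = 0"
  by (simp add: tangent_def)

lemma tangent_carrier: "X \<in> tangent \<Longrightarrow> X \<in> carrier_mat n n"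
  by (simp add: tangent_def)

lemma ideal_left_mult:
  assumes "f \<in> ideal" "h \<in> carrier_mat n n" "\<And>A. A \<in> \<Gamma> \<Longrightarrow> h * A \<in> closure"
  shows "\<exists>g\<in>ideal. \<forall>A\<in>carrier_mat n n. g A = f (h * A)"
proof -
  obtain g where g: "poly_fun n g" "\<And>A. A \<in> carrier_mat n n \<Longrightarrow> g A = f (h * A)"
    using poly_fun_left_mult[of n f h] assms by (auto simp: ideal_def)
  then have "g \<in> ideal" using assms \<Gamma>(1) by (auto simp: ideal_def closure_def)
  then show ?thesis using g by blast
qed

lemma closure_left_mult:
  assumes "h \<in> \<Gamma>" "A \<in> closure"
  shows "h * A \<in> closure"
proof -
  have h: "h \<in> carrier_mat n n" using assms \<Gamma> by blast
  have "f (h * A) = 0" if f: "f \<in> ideal" for f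
  proof -
    obtain g where "g \<in> ideal" "\<forall>A\<in>carrier_mat n n. g A = f (h * A)"
      using ideal_left_mult[OF f h] \<Gamma>(3)[OF assms(1)] \<Gamma>_closure by blast
    then show ?thesis using assms(2) by (auto simp: closure_def)
  qed
  then show ?thesis using h closure_carrier[OF assms(2)] by (simp add: closure_def)
qed

lemma tangent_linear:
  assumes "X \<in> tangent" "Y \<in> tangent"
  shows "a \<cdot>\<^sub>m X + b \<cdot>\<^sub>m Y \<in> tangent"
proof -
  note car = assms[THEN tangent_carrier]
  have "f' A ((a \<cdot>\<^sub>m X + b \<cdot>\<^sub>m Y) * A) = 0" if f: "poly_der n f f'" "f \<in> ideal" and A: "A \<in> closure" for f f' A
  proof -
    note cA = closure_carrier[OF A]
    have "(a \<cdot>\<^sub>m X + b \<cdot>\<^sub>m Y) * A = a \<cdot>\<^sub>m (X * A) + b \<cdot>\<^sub>m (Y * A)"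
      using car cA by (simp add: add_mult_distrib_mat[of _ n n _ _ n] mult_smult_assoc_mat[of _ n n _ n])
    then show ?thesis
      using poly_der_linear[OF f(1), of "X * A" "Y * A"] car cA tangentD[OF assms(1) f A] tangentD[OF assms(2) f A]
      by simp
  qed
  then show ?thesis using car by (auto simp: tangent_def)
qed

end

locale closure_unipotent = zariski_closure + unipotent_log +
  assumes L_\<Gamma>: "unip n L 1 \<in> \<Gamma>"
begin

lemma unip_nat_\<Gamma>: "unip n L (real m) \<in> \<Gamma>"
proof (induction m)
  case (Suc m)
  have "unip n L (real (Suc m)) = unip n L (real m) * unip n L 1" by (simp add: unip_add add.commute)
  then show ?case using \<Gamma>(3) Suc L_\<Gamma> by simp
qed (use unip_0 \<Gamma> in simp)

text \<open>All natural powers of the unipotent element lie in \<open>\<Gamma>\<close>. Along the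
  one-parameter group a function of the ideal becomes a polynomial in s that vanishes at all natural
  numbers.\<close>

lemma unip_closure:
  assumes "A \<in> closure"
  shows "unip n L s * A \<in> closure"
proof -
  note cA = closure_carrier[OF assms]
  have "f (unip n L s * A) = 0" if f: "f \<in> ideal" for f
  proof -
    have "poly_fun n f" using f by (simp add: ideal_def)
    from poly_fun_curve[OF this poly_curve_mult[OF unip_curve cA]]
    obtain p where p: "\<And>t. f (unip n L t * A) = poly p t" by blast
    have "poly p (real m) = 0" for m
      using closure_left_mult[OF unip_nat_\<Gamma> assms] f by (simp add: closure_def flip: p)
    then have "p = 0" by (rule poly_zero_nat)
    then show ?thesis using p by simp
  qed
  then show ?thesis using cA by (simp add: closure_def)
qed

lemma L_tangent: "L \<in> tangent"
proof -
  have "f' A (L * A) = 0" if f: "poly_der n f f'" "f \<in> ideal" and A: "A \<in> closure" for f f' A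
  proof -
    note cA = closure_carrier[OF A]
    have "mat_deriv n (\<lambda>t. unip n L t * A) (L * A + unip n L 0 * 0\<^sub>m n n) 0"
      by (rule mat_deriv_mult[OF unip_deriv(1) mat_deriv_const[OF cA]])
    then have "mat_deriv n (\<lambda>t. unip n L t * A) (L * A) 0" using cA L by (simp add: unip_0)
    from poly_der_chain[OF f(1) this]
    have "((\<lambda>t. f (unip n L t * A)) has_real_derivative f' A (L * A)) (at 0)" using cA by (simp add: unip_0)
    moreover have "f (unip n L t * A) = 0" for t using unip_closure[OF A, of t] f by (simp add: closure_def)
    ultimately show ?thesis using DERIV_unique[OF _ DERIV_const] by force
  qed
  then show ?thesis using L by (auto simp: tangent_def)
qed

text \<open>Left translation by the unipotent h preserves the closure, so it pulls f back to a
  function g of the ideal. Applying X to g at h^-1 A gives the derivative of f at A in direction (h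
  X h^-1) A.\<close>

lemma conj_tangent:
  assumes X: "X \<in> tangent"
  shows "unip n L s * X * unip n L (- s) \<in> tangent"
proof -
  define h where "h = unip n L s"
  define k where "k = unip n L (- s)"
  note cX = tangent_carrier[OF X]
  have hk: "h \<in> carrier_mat n n" "k \<in> carrier_mat n n" "h * k = 1\<^sub>m n"
    by (simp_all add: h_def k_def unip_add unip_0)
  have "f' A (h * X * k * A) = 0" if f: "poly_der n f f'" "f \<in> ideal" and A: "A \<in> closure" for f f' A
  proof -
    note cA = closure_carrier[OF A]
    obtain g where g: "g \<in> ideal" "\<And>A. A \<in> carrier_mat n n \<Longrightarrow> g A = f (h * A)"
      using ideal_left_mult[OF f(2) hk(1)] unip_closure \<Gamma>_closure unfolding h_def by blast
    have "poly_fun n g" using g(1) by (simp add: ideal_def)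
    then obtain g' where g': "poly_der n g g'" using poly_der_exists by blast
    define B where "B = k * A"
    have B: "B \<in> closure" "B \<in> carrier_mat n n" using unip_closure[OF A] closure_carrier by (auto simp: B_def k_def)
    have XB: "X * B \<in> carrier_mat n n" using cX B by simp
    have hB: "h * B = A" using hk cA by (simp add: B_def flip: assoc_mult_mat[of h n n k n A n])
    \<comment> \<open>The derivative of g comes from another construction than that of f. The two
      are compared by differentiating one and the same real function along the line through
      B.\<close>
    have d: "mat_deriv n (\<lambda>t. B + t \<cdot>\<^sub>m (X * B)) (X * B) 0"
      by (rule mat_deriv_line[OF B(2) XB])
    have "B + 0 \<cdot>\<^sub>m Y = B" if "Y \<in> carrier_mat n n" for Y using that B(2) by (auto intro!: eq_matI)
    from this[OF XB] have 2: "B + 0 \<cdot>\<^sub>m (X * B) = B" .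
    have "mat_deriv n (\<lambda>t. h * (B + t \<cdot>\<^sub>m (X * B))) (0\<^sub>m n n * (B + 0 \<cdot>\<^sub>m (X * B)) + h * (X * B)) 0"
      by (rule mat_deriv_mult[OF mat_deriv_const[OF hk(1)] d])
    moreover have "0\<^sub>m n n * (B + 0 \<cdot>\<^sub>m (X * B)) + h * (X * B) = h * (X * B)"
      unfolding 2 left_mult_zero_mat[OF B(2)] by (rule left_add_zero_mat[OF square_mult_closed[OF hk(1) XB]])
    ultimately have "mat_deriv n (\<lambda>t. h * (B + t \<cdot>\<^sub>m (X * B))) (h * (X * B)) 0" by simp
    from poly_der_chain[OF f(1) this]
    have 1: "((\<lambda>t. f (h * (B + t \<cdot>\<^sub>m (X * B)))) has_real_derivative f' (h * (B + 0 \<cdot>\<^sub>m (X * B))) (h * (X * B))) (at 0)" .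
    have "((\<lambda>t. g (B + t \<cdot>\<^sub>m (X * B))) has_real_derivative g' (B + 0 \<cdot>\<^sub>m (X * B)) (X * B)) (at 0)"
      by (rule poly_der_chain[OF g' d])
    moreover have "g (B + t \<cdot>\<^sub>m (X * B)) = f (h * (B + t \<cdot>\<^sub>m (X * B)))" for t
      by (rule g(2)) (use B XB in simp)
    ultimately have "((\<lambda>t. f (h * (B + t \<cdot>\<^sub>m (X * B)))) has_real_derivative g' B (X * B)) (at 0)"
      by (simp add: 2)
    moreover have "g' B (X * B) = 0" by (rule tangentD[OF X g' g(1) B(1)])
    ultimately have "f' A (h * (X * B)) = 0" using DERIV_unique[OF 1] by (simp add: 2 hB)
    moreover have "h * (X * B) = h * X * k * A"
      using hk cX cA by (simp add: B_def assoc_mult_mat[of _ n n _ n _ n])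
    ultimately show ?thesis by simp
  qed
  then show ?thesis using hk cX by (auto simp: tangent_def h_def k_def)
qed

text \<open>The bracket is the derivative at 0 of the conjugates in \<open>conj_tangent\<close>, and
  \<open>f' A\<close> is linear in the direction.\<close>

lemma bracket_tangent:
  assumes X: "X \<in> tangent"
  shows "L * X - X * L \<in> tangent"
proof -
  note cX = tangent_carrier[OF X]
  have "f' A ((L * X - X * L) * A) = 0" if f: "poly_der n f f'" "f \<in> ideal" and A: "A \<in> closure" for f f' A
  proof -
    note cA = closure_carrier[OF A]
    have "mat_deriv n (\<lambda>t. unip n L t * X) (L * X + unip n L 0 * 0\<^sub>m n n) 0"
      by (rule mat_deriv_mult[OF unip_deriv(1) mat_deriv_const[OF cX]])
    from mat_deriv_mult[OF mat_deriv_mult[OF this unip_deriv(2)] mat_deriv_const[OF cA]]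
    have "mat_deriv n (\<lambda>t. unip n L t * X * unip n L (- t) * A)
      (((L * X + unip n L 0 * 0\<^sub>m n n) * unip n L (- 0) + unip n L 0 * X * (- L)) * A +
        unip n L 0 * X * unip n L (- 0) * 0\<^sub>m n n) 0" .
    moreover have "((L * X + unip n L 0 * 0\<^sub>m n n) * unip n L (- 0) + unip n L 0 * X * (- L)) * A +
        unip n L 0 * X * unip n L (- 0) * 0\<^sub>m n n = (L * X - X * L) * A"
    proof -
      have "X * (- L) = - (X * L)" using cX L by simp
      moreover have "L * X + - (X * L) = L * X - X * L" using cX L by (auto intro!: eq_matI)
      moreover have "(L * X - X * L) * A \<in> carrier_mat n n"
        by (rule mult_carrier_mat[OF minus_carrier_mat cA]) (use cX L in simp)
      ultimately show ?thesis using cX L cA by (simp add: unip_0)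
    qed
    ultimately have "mat_deriv n (\<lambda>t. unip n L t * X * unip n L (- t) * A) ((L * X - X * L) * A) 0" by simp
    from poly_der_deriv_dir[OF f(1) this]
    have "((\<lambda>t. f' A (unip n L t * X * unip n L (- t) * A)) has_real_derivative f' A ((L * X - X * L) * A)) (at 0)" .
    moreover have "f' A (unip n L t * X * unip n L (- t) * A) = 0" for t
      by (rule tangentD[OF conj_tangent[OF X] f A])
    ultimately show ?thesis using DERIV_unique[OF _ DERIV_const] by force
  qed
  then show ?thesis using cX L by (auto simp: tangent_def)
qed

end

section \<open>Generation by transvections\<close>

lemma mat_unit_carrier [simp]: "mat_unit n k l \<in> carrier_mat n n"
  "dim_row (mat_unit n k l) = n" "dim_col (mat_unit n k l) = n"
  by (simp_all add: mat_unit_def)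

lemma mat_unit_entry: "i < n \<Longrightarrow> j < n \<Longrightarrow> mat_unit n k l $$ (i, j) = (if i = k \<and> j = l then 1 else 0)"
  by (simp add: mat_unit_def)

lemma mat_unit_mult_entry:
  assumes "A \<in> carrier_mat n n" "l < n" "i < n" "j < n"
  shows "(mat_unit n k l * A) $$ (i, j) = (if i = k then A $$ (l, j) else 0)"
proof -
  have "(mat_unit n k l * A) $$ (i, j) = (\<Sum>m<n. if m = l then (if i = k then A $$ (l, j) else 0) else 0)"
    unfolding mult_mat_entry[OF mat_unit_carrier(1) assms(1,3,4)]
    by (rule sum.cong) (use assms in \<open>auto simp: mat_unit_entry\<close>)
  then show ?thesis using assms(2) by simp
qed

lemma add_smult_entry:
  fixes A B :: "real mat"
  assumes "A \<in> carrier_mat n n" "B \<in> carrier_mat n n" "i < n" "j < n"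
  shows "(A + a \<cdot>\<^sub>m B) $$ (i, j) = A $$ (i, j) + a * B $$ (i, j)"
  using assms by auto

lemma addrow_mat_unit:
  fixes A :: "real mat"
  assumes "A \<in> carrier_mat n n" "l < n"
  shows "addrow a k l A = (1\<^sub>m n + a \<cdot>\<^sub>m mat_unit n k l) * A"
proof -
  have "(1\<^sub>m n + a \<cdot>\<^sub>m mat_unit n k l) * A = A + a \<cdot>\<^sub>m (mat_unit n k l * A)"
    using assms by (simp add: add_mult_distrib_mat[of _ n n _ _ n] mult_smult_assoc_mat[of _ n n _ n])
  also have "\<dots> = addrow a k l A"
  proof (rule eq_matI)
    fix i j assume "i < dim_row (addrow a k l A)" "j < dim_col (addrow a k l A)"
    then have ij: "i < n" "j < n" using assms by auto
    then have "(A + a \<cdot>\<^sub>m (mat_unit n k l * A)) $$ (i, j) = A $$ (i, j) + a * (mat_unit n k l * A) $$ (i, j)"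
      using assms by (intro add_smult_entry) simp_all
    then show "(A + a \<cdot>\<^sub>m (mat_unit n k l * A)) $$ (i, j) = addrow a k l A $$ (i, j)"
      using mat_unit_mult_entry[OF assms ij] assms ij by (auto simp: ac_simps)
  qed (use assms in auto)
  finally show ?thesis by simp
qed

context zariski_closure
begin

text \<open>If the unit \<open>E = E\<^sub>k\<^sub>l\<close> is tangent, then \<open>t \<mapsto> f ((1 + t E) A)\<close> is a polynomial whose derivative
  is of the same form, for another function in the ideal; by induction on the degree it vanishes.\<close>
lemma transvection_closure:
  assumes kl: "k < n" "l < n" "k \<noteq> l" and E: "mat_unit n k l \<in> tangent" and A: "A \<in> closure"
  shows "(1\<^sub>m n + t \<cdot>\<^sub>m mat_unit n k l) * A \<in> closure"
proof -
  define X where "X = mat_unit n k l"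
  note cA = closure_carrier[OF A]
  have X: "X \<in> carrier_mat n n" by (simp add: X_def)
  define c where "c = (\<lambda>t. A + t \<cdot>\<^sub>m (X * A))"
  have XA: "X * A \<in> carrier_mat n n" using X cA by simp
  have c: "c t \<in> carrier_mat n n" for t using XA cA by (simp add: c_def)
  have ct: "(1\<^sub>m n + t \<cdot>\<^sub>m X) * A = c t" for t
    using cA X by (simp add: c_def add_mult_distrib_mat[of _ n n _ _ n] mult_smult_assoc_mat[of _ n n _ n])
  have "X * X = 0\<^sub>m n n"
  proof (rule eq_matI)
    fix i j assume "i < dim_row (0\<^sub>m n n)" "j < dim_col (0\<^sub>m n n)"
    then have ij: "i < n" "j < n" by auto
    have "X $$ (l, j) = 0" using ij kl by (simp add: X_def mat_unit_entry)
    then show "(X * X) $$ (i, j) = 0\<^sub>m n n $$ (i, j)"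
      using mat_unit_mult_entry[OF X kl(2) ij, of k] ij by (simp add: X_def del: index_mult_mat(1))
  qed (use X in auto)
  then have "X * (X * A) = 0\<^sub>m n n" using X cA by (simp flip: assoc_mult_mat[of X n n X n A n])
  \<comment> \<open>As X has square zero, the field is constant along the line c. Hence the
    derivative of f along c is the restriction to c of another function of the ideal.\<close>
  then have Xc: "X * c t = X * A" for t
    using X cA XA by (simp add: c_def mult_add_distrib_mat[of _ n n _ n] mult_smult_distrib[of _ n n _ n])
  have curve: "poly_curve n c"
  proof -
    have "c t $$ (i, j) = poly [:A $$ (i, j), (X * A) $$ (i, j):] t" if "i < n" "j < n" for i j t
      unfolding c_def add_smult_entry[OF cA XA that] by simp
    then show ?thesis unfolding poly_curve_def using c by blast
  qed
  have "A + 0 \<cdot>\<^sub>m Y = A" if "Y \<in> carrier_mat n n" for Y using that cA by (auto intro!: eq_matI)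
  from this[OF XA] have c0: "c 0 = A" by (simp only: c_def)
  have p0: "poly p 0 = 0" if "f \<in> ideal" "\<And>t. f (c t) = poly p t" for f p
  proof -
    have "f A = 0" using that(1) A by (simp add: closure_def)
    then show ?thesis using that(2)[of 0] c0 by simp
  qed
  have van: "p = 0" if "degree p \<le> d" "f \<in> ideal" "\<And>t. f (c t) = poly p t" for f p d
    using that
  proof (induction d arbitrary: f p)
    case (0 f p)
    obtain a where "p = [:a:]" using 0(1) degree_eq_zeroE by blast
    then show ?case using p0[OF 0(2,3)] by simp
  next
    case (Suc d f p)
    have pf: "poly_fun n f" using Suc.prems(2) by (simp add: ideal_def)
    obtain f' where f': "poly_der n f f'" using poly_der_exists[OF pf] by blast
    obtain g where g: "poly_fun n g" "\<And>A. A \<in> carrier_mat n n \<Longrightarrow> g A = f' A (X * A)"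
      using poly_der_vector_field[OF f' X] by blast
    have gI: "g \<in> ideal"
    proof -
      have "g B = 0" if "B \<in> \<Gamma>" for B
      proof -
        have "B \<in> closure" using that \<Gamma>_closure by blast
        then show ?thesis using g(2) tangentD[OF E f' Suc.prems(2)] closure_carrier by (simp add: X_def)
      qed
      then show ?thesis using g(1) by (simp add: ideal_def)
    qed
    have "((\<lambda>t. f (c t)) has_real_derivative g (c t)) (at t)" for t
    proof -
      have "mat_deriv n c (X * A) t" unfolding c_def by (rule mat_deriv_line[OF cA XA])
      from poly_der_chain[OF f' this] show ?thesis using g(2)[OF c] by (simp add: Xc)
    qed
    then have "g (c t) = poly (pderiv p) t" for t
      using poly_DERIV[of p t] DERIV_unique unfolding Suc.prems(3) by blast
    moreover have "degree (pderiv p) \<le> d" using Suc.prems(1) by (simp add: degree_pderiv)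
    ultimately have "pderiv p = 0" using Suc.IH gI by blast
    then have "degree p = 0" by (simp add: pderiv_eq_0_iff)
    then obtain a where a: "p = [:a:]" by (rule degree_eq_zeroE)
    then show ?case using p0[OF Suc.prems(2,3)] by simp
  qed
  have "f (c t) = 0" if f: "f \<in> ideal" for f
  proof -
    have "poly_fun n f" using f by (simp add: ideal_def)
    from poly_fun_curve[OF this curve] obtain p where p: "\<And>t. f (c t) = poly p t" by blast
    then have "p = 0" using van[OF le_refl f] by blast
    then show ?thesis using p by simp
  qed
  then show ?thesis using c ct by (simp add: closure_def X_def)
qed

end

text \<open>Gaussian elimination by row additions only, read backwards: P passes from the reduced
  matrix to the original since a row addition is undone by another. A diagonal entry is made 1 by
  adding a multiple of a lower row. In the last column no lower row exists, but there determinant 1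
  forces the entry to be 1.\<close>

lemma SL_transvection_induct:
  fixes B :: "real mat"
  assumes one: "P (1\<^sub>m n)"
    and step: "\<And>A k l a. A \<in> carrier_mat n n \<Longrightarrow> k < n \<Longrightarrow> l < n \<Longrightarrow> k \<noteq> l \<Longrightarrow> P A \<Longrightarrow> P (addrow a k l A)"
    and B: "B \<in> carrier_mat n n" "det B = 1"
  shows "P B"
proof -
  have undo: "P A" if "A \<in> carrier_mat n n" "k < n" "l < n" "k \<noteq> l" "P (addrow a k l A)" for A k l a
  proof -
    have "addrow (-a) k l (addrow a k l A) = A"
      by (rule eq_matI) (use that in \<open>auto simp: algebra_simps\<close>)
    then show ?thesis using step[of "addrow a k l A" k l "-a"] that by simp
  qed
  define cols where "cols = (\<lambda>m A. A \<in> carrier_mat n n \<and> det A = 1 \<and>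
    (\<forall>j<m. \<forall>i<n. A $$ (i, j) = (if i = j then 1 else 0 :: real)))"
  have det_add: "det (addrow a k l A) = det A" if "A \<in> carrier_mat n n" "l < n" "k \<noteq> l" for A :: "real mat" and a k l
    using det_addrow[of l n k A a] that by auto
  have cols_add: "cols m (addrow a k l A)" if "cols m A" "k < n" "l < n" "k \<noteq> l" "m \<le> l" "m \<le> n" for m a k l A
    using that det_add[of A l k a] by (auto simp: cols_def)
  have "P A" if "m \<le> n" "cols m A" for m A
    using that
  proof (induction m arbitrary: A rule: inc_induct)
    case base
    then have "A = 1\<^sub>m n" by (intro eq_matI) (auto simp: cols_def)
    then show ?case using one by simp
  next
    case (step m)
    note m = step.hyps(2)
    have clear: "P C" if "r \<le> n" "cols m C" "C $$ (m, m) = 1" "\<And>i. i < r \<Longrightarrow> i \<noteq> m \<Longrightarrow> C $$ (i, m) = 0" for r C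
      using that
    proof (induction r arbitrary: C rule: inc_induct)
      case base
      then have "cols (Suc m) C" by (auto simp: cols_def less_Suc_eq)
      then show ?case by (rule step.IH)
    next
      case (step r)
      have C: "C \<in> carrier_mat n n" using step.prems by (simp add: cols_def)
      show ?case
      proof (cases "r = m")
        case True
        then show ?thesis using step.IH[of C] step.prems by (metis less_Suc_eq)
      next
        case False
        have "P (addrow (- C $$ (r, m)) r m C)"
          by (rule step.IH) (use False m C step.hyps step.prems cols_add[OF step.prems(1)] in \<open>auto simp: less_Suc_eq\<close>)
        then show ?thesis using undo[OF C step.hyps(2) m False] by blast
      qed
    qed
    have one_at: "P C" if "cols m C" "C $$ (m, m) = 1" for C
      by (rule clear[of 0]) (use that in auto)
    have pivot: "P C" if C: "cols m C" and i: "i > m" "i < n" "C $$ (i, m) \<noteq> 0" for C i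
    proof -
      define a where "a = (1 - C $$ (m, m)) / C $$ (i, m)"
      have cC: "C \<in> carrier_mat n n" using C by (simp add: cols_def)
      have "P (addrow a m i C)"
        by (rule one_at) (use cols_add[OF C] i m cC in \<open>auto simp: a_def\<close>)
      then show ?thesis using undo[OF cC _ i(2), of m a] i m by simp
    qed
    have cA: "A \<in> carrier_mat n n" and dA: "det A = 1" using step.prems by (auto simp: cols_def)
    have cA0: "A $$ (i, j) = (if i = j then 1 else 0)" if "j < m" "i < n" for i j
      using step.prems that by (simp add: cols_def)
    show ?case
    proof (cases "\<exists>i>m. i < n \<and> A $$ (i, m) \<noteq> 0")
      case True
      then show ?thesis using pivot[OF step.prems] by blast
    next
      case False
      have mm: "A $$ (m, m) \<noteq> 0"
      proof
        assume z: "A $$ (m, m) = 0"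
        \<comment> \<open>If column m vanished from row m on, it would be a combination of the
          earlier columns, which are unit vectors; v records this dependence.\<close>
        define v where "v = vec n (\<lambda>j. if j = m then 1 else if j < m then - A $$ (j, m) else 0)"
        have "A *\<^sub>v v = 0\<^sub>v n"
        proof (rule eq_vecI)
          fix i assume "i < dim_vec (0\<^sub>v n :: real vec)"
          then have i: "i < n" by simp
          have "(A *\<^sub>v v) $ i = (\<Sum>j<n. A $$ (i, j) * v $ j)"
            using cA i by (auto simp: v_def scalar_prod_def atLeast0LessThan intro!: sum.cong)
          also have "\<dots> = (\<Sum>j<n. (if j = m then A $$ (i, m) else 0) + (if j = i then (if i < m then - A $$ (i, m) else 0) else 0))"
            using i cA0 by (intro sum.cong) (auto simp: v_def)
          also have "\<dots> = A $$ (i, m) + (if i < m then - A $$ (i, m) else 0)"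
            using i m by (simp add: sum.distrib)
          also have "\<dots> = 0" using i False z by (cases i m rule: linorder_cases) auto
          finally show "(A *\<^sub>v v) $ i = 0\<^sub>v n $ i" using i by simp
        qed (use cA in auto)
        moreover have "v \<in> carrier_vec n" "v \<noteq> 0\<^sub>v n"
          using m by (auto simp: v_def vec_eq_iff)
        ultimately have "det A = 0" using det_0_iff_vec_prod_zero[OF cA] by blast
        then show False using dA by simp
      qed
      show ?thesis
      proof (cases "Suc m < n")
        case True
        \<comment> \<open>The nonzero diagonal entry is first copied one row down, so that
          \<open>pivot\<close> applies.\<close>
        have "P (addrow 1 (Suc m) m A)"
          by (rule pivot[of _ "Suc m"]) (use cols_add[OF step.prems] True m mm cA False in auto)
        then show ?thesis using undo[OF cA True m, of 1] by simp
      next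
        case last: False
        then have n: "n = Suc m" using m by simp
        have "upper_triangular A" using cA0 cA n by (auto simp: upper_triangular_def)
        then have "det A = prod_list (diag_mat A)" by (rule det_upper_triangular[OF _ cA])
        also have "\<dots> = (\<Prod>i<n. A $$ (i, i))"
          using cA by (simp add: prod_list_diag_prod atLeast0LessThan)
        also have "\<dots> = A $$ (m, m)" using cA0 n by simp
        finally show ?thesis using one_at[OF step.prems] dA by simp
      qed
    qed
  qed
  from this[of 0 B] B show ?thesis by (simp add: cols_def)
qed

section \<open>From generation of a Lie algebra to Zariski density\<close>

lemma bracket_jacobi:
  fixes X Y Z :: "real mat"
  assumes "X \<in> carrier_mat n n" "Y \<in> carrier_mat n n" "Z \<in> carrier_mat n n"
  shows "(X * Y - Y * X) * Z - Z * (X * Y - Y * X) =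
    1 \<cdot>\<^sub>m (X * (Y * Z - Z * Y) - (Y * Z - Z * Y) * X) + (-1) \<cdot>\<^sub>m (Y * (X * Z - Z * X) - (X * Z - Z * X) * Y)"
proof -
  have gen: "(P - Q) - (R - S) = 1 \<cdot>\<^sub>m ((P - T) - (U - S)) + (-1) \<cdot>\<^sub>m ((Q - U) - (T - R))"
    if "P \<in> carrier_mat n n" "Q \<in> carrier_mat n n" "R \<in> carrier_mat n n" "S \<in> carrier_mat n n"
      "T \<in> carrier_mat n n" "U \<in> carrier_mat n n" for P Q R S T U :: "real mat"
    using that by (auto intro!: eq_matI)
  have m: "(M - N) * K = M * K - N * K" "K * (M - N) = K * M - K * N"
    if "M \<in> carrier_mat n n" "N \<in> carrier_mat n n" "K \<in> carrier_mat n n" for M N K :: "real mat"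
    using minus_mult_distrib_mat[OF that] mult_minus_distrib_mat[OF that(3,1,2)] by auto
  show ?thesis
    using assms gen[of "X * (Y * Z)" "Y * (X * Z)" "Z * (X * Y)" "Z * (Y * X)" "X * (Z * Y)" "Y * (Z * X)"]
    by (simp add: m assoc_mult_mat[of _ n n _ n _ n])
qed

theorem zariski_dense_SL_lie:
  assumes H: "H \<subseteq> carrier_mat n n" "1\<^sub>m n \<in> H" "\<And>A B. A \<in> H \<Longrightarrow> B \<in> H \<Longrightarrow> A * B \<in> H"
    and \<Lambda>: "\<And>L. L \<in> \<Lambda> \<Longrightarrow> L \<in> carrier_mat n n \<and> L * (L * L) = 0\<^sub>m n n \<and> unip n L 1 \<in> map_mat real_of_int ` H"
      "\<Lambda> \<noteq> {}"
    and gen: "\<And>S k l. lie_subalgebra n S \<Longrightarrow> \<Lambda> \<subseteq> S \<Longrightarrow> k < n \<Longrightarrow> l < n \<Longrightarrow> k \<noteq> l \<Longrightarrow> mat_unit n k l \<in> S"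
  shows "zariski_dense_SL n H"
proof -
  define \<Gamma> where "\<Gamma> = map_mat real_of_int ` H"
  interpret zariski_closure n \<Gamma>
  proof
    show "A * B \<in> \<Gamma>" if AB: "A \<in> \<Gamma>" "B \<in> \<Gamma>" for A B
    proof -
      obtain A' B' where A': "A' \<in> H" "A = map_mat real_of_int A'" and B': "B' \<in> H" "B = map_mat real_of_int B'"
        using AB by (auto simp: \<Gamma>_def)
      have "A' \<in> carrier_mat n n" "B' \<in> carrier_mat n n" using A' B' H(1) by auto
      then have "map_mat real_of_int (A' * B') = A * B"
        unfolding A'(2) B'(2) by (rule of_int_hom.mat_hom_mult)
      then show ?thesis using H(3)[OF A'(1) B'(1)] unfolding \<Gamma>_def by (metis image_eqI)
    qed
    have "map_mat real_of_int (1\<^sub>m n) = 1\<^sub>m n" by (rule of_int_hom.mat_hom_one)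
    then show "1\<^sub>m n \<in> \<Gamma>" using H(2) unfolding \<Gamma>_def by (metis image_eqI)
    show "\<Gamma> \<subseteq> carrier_mat n n" using H(1) by (auto simp: \<Gamma>_def)
  qed
  \<comment> \<open>\<open>tangent\<close> is only known to be stable under brackets with logarithms
    of elements of H. The part of it that normalises it contains these logarithms and is a Lie
    algebra by the Jacobi identity, so it contains all that they generate.\<close>
  define N where "N = {Y \<in> tangent. \<forall>X\<in>tangent. Y * X - X * Y \<in> tangent}"
  have "\<Lambda> \<subseteq> N"
  proof
    fix L assume L: "L \<in> \<Lambda>"
    interpret closure_unipotent n \<Gamma> L by unfold_locales (use \<Lambda>(1)[OF L] in \<open>auto simp: \<Gamma>_def\<close>)
    show "L \<in> N" using L_tangent bracket_tangent by (simp add: N_def)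
  qed
  moreover have "lie_subalgebra n N"
    unfolding lie_subalgebra_def
  proof (intro conjI ballI allI)
    show "N \<subseteq> carrier_mat n n" using tangent_carrier by (auto simp: N_def)
    show "N \<noteq> {}" using \<open>\<Lambda> \<subseteq> N\<close> \<Lambda>(2) by blast
  next
    fix X Y :: "real mat" and a b :: real assume XY: "X \<in> N" "Y \<in> N"
    then have t: "X \<in> tangent" "Y \<in> tangent" by (auto simp: N_def)
    note c = t[THEN tangent_carrier]
    have "(a \<cdot>\<^sub>m X + b \<cdot>\<^sub>m Y) * Z - Z * (a \<cdot>\<^sub>m X + b \<cdot>\<^sub>m Y) \<in> tangent" if Z: "Z \<in> tangent" for Z
    proof -
      note cZ = tangent_carrier[OF Z]
      have g: "(a \<cdot>\<^sub>m P + b \<cdot>\<^sub>m Q) - (a \<cdot>\<^sub>m R + b \<cdot>\<^sub>m S) = a \<cdot>\<^sub>m (P - R) + b \<cdot>\<^sub>m (Q - S)"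
        if "P \<in> carrier_mat n n" "Q \<in> carrier_mat n n" "R \<in> carrier_mat n n" "S \<in> carrier_mat n n" for P Q R S
        using that by (auto intro!: eq_matI simp: algebra_simps)
      have "(a \<cdot>\<^sub>m X + b \<cdot>\<^sub>m Y) * Z - Z * (a \<cdot>\<^sub>m X + b \<cdot>\<^sub>m Y) =
          a \<cdot>\<^sub>m (X * Z - Z * X) + b \<cdot>\<^sub>m (Y * Z - Z * Y)"
        using c cZ by (simp add: add_mult_distrib_mat[of _ n n _ _ n] mult_add_distrib_mat[of _ n n _ n]
            mult_smult_assoc_mat[of _ n n _ n] mult_smult_distrib[of _ n n _ n] g)
      then show ?thesis using tangent_linear XY Z by (simp add: N_def)
    qed
    then show "a \<cdot>\<^sub>m X + b \<cdot>\<^sub>m Y \<in> N" using tangent_linear[OF t] by (simp add: N_def)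
  next
    fix X Y :: "real mat" assume XY: "X \<in> N" "Y \<in> N"
    then have t: "X \<in> tangent" "Y \<in> tangent" by (auto simp: N_def)
    have "(X * Y - Y * X) * Z - Z * (X * Y - Y * X) \<in> tangent" if Z: "Z \<in> tangent" for Z
      unfolding bracket_jacobi[OF t[THEN tangent_carrier] tangent_carrier[OF Z]]
      by (rule tangent_linear) (use XY Z in \<open>auto simp: N_def\<close>)
    then show "X * Y - Y * X \<in> N" using XY t by (simp add: N_def)
  qed
  ultimately have E: "mat_unit n k l \<in> tangent" if "k < n" "l < n" "k \<noteq> l" for k l
    using gen that by (auto simp: N_def)
  have "B \<in> closure" if "B \<in> carrier_mat n n" "det B = 1" for B
  proof (rule SL_transvection_induct[OF _ _ that])
    show "1\<^sub>m n \<in> closure" using \<Gamma>_closure \<Gamma>(2) by blast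
  next
    fix A k l a assume "A \<in> carrier_mat n n" "k < n" "l < n" "k \<noteq> l" "A \<in> closure"
    then show "addrow a k l A \<in> closure"
      using transvection_closure[OF _ _ _ E] by (simp add: addrow_mat_unit)
  qed
  moreover have "f \<in> ideal" if "poly_fun n f" "\<forall>A\<in>H. f (map_mat real_of_int A) = 0" for f
    unfolding ideal_def using that by (simp add: \<Gamma>_def)
  ultimately show ?thesis
    unfolding zariski_dense_SL_def SL_real_def by (fastforce simp: closure_def)
qed

section \<open>The reflections\<close>

declare One_nat_def [simp del]

text \<open>Simple roots are the coordinate functionals \<open>e\<^sub>0, \<dots>, e\<^sub>n\<^sub>-\<^sub>1\<close> and \<open>e\<^sub>n = (-1, 2, 2, 1, 1, 0, \<dots>)\<close>; the
  reflection with index i is \<open>x \<mapsto> x - e\<^sub>i(x) \<phi>\<^sub>i\<close>. Indices below 3 and indices between 3 and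
  n span two commuting factors; \<open>\<phi>\<^sub>n\<close> differs from \<open>-\<phi>\<^sub>0 + 2 \<phi>\<^sub>1 + 2 \<phi>\<^sub>2 + \<phi>\<^sub>3 + \<phi>\<^sub>4\<close>, which prevents
  the reflections from preserving a bilinear form.\<close>
definition \<phi> :: "nat \<Rightarrow> nat \<Rightarrow> nat \<Rightarrow> int" where
  "\<phi> n i u = (if i = n then (if u = 0 then -12 else if u = 1 then -2 else if u = 2 then -3 else if u < 5 then 0 else -4)
    else if i = u then 2
    else if i < 3 \<and> u < 3 then (if i = 0 \<or> u = 0 then -2 else -4)
    else if 3 \<le> i \<and> 3 \<le> u then -2 else 0)"

definition root :: "nat \<Rightarrow> nat \<Rightarrow> nat \<Rightarrow> int" where
  "root n i v = (if i = n then (if v = 0 then -1 else if v < 3 then 2 else if v < 5 then 1 else 0)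
    else if v = i then 1 else 0)"

definition dot :: "nat \<Rightarrow> (nat \<Rightarrow> 'a::comm_ring_1) \<Rightarrow> (nat \<Rightarrow> 'a) \<Rightarrow> 'a" where
  "dot n x y = (\<Sum>w<n. x w * y w)"

definition ev :: "nat \<Rightarrow> nat \<Rightarrow> (nat \<Rightarrow> 'a::comm_ring_1) \<Rightarrow> 'a" where
  "ev n i x = (if i = n then - x 0 + 2 * x 1 + 2 * x 2 + x 3 + x 4 else x i)"

lemma dot_root:
  assumes "n \<ge> 6" "i \<le> n"
  shows "dot n (\<lambda>w. of_int (root n i w)) x = ev n i x"
proof (cases "i = n")
  case True
  have n: "{..<n} = {0, 1, 2, 3, 4} \<union> {5..<n}" using assms(1) by auto
  have "dot n (\<lambda>w. of_int (root n i w)) x =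
      (\<Sum>w\<in>{0, 1, 2, 3, 4}. of_int (root n i w) * x w) + (\<Sum>w\<in>{5..<n}. of_int (root n i w) * x w)"
    unfolding dot_def n by (rule sum.union_disjoint) auto
  moreover have "(\<Sum>w\<in>{5..<n}. of_int (root n i w) * x w) = 0"
    by (rule sum.neutral) (use True in \<open>auto simp: root_def\<close>)
  ultimately show ?thesis using True by (simp add: root_def ev_def)
next
  case False
  have "dot n (\<lambda>w. of_int (root n i w)) x = (\<Sum>w<n. if w = i then x i else 0)"
    unfolding dot_def by (rule sum.cong) (use False in \<open>auto simp: root_def\<close>)
  then show ?thesis using False assms by (simp add: ev_def)
qed

definition cart :: "nat \<Rightarrow> nat \<Rightarrow> nat \<Rightarrow> int" where
  "cart n i j = ev n j (\<phi> n i)"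

lemma cartan_cart: "n \<ge> 6 \<Longrightarrow> cartan {..n} (cart n)"
  unfolding cartan_def by (auto simp: cart_def ev_def \<phi>_def)

text \<open>The pairs with -2 both ways include all those from which the generators are built. The
  asymmetry sits elsewhere: between n and 0 the entries are -12 and -10, between n and 2 they are -3
  and -2.\<close>

lemma cart_values:
  assumes "n \<ge> 6"
  shows "cart n 0 1 = -2" "cart n 1 0 = -2" "cart n 0 2 = -2" "cart n 2 0 = -2" "cart n n 1 = -2" "cart n 1 n = -2"
    "3 \<le> i \<Longrightarrow> i < n \<Longrightarrow> 3 \<le> j \<Longrightarrow> j < n \<Longrightarrow> i \<noteq> j \<Longrightarrow> cart n i j = -2"
    "i < 3 \<Longrightarrow> 3 \<le> j \<Longrightarrow> j < n \<Longrightarrow> cart n i j = 0 \<and> cart n j i = 0"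
    "3 \<le> j \<Longrightarrow> j < 5 \<Longrightarrow> cart n n j = 0 \<and> cart n j n = 0"
    "i \<le> n \<Longrightarrow> cart n i i = 2"
  using assms by (auto simp: cart_def ev_def \<phi>_def)

section \<open>Logarithms of products of two reflections generate the special linear Lie algebra\<close>

definition fmat :: "nat \<Rightarrow> (nat \<Rightarrow> nat \<Rightarrow> 'a) \<Rightarrow> 'a mat" where
  "fmat n F = mat n n (\<lambda>(u, v). F u v)"

definition fmult :: "nat \<Rightarrow> (nat \<Rightarrow> nat \<Rightarrow> 'a) \<Rightarrow> (nat \<Rightarrow> nat \<Rightarrow> 'a) \<Rightarrow> nat \<Rightarrow> nat \<Rightarrow> 'a::comm_ring_1" where
  "fmult n F G u v = (\<Sum>w<n. F u w * G w v)"

lemma fmat_carrier [simp]: "fmat n F \<in> carrier_mat n n"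
  by (simp add: fmat_def)

lemma fmat_entry [simp]: "u < n \<Longrightarrow> v < n \<Longrightarrow> fmat n F $$ (u, v) = F u v"
  by (simp add: fmat_def)

lemma fmat_cong: "(\<And>u v. u < n \<Longrightarrow> v < n \<Longrightarrow> F u v = G u v) \<Longrightarrow> fmat n F = fmat n G"
  by (auto simp: fmat_def intro!: eq_matI)

lemma fmat_mult: "fmat n F * fmat n G = fmat n (fmult n F G)"
proof (rule eq_matI)
  fix u v assume "u < dim_row (fmat n (fmult n F G))" "v < dim_col (fmat n (fmult n F G))"
  then have uv: "u < n" "v < n" by (auto simp: fmat_def)
  show "(fmat n F * fmat n G) $$ (u, v) = fmat n (fmult n F G) $$ (u, v)"
    using uv mult_mat_entry[OF fmat_carrier fmat_carrier uv, of F G] by (simp add: fmult_def)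
qed (simp_all add: fmat_def)

lemma fmat_minus: "fmat n F - fmat n G = fmat n (\<lambda>u v. F u v - G u v)"
  by (auto simp: fmat_def intro!: eq_matI)

lemma fmat_lin: "a \<cdot>\<^sub>m fmat n F + b \<cdot>\<^sub>m fmat n G = fmat n (\<lambda>u v. a * F u v + b * G u v)"
  by (auto simp: fmat_def intro!: eq_matI)

text \<open>All matrices of this section are differences of two outer products.\<close>
lemma fmult_outer:
  "fmult n (\<lambda>u v. a u * x v - b u * y v) (\<lambda>u v. c u * z v - d u * t v) u v =
    a u * (dot n x c * z v - dot n x d * t v) - b u * (dot n y c * z v - dot n y d * t v)"
  unfolding fmult_def dot_def
  by (simp add: algebra_simps sum.distrib sum_subtractf sum_distrib_left sum_distrib_right)

abbreviation \<phi>r :: "nat \<Rightarrow> nat \<Rightarrow> nat \<Rightarrow> real" where "\<phi>r n i u \<equiv> real_of_int (\<phi> n i u)"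

abbreviation er :: "nat \<Rightarrow> nat \<Rightarrow> nat \<Rightarrow> real" where "er n i v \<equiv> real_of_int (root n i v)"

text \<open>When both Cartan entries of i and j are -2, this is the logarithm of the product of the
  reflections i and j, as \<open>pair_unip\<close> shows.\<close>

definition Lf :: "nat \<Rightarrow> nat \<Rightarrow> nat \<Rightarrow> nat \<Rightarrow> nat \<Rightarrow> real" where
  "Lf n i j = (\<lambda>u v. \<phi>r n j u * er n i v - \<phi>r n i u * er n j v)"

locale log_algebra =
  fixes n :: nat and S :: "real mat set"
  assumes n: "n \<ge> 6" and S: "lie_subalgebra n S"
begin

definition mem :: "(nat \<Rightarrow> nat \<Rightarrow> real) \<Rightarrow> bool" where "mem F \<longleftrightarrow> fmat n F \<in> S"

lemma mem_lin: "mem F \<Longrightarrow> mem G \<Longrightarrow> mem (\<lambda>u v. a * F u v + b * G u v)"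
  using S unfolding mem_def lie_subalgebra_def fmat_lin[symmetric] by blast

lemma mem_cong: "mem F \<Longrightarrow> (\<And>u v. u < n \<Longrightarrow> v < n \<Longrightarrow> F u v = G u v) \<Longrightarrow> mem G"
  unfolding mem_def using fmat_cong by metis

lemma mem_comb:
  assumes "mem F" "mem G" "\<And>u v. u < n \<Longrightarrow> v < n \<Longrightarrow> K u v = a * F u v + b * G u v"
  shows "mem K"
  by (rule mem_cong[OF mem_lin[OF assms(1,2)]]) (rule assms(3)[symmetric])

lemma mem_sum:
  assumes "finite I" "I \<noteq> {}" "\<And>i. i \<in> I \<Longrightarrow> mem (F i)"
  shows "mem (\<lambda>u v. \<Sum>i\<in>I. F i u v)"
  using assms
proof (induction rule: finite_ne_induct)
  case (insert i I)
  have "mem (F i)" "mem (\<lambda>u v. \<Sum>i\<in>I. F i u v)" by (rule insert.prems insert.IH, simp add: insert.prems)+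
  then show ?case by (rule mem_comb[where a = 1 and b = 1]) (simp add: insert.hyps)
qed simp

lemma mem_bracket:
  assumes "mem F" "mem G" "\<And>u v. u < n \<Longrightarrow> v < n \<Longrightarrow> K u v = fmult n F G u v - fmult n G F u v"
  shows "mem K"
proof -
  have "fmat n F * fmat n G - fmat n G * fmat n F \<in> S"
    using S assms(1,2) unfolding mem_def lie_subalgebra_def by blast
  then have "mem (\<lambda>u v. fmult n F G u v - fmult n G F u v)" by (simp only: mem_def fmat_mult fmat_minus)
  then show ?thesis by (rule mem_cong) (rule assms(3)[symmetric])
qed

lemma dot_er [simp]: "i \<le> n \<Longrightarrow> dot n (er n i) x = ev n i x"
  using dot_root[OF n, of i x] by simp

lemma fmult_L:
  assumes "i \<le> n" "j \<le> n"
  shows "fmult n (Lf n i j) (\<lambda>u v. c u * z v - d u * t v) u v =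
    \<phi>r n j u * (ev n i c * z v - ev n i d * t v) - \<phi>r n i u * (ev n j c * z v - ev n j d * t v)"
  unfolding Lf_def fmult_outer using assms by simp

lemma fmult_LL:
  assumes "i \<le> n" "j \<le> n"
  shows "fmult n (Lf n i j) (Lf n k l) u v =
    \<phi>r n j u * (ev n i (\<phi>r n l) * er n k v - ev n i (\<phi>r n k) * er n l v) -
    \<phi>r n i u * (ev n j (\<phi>r n l) * er n k v - ev n j (\<phi>r n k) * er n l v)"
  unfolding Lf_def[of n k l] by (rule fmult_L[OF assms])

definition rank1 :: "(nat \<Rightarrow> real) \<Rightarrow> nat \<Rightarrow> nat \<Rightarrow> nat \<Rightarrow> real" where
  "rank1 c k = (\<lambda>u v. c u * er n k v)"

lemma fmult_L_rank1:
  "i \<le> n \<Longrightarrow> j \<le> n \<Longrightarrow> fmult n (Lf n i j) (rank1 c k) u v =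
    \<phi>r n j u * (ev n i c * er n k v) - \<phi>r n i u * (ev n j c * er n k v)"
  using fmult_L[of i j c "er n k" "\<lambda>_. 0" "\<lambda>_. 0" u v] by (simp add: rank1_def ev_def)

lemma fmult_rank1_L:
  "k \<le> n \<Longrightarrow> fmult n (rank1 c k) (Lf n i j) u v =
    c u * (ev n k (\<phi>r n j) * er n i v - ev n k (\<phi>r n i) * er n j v)"
  using fmult_outer[of n c "er n k" "\<lambda>_. 0" "\<lambda>_. 0" "\<phi>r n j" "er n i" "\<phi>r n i" "er n j" u v]
  by (simp add: rank1_def Lf_def)

lemma fmult_rank1:
  "k \<le> n \<Longrightarrow> fmult n (rank1 c k) (rank1 d l) u v = c u * (ev n k d * er n l v)"
  using fmult_outer[of n c "er n k" "\<lambda>_. 0" "\<lambda>_. 0" d "er n l" "\<lambda>_. 0" "\<lambda>_. 0" u v]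
  by (simp add: rank1_def)

lemma ev_lt: "i < n \<Longrightarrow> ev n i x = x i"
  by (simp add: ev_def)

lemma ev_n: "ev n n x = - x 0 + 2 * x 1 + 2 * x 2 + x 3 + x 4"
  by (simp add: ev_def)

lemma \<phi>_values: "\<phi> n 0 1 = -2" "\<phi> n 1 0 = -2" "\<phi> n 0 2 = -2" "\<phi> n 2 0 = -2" "\<phi> n 1 2 = -4" "\<phi> n 2 1 = -4"
    "i < n \<Longrightarrow> \<phi> n i i = 2" "3 \<le> i \<Longrightarrow> i < n \<Longrightarrow> 3 \<le> j \<Longrightarrow> i \<noteq> j \<Longrightarrow> \<phi> n i j = -2"
    "i < 3 \<Longrightarrow> 3 \<le> j \<Longrightarrow> \<phi> n i j = 0" "i < 3 \<Longrightarrow> 3 \<le> j \<Longrightarrow> j < n \<Longrightarrow> \<phi> n j i = 0"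
    "\<phi> n n 0 = -12" "\<phi> n n 1 = -2" "\<phi> n n 2 = -3" "\<phi> n n 3 = 0" "\<phi> n n 4 = 0" "5 \<le> i \<Longrightarrow> \<phi> n n i = -4"
  using n by (auto simp: \<phi>_def)

lemma \<phi>_sym: "i < n \<Longrightarrow> j < n \<Longrightarrow> \<phi> n i j = \<phi> n j i"
  by (auto simp: \<phi>_def)

text \<open>Below n the coroots pair symmetrically and these matrices are infinitesimal rotations of
  the resulting form. The bracket of two that share i contains \<open>Lf n j k\<close> with
  coefficient 2, the value of root i on its own coroot.\<close>

lemma L_triangle:
  assumes "mem (Lf n i j)" "mem (Lf n i k)" "i < n" "j < n" "k < n"
  shows "mem (Lf n j k)"
proof -
  define K where "K = (\<lambda>u v. \<phi>r n i k * Lf n i j u v + 2 * Lf n j k u v - \<phi>r n i j * Lf n i k u v)"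
  have "mem K"
    by (rule mem_bracket[OF assms(1,2)])
      (use assms(3-) \<phi>_sym[of j i] \<phi>_sym[of k i] \<phi>_sym[of k j] in
        \<open>simp add: K_def fmult_LL ev_lt \<phi>_values(7), simp add: Lf_def field_simps\<close>)
  then have "mem (\<lambda>u v. 1 * K u v + (- \<phi>r n i k) * Lf n i j u v)" using assms(1) by (rule mem_lin)
  from this assms(2) show ?thesis
    by (rule mem_comb[where a = "1 / 2" and b = "\<phi>r n i j / 2"]) (simp add: K_def algebra_simps)
qed

lemma L_flip: "mem (Lf n i j) \<Longrightarrow> mem (Lf n j i)"
  by (rule mem_comb[of "Lf n i j" "Lf n i j" _ "-1" 0]) (auto simp: Lf_def)

text \<open>The generator d supplies only the sum. Its part in Q commutes with everything in P, so a
  bracket with \<open>Lf n 0 1\<close> yields X = \<open>Lf n 0 2\<close> + \<open>Lf n 1 2\<close>.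
  The bracket of the sum with X gives, modulo \<open>Lf n 0 1\<close>, the element 4
  \<open>Lf n 0 2\<close> - 2 \<open>Lf n 1 2\<close>, and the two can be solved for
  \<open>Lf n 0 2\<close>.\<close>

lemma L_split:
  assumes L01: "mem (Lf n 0 1)" and D: "mem (\<lambda>u v. Lf n 0 2 u v + Lf n 3 5 u v)"
  shows "mem (Lf n 0 2)" "mem (Lf n 3 5)"
proof -
  have dist: "fmult n (\<lambda>u v. F u v + G u v) H u v = fmult n F H u v + fmult n G H u v"
    "fmult n H (\<lambda>u v. F u v + G u v) u v = fmult n H F u v + fmult n H G u v" for F G H :: "nat \<Rightarrow> nat \<Rightarrow> real" and u v
    by (simp_all add: fmult_def algebra_simps sum.distrib)
  define K where "K = (\<lambda>u v. -2 * Lf n 0 1 u v + 2 * Lf n 1 2 u v + 2 * Lf n 0 2 u v)"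
  have "mem K"
    by (rule mem_bracket[OF L01 D]) (use n in \<open>simp add: K_def dist fmult_LL ev_lt \<phi>_values, simp add: Lf_def field_simps\<close>)
  from this L01 have X: "mem (\<lambda>u v. Lf n 0 2 u v + Lf n 1 2 u v)"
    by (rule mem_comb[where a = "1/2" and b = 1]) (simp add: K_def field_simps)
  define M where "M = (\<lambda>u v. 4 * Lf n 0 2 u v + 2 * Lf n 0 1 u v - 2 * Lf n 1 2 u v)"
  have "mem M"
    by (rule mem_bracket[OF D X]) (use n in \<open>simp add: M_def dist fmult_LL ev_lt \<phi>_values, simp add: Lf_def field_simps\<close>)
  from mem_lin[OF this L01, of 1 "-2"] X show L02: "mem (Lf n 0 2)"
    by (rule mem_comb[where a = "1/6" and b = "1/3"]) (simp add: M_def field_simps)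
  from D L02 show "mem (Lf n 3 5)" by (rule mem_comb[where a = 1 and b = "-1"]) simp
qed

lemma all_L:
  assumes L01: "mem (Lf n 0 1)" and D: "mem (\<lambda>u v. Lf n 0 2 u v + Lf n 3 5 u v)"
    and Q: "\<And>j. 4 \<le> j \<Longrightarrow> j < n \<Longrightarrow> j \<noteq> 5 \<Longrightarrow> mem (Lf n 3 j)" and T: "mem (Lf n n 1)"
    and jk: "j < n" "k < n"
  shows "mem (Lf n j k)"
proof -
  note L02 = L_split(1)[OF L01 D] and L35 = L_split(2)[OF L01 D]
  \<comment> \<open>This is the first link between the two blocks. Of the pairings between the
    indices 3, 5 and the indices n, 1 only those of 5 with n are nonzero, equal to -4 both ways; so
    the bracket collapses to 4 \<open>Lf n 3 1\<close>.\<close>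
  have L31: "mem (Lf n 3 1)"
    by (rule mem_comb[where a = "1/4" and b = 0, OF mem_bracket[OF L35 T HOL.refl] L01])
      (use n in \<open>simp add: fmult_LL ev_lt ev_n \<phi>_values, simp add: Lf_def field_simps\<close>)
  have L12: "mem (Lf n 1 2)" using L_triangle[OF L01 L02] n by simp
  have L30: "mem (Lf n 3 0)" using L_triangle[OF L_flip[OF L31] L_flip[OF L01]] n by simp
  have L32: "mem (Lf n 3 2)" using L_triangle[OF L_flip[OF L31] L12] n by simp
  have L3: "mem (Lf n 3 j)" if "j < n" for j
  proof -
    consider "j = 0" | "j = 1" | "j = 2" | "j = 3" | "j = 5" | "4 \<le> j" "j \<noteq> 5" by linarith
    then show ?thesis
    proof cases
      case 4
      then show ?thesis using mem_comb[OF L01 L01, of "Lf n 3 3" 0 0] by (simp add: Lf_def)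
    qed (use L30 L31 L32 L35 Q that in auto)
  qed
  show ?thesis using L_triangle[OF L3 L3] jk n by simp
qed

text \<open>As c vanishes on the first block, \<open>Lf n 1 j\<close> kills it from the left, and
  the bracket only changes the functional from root 1 to a combination of roots 1 and j.\<close>

lemma rank1_move:
  assumes "mem (rank1 c 1)" "c 0 = 0" "c 1 = 0" "c 2 = 0" "mem (Lf n 1 j)" "j < 3"
  shows "mem (rank1 c j)"
proof -
  have "j = 0 \<or> j = 1 \<or> j = 2" using assms(6) by linarith
  then have c: "ev n 1 c = 0" "ev n j c = 0" using assms(2-4) n by (auto simp: ev_lt)
  show ?thesis
    by (rule mem_comb[where a = "1/2" and b = "\<phi>r n j 1 / 2", OF mem_bracket[OF assms(5,1) HOL.refl] assms(1)])
      (use n assms(6) c in \<open>simp add: fmult_L_rank1 fmult_rank1_L, simp add: ev_lt \<phi>_values rank1_def field_simps\<close>)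
qed

text \<open>If the last coroot were the same combination of coroots as the last root is of roots,
  \<open>Lf n n 1\<close> would add nothing to the rotations. Its defect \<open>\<epsilon>\<close>
  leaves one matrix of rank one, and brackets with rotations spread that matrix over all
  positions.\<close>

lemma mat_units:
  assumes L: "\<And>j k. j < n \<Longrightarrow> k < n \<Longrightarrow> mem (Lf n j k)" and T: "mem (Lf n n 1)"
    and kl: "k < n" "l < n" "k \<noteq> l"
  shows "mat_unit n k l \<in> S"
proof -
  define \<epsilon> where "\<epsilon> = (\<lambda>u::nat. if u = 0 then 2 else if u = 2 then 1 else 0 :: real)"
  define \<iota> where "\<iota> = (\<lambda>(q::nat) u. if u = q then 1 else 0 :: real)"
  have er: "er n n v = - er n 0 v + 2 * er n 1 v + 2 * er n 2 v + er n 3 v + er n 4 v" for v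
    using n by (simp add: root_def)
  have \<phi>n: "\<phi>r n n u = - \<phi>r n 0 u + 2 * \<phi>r n 1 u + 2 * \<phi>r n 2 u + \<phi>r n 3 u + \<phi>r n 4 u - \<epsilon> u" if "u < n" for u
    using n that by (simp add: \<phi>_def \<epsilon>_def)
  have L': "mem (Lf n 0 1)" "mem (Lf n 2 1)" "mem (Lf n 3 1)" "mem (Lf n 4 1)" using L n by auto
  have \<epsilon>1: "mem (rank1 \<epsilon> 1)"
    by (rule mem_comb[where a = 1 and b = 1, OF mem_lin[OF mem_lin[OF L'(3,4), of "-1" "-1"] L'(2), of 1 "-2"]
        mem_lin[OF L'(1) T, of 1 1]])
      (simp add: Lf_def rank1_def er \<phi>n algebra_simps)
  have \<epsilon>i: "mem (rank1 \<epsilon> i)" if "3 \<le> i" "i < n" for i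
    by (rule mem_comb[where a = "-1/2" and b = 0, OF mem_bracket[OF L[of i 1] \<epsilon>1 HOL.refl] \<epsilon>1])
      (use n that in \<open>simp_all add: fmult_L_rank1 fmult_rank1_L, simp add: ev_lt \<phi>_values \<epsilon>_def rank1_def field_simps\<close>)
  have \<phi>1: "mem (rank1 (\<phi>r n i) 1)" if "3 \<le> i" "i < n" for i
    by (rule mem_comb[where a = "-1/2" and b = 1, OF mem_bracket[OF L[of i 0] \<epsilon>1 HOL.refl] \<epsilon>i[OF that]])
      (use n that in \<open>simp_all add: fmult_L_rank1 fmult_rank1_L, simp add: ev_lt \<phi>_values \<epsilon>_def rank1_def field_simps\<close>)
  have \<iota>1: "mem (rank1 (\<iota> q) 1)" if q: "3 \<le> q" "q < n" for q
  proof -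
    have s: "mem (\<lambda>u v. \<Sum>i\<in>{3..<n}. rank1 (\<phi>r n i) 1 u v)"
      by (rule mem_sum) (use n \<phi>1 in auto)
    \<comment> \<open>A coroot of Q is 4 times a unit vector minus 2 times the all-ones vector of
      that block. The coroots therefore sum to 4 - 2 (n - 3) times the all-ones vector, a nonzero
      multiple for n at least 6.\<close>
    have sum_\<phi>: "(\<Sum>i\<in>{3..<n}. \<phi>r n i u) = (if 3 \<le> u then 10 - 2 * real n else 0)" if u: "u < n" for u
    proof (cases "3 \<le> u")
      case True
      have "(\<Sum>i\<in>{3..<n}. \<phi>r n i u) = (\<Sum>i\<in>{3..<n}. (if i = u then 4 else 0) - 2)"
        by (rule sum.cong) (use True u in \<open>auto simp: \<phi>_def\<close>)
      also have "\<dots> = 4 - 2 * real (n - 3)" using True u by (simp add: sum_subtractf)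
      finally show ?thesis using True n by (simp add: of_nat_diff)
    next
      case False
      then show ?thesis by (auto simp: \<phi>_def intro!: sum.neutral)
    qed
    from s have "mem (\<lambda>u v. (if 3 \<le> u then 10 - 2 * real n else 0) * er n 1 v)"
      by (rule mem_cong) (simp add: rank1_def sum_\<phi> flip: sum_distrib_right)
    from this \<phi>1[OF q] have "mem (rank1 (\<lambda>u. if 3 \<le> u then 1 else 0) 1)"
      by (rule mem_comb[where a = "1 / (10 - 2 * real n)" and b = 0]) (use n in \<open>simp add: rank1_def\<close>)
    from \<phi>1[OF q] this show ?thesis
      by (rule mem_comb[where a = "1/4" and b = "1/2"]) (use q in \<open>auto simp: rank1_def \<iota>_def \<phi>_def\<close>)
  qed
  have QP: "mem (rank1 (\<iota> q) p)" "mem (rank1 (\<phi>r n q) p)" if "3 \<le> q" "q < n" "p < 3" for p q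
  proof -
    have "mem (Lf n 1 p)" using L n that by simp
    from rank1_move[OF \<iota>1[OF that(1,2)] _ _ _ this that(3)] rank1_move[OF \<phi>1[OF that(1,2)] _ _ _ this that(3)]
    show "mem (rank1 (\<iota> q) p)" "mem (rank1 (\<phi>r n q) p)" using that by (simp_all add: \<iota>_def \<phi>_def)
  qed
  have PQ: "mem (rank1 (\<phi>r n p) q)" if "3 \<le> q" "q < n" "p < 3" for p q
    by (rule mem_comb[where a = 1 and b = 1, OF L[of q p] QP(2)[OF that]])
      (use that in \<open>auto simp: Lf_def rank1_def\<close>)
  have PQ': "mem (rank1 (\<iota> p) q)" if q: "3 \<le> q" "q < n" and p: "p < 3" for p q
  proof -
    note r = PQ[OF q]
    \<comment> \<open>The three coroots of P form an invertible matrix; for instance the last two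
      minus the first is -6 times the first unit vector.\<close>
    have \<phi>P: "\<phi>r n 0 u = 2 * \<iota> 0 u - 2 * \<iota> 1 u - 2 * \<iota> 2 u" "\<phi>r n 1 u = - 2 * \<iota> 0 u + 2 * \<iota> 1 u - 4 * \<iota> 2 u"
      "\<phi>r n 2 u = - 2 * \<iota> 0 u - 4 * \<iota> 1 u + 2 * \<iota> 2 u" for u
      using n by (auto simp: \<phi>_def \<iota>_def)
    have "mem (rank1 (\<iota> 0) q)"
      by (rule mem_comb[where a = "-1/6" and b = "-1/6", OF mem_lin[OF r[of 0] r[of 1], of "-1" 1] r[of 2]])
        (simp_all add: rank1_def \<phi>P algebra_simps)
    moreover have "mem (rank1 (\<iota> 1) q)"
      by (rule mem_comb[where a = "-1/6" and b = "-1/6", OF r[of 0] r[of 2]])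
        (simp_all add: rank1_def \<phi>P algebra_simps)
    moreover have "mem (rank1 (\<iota> 2) q)"
      by (rule mem_comb[where a = "-1/6" and b = "-1/6", OF r[of 0] r[of 1]])
        (simp_all add: rank1_def \<phi>P algebra_simps)
    moreover have "p = 0 \<or> p = 1 \<or> p = 2" using p by linarith
    ultimately show ?thesis by auto
  qed
  have via: "mem (rank1 (\<iota> k) l)" if "mem (rank1 (\<iota> k) m)" "mem (rank1 (\<iota> m) l)" "k \<noteq> l" "k < n" "l < n" "m < n" for k l m
    by (rule mem_bracket[OF that(1,2)])
      (use that(3-) in \<open>simp add: fmult_rank1, simp add: ev_lt \<iota>_def rank1_def\<close>)
  \<comment> \<open>A unit with both indices in one block is the bracket of two units passing
    through an index of the other block.\<close>
  have "mem (rank1 (\<iota> k) l)"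
  proof (cases "k < 3"; cases "l < 3")
    assume "k < 3" "l < 3"
    then show ?thesis using via[OF PQ'[of 3 k] QP(1)[of 3 l]] kl n by simp
  next
    assume "\<not> k < 3" "\<not> l < 3"
    then show ?thesis using via[OF QP(1)[of k 0] PQ'[of l 0]] kl n by simp
  qed (use kl PQ' QP in auto)
  moreover have "fmat n (rank1 (\<iota> k) l) = mat_unit n k l"
    using kl by (auto simp: fmat_def mat_unit_def rank1_def \<iota>_def root_def intro!: eq_matI)
  ultimately show ?thesis by (simp add: mem_def)
qed

end

section \<open>The group\<close>

definition rfun :: "nat \<Rightarrow> nat \<Rightarrow> nat \<Rightarrow> nat \<Rightarrow> int" where
  "rfun n i = (\<lambda>u v. (if u = v then 1 else 0) - \<phi> n i u * root n i v)"

definition rmat :: "nat \<Rightarrow> nat \<Rightarrow> int mat" where "rmat n i = fmat n (rfun n i)"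

definition wmat :: "nat \<Rightarrow> nat list \<Rightarrow> int mat" where
  "wmat n u = foldr (\<lambda>i M. rmat n i * M) u (1\<^sub>m n)"

lemma rmat_carrier [simp]: "rmat n i \<in> carrier_mat n n"
  by (simp add: rmat_def)

lemma wmat_carrier [simp]: "wmat n u \<in> carrier_mat n n"
  by (induction u) (simp_all add: wmat_def)

lemma wmat_simps [simp]: "wmat n [] = 1\<^sub>m n" "wmat n (i # u) = rmat n i * wmat n u"
  by (simp_all add: wmat_def)

lemma wmat_unit [simp]: "1\<^sub>m n * wmat n u = wmat n u" "wmat n u * 1\<^sub>m n = wmat n u"
  "1\<^sub>m n * rmat n i = rmat n i" "rmat n i * 1\<^sub>m n = rmat n i"
  by (rule left_mult_one_mat right_mult_one_mat wmat_carrier rmat_carrier)+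

lemma wmat_append: "wmat n (u @ v) = wmat n u * wmat n v"
  by (induction u) (simp_all add: assoc_mult_mat[of _ n n _ n _ n])

text \<open>Reversing a word inverts it because the letters act as involutions.\<close>

definition pow_word :: "'a list \<Rightarrow> int \<Rightarrow> 'a list" where
  "pow_word u j = concat (replicate (nat \<bar>j\<bar>) (if 0 \<le> j then u else rev u))"

lemma set_pow_word: "set (pow_word u j) \<subseteq> set u"
  by (auto simp: pow_word_def)

lemma act_power: "act f (concat (replicate m u)) = act f u ^^ m"
  by (induction m) auto

lemma act_rev:
  assumes "coxeter_map I A f" "set u \<subseteq> I"
  shows "act f (rev u) \<circ> act f u = id"
  using assms(2)
proof (induction u)
  case (Cons i u)
  have "act f (rev (i # u)) \<circ> act f (i # u) = act f (rev u) \<circ> (f i \<circ> f i) \<circ> act f u"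
    by (simp add: comp_assoc)
  also have "f i \<circ> f i = id" using assms(1) Cons.prems by (simp add: coxeter_map_def)
  finally show ?case using Cons by simp
qed simp

section \<open>Words in the reflections and faithfulness of the matrix representation\<close>

locale reflections =
  fixes n :: nat
  assumes n: "n \<ge> 6"
begin

lemma ev_cart: "ev n j (\<phi> n i) = cart n i j"
  by (simp add: cart_def)

lemma dot_root_int: "i \<le> n \<Longrightarrow> dot n (root n i) x = ev n i x"
  using dot_root[OF n, of i x] by simp

lemma fmult_rfun:
  assumes "i \<le> n" "j \<le> n" "u < n" "v < n"
  shows "fmult n (rfun n i) (rfun n j) u v = (if u = v then 1 else 0) - \<phi> n i u * root n i v
    - \<phi> n j u * root n j v + \<phi> n i u * cart n j i * root n j v"
proof -
  have "fmult n (rfun n i) (rfun n j) u v =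
    (\<Sum>w<n. (if w = u then rfun n j u v else 0) - \<phi> n i u * (if w = v then root n i v else 0)
       + \<phi> n i u * (root n i w * \<phi> n j w) * root n j v)"
    unfolding fmult_def by (rule sum.cong) (auto simp: rfun_def algebra_simps)
  also have "\<dots> = rfun n j u v - \<phi> n i u * root n i v + \<phi> n i u * dot n (root n i) (\<phi> n j) * root n j v"
    using assms(3,4) by (simp add: sum.distrib sum_subtractf dot_def sum_distrib_left[symmetric] sum_distrib_right[symmetric])
  finally show ?thesis using assms by (simp add: dot_root_int ev_cart rfun_def)
qed

lemma fmat_one: "fmat n (\<lambda>u v. if u = v then 1 else 0) = 1\<^sub>m n"
  by (auto simp: fmat_def intro!: eq_matI)

lemma rmat_square: "i \<le> n \<Longrightarrow> rmat n i * rmat n i = 1\<^sub>m n"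
  unfolding rmat_def fmat_mult fmat_one[symmetric]
  by (rule fmat_cong) (simp add: fmult_rfun cart_values(10)[OF n])

lemma rmat_commute:
  "i \<le> n \<Longrightarrow> j \<le> n \<Longrightarrow> cart n i j = 0 \<Longrightarrow> cart n j i = 0 \<Longrightarrow> rmat n i * rmat n j = rmat n j * rmat n i"
  unfolding rmat_def fmat_mult by (rule fmat_cong) (simp add: fmult_rfun)

definition far :: "nat list \<Rightarrow> nat list \<Rightarrow> bool" where
  "far u v \<longleftrightarrow> (\<forall>i\<in>set u. \<forall>j\<in>set v. i \<le> n \<and> j \<le> n \<and> cart n i j = 0 \<and> cart n j i = 0)"

lemma wmat_commute:
  assumes "far u v"
  shows "wmat n u * wmat n v = wmat n v * wmat n u"
  using assms
proof (induction u)
  case Nil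
  then show ?case by simp
next
  case (Cons i u)
  have i: "rmat n i * wmat n v = wmat n v * rmat n i"
    using Cons.prems
  proof (induction v)
    case Nil
    then show ?case by simp
  next
    case (Cons j v)
    have "far (i # u) v" using Cons.prems by (simp add: far_def)
    then have IH: "rmat n i * wmat n v = wmat n v * rmat n i" by (rule Cons.IH)
    have ij: "rmat n i * rmat n j = rmat n j * rmat n i" using Cons.prems by (intro rmat_commute) (auto simp: far_def)
    have "rmat n i * wmat n (j # v) = (rmat n i * rmat n j) * wmat n v"
      by (simp add: assoc_mult_mat[of _ n n _ n _ n])
    also have "\<dots> = rmat n j * (rmat n i * wmat n v)" unfolding ij by (simp add: assoc_mult_mat[of _ n n _ n _ n])
    also have "\<dots> = wmat n (j # v) * rmat n i" unfolding IH by (simp add: assoc_mult_mat[of _ n n _ n _ n])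
    finally show ?case .
  qed
  have IH: "wmat n u * wmat n v = wmat n v * wmat n u" using Cons by (simp add: far_def)
  have "wmat n (i # u) * wmat n v = rmat n i * (wmat n v * wmat n u)"
    unfolding IH[symmetric] by (simp add: assoc_mult_mat[of _ n n _ n _ n])
  also have "\<dots> = (wmat n v * rmat n i) * wmat n u" unfolding i[symmetric] by (simp add: assoc_mult_mat[of _ n n _ n _ n])
  also have "\<dots> = wmat n v * wmat n (i # u)" by (simp add: assoc_mult_mat[of _ n n _ n _ n])
  finally show ?case .
qed

lemma wmat_rev: "set u \<subseteq> {..n} \<Longrightarrow> wmat n u * wmat n (rev u) = 1\<^sub>m n"
proof (induction u)
  case Nil
  then show ?case using left_mult_one_mat[OF one_carrier_mat] by simp
next
  case (Cons i u)
  have "wmat n (i # u) * wmat n (rev (i # u)) = rmat n i * ((wmat n u * wmat n (rev u)) * rmat n i)"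
    by (simp add: wmat_append assoc_mult_mat[of _ n n _ n _ n])
  then show ?case using Cons rmat_square[of i] by simp
qed

lemma wmat_conj:
  assumes "far p v" "set p \<subseteq> {..n}"
  shows "wmat n (p @ v @ rev p) = wmat n v"
proof -
  have "wmat n (p @ v @ rev p) = (wmat n p * wmat n v) * wmat n (rev p)"
    by (simp add: wmat_append assoc_mult_mat[of _ n n _ n _ n])
  also have "\<dots> = wmat n v * (wmat n p * wmat n (rev p))"
    unfolding wmat_commute[OF assms(1)] by (simp add: assoc_mult_mat[of _ n n _ n _ n])
  finally show ?thesis using wmat_rev[OF assms(2)] by simp
qed

text \<open>The reflection as a permutation of a whole type, leaving the coordinates from n on
  alone, so that triviality of a word can be stated as equality with \<open>id\<close>.\<close>

definition vact :: "nat \<Rightarrow> (nat \<Rightarrow> int) \<Rightarrow> nat \<Rightarrow> int" where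
  "vact i x = (\<lambda>u. if u < n then x u - \<phi> n i u * ev n i x else x u)"

lemma ev_vact: "i \<le> n \<Longrightarrow> j \<le> n \<Longrightarrow> ev n j (vact i x) = ev n j x - cart n i j * ev n i x"
  using n by (auto simp: vact_def ev_def cart_def algebra_simps)

lemma vact_coxeter: "coxeter_map {..n} (cart n) vact"
proof -
  have "vact i \<circ> vact i = id" if "i \<le> n" for i
  proof (intro ext)
    fix x u show "(vact i \<circ> vact i) x u = id x u"
      using ev_vact[OF that that, of x] cart_values(10)[OF n that]
      by (cases "u < n") (simp_all add: vact_def algebra_simps)
  qed
  moreover have "vact i \<circ> vact j = vact j \<circ> vact i" if "i \<le> n" "j \<le> n" "i \<noteq> j" "cart n i j = 0" for i j
  proof (intro ext)
    fix x u
    have "cart n i j = 0 \<and> cart n j i = 0 \<or> cart n i j \<le> -2 \<and> cart n j i \<le> -2"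
      using cartan_cart[OF n] that(1-3) unfolding cartan_def by blast
    then have "cart n j i = 0" using that(4) by auto
    then show "(vact i \<circ> vact j) x u = (vact j \<circ> vact i) x u"
      using ev_vact[OF that(1,2), of x] ev_vact[OF that(2,1), of x] that(4)
      by (cases "u < n") (simp_all add: vact_def)
  qed
  ultimately show ?thesis unfolding coxeter_map_def atMost_iff Ball_def by blast
qed

lemma act_vact_wmat:
  assumes "set w \<subseteq> {..n}"
  shows "act vact w x u = (if u < n then \<Sum>v<n. wmat n w $$ (u, v) * x v else x u)"
  using assms
proof (induction w arbitrary: u)
  case Nil
  have "(\<Sum>v<n. (1\<^sub>m n :: int mat) $$ (u, v) * x v) = x u" if "u < n"
  proof -
    have "(\<Sum>v<n. (1\<^sub>m n :: int mat) $$ (u, v) * x v) = (\<Sum>v<n. if v = u then x u else 0)"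
      by (rule sum.cong) (use that in auto)
    then show ?thesis using that by simp
  qed
  then show ?case by simp
next
  case (Cons i w)
  define y where "y = act vact w x"
  have y: "y v = (\<Sum>k<n. wmat n w $$ (v, k) * x k)" if "v < n" for v
    using Cons that by (simp add: y_def)
  show ?case
  proof (cases "u < n")
    case True
    have "(\<Sum>v<n. wmat n (i # w) $$ (u, v) * x v) = (\<Sum>v<n. (\<Sum>k<n. rfun n i u k * wmat n w $$ (k, v)) * x v)"
    proof (rule sum.cong)
      fix v assume "v \<in> {..<n}"
      then show "wmat n (i # w) $$ (u, v) * x v = (\<Sum>k<n. rfun n i u k * wmat n w $$ (k, v)) * x v"
        using True mult_mat_entry[OF rmat_carrier[of n i] wmat_carrier[of n w], of u v] by (simp add: rmat_def)
    qed simp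
    also have "\<dots> = (\<Sum>k<n. rfun n i u k * y k)"
      unfolding sum_distrib_right
      by (subst sum.swap, rule sum.cong) (simp_all add: y sum_distrib_left mult.assoc)
    also have "\<dots> = (\<Sum>k<n. (if k = u then y u else 0) - \<phi> n i u * (root n i k * y k))"
      by (rule sum.cong) (auto simp: rfun_def algebra_simps)
    also have "\<dots> = y u - \<phi> n i u * dot n (root n i) y"
      using True by (simp add: sum_subtractf sum_distrib_left[symmetric] dot_def)
    also have "\<dots> = vact i y u" using True Cons.prems by (simp add: vact_def dot_root_int)
    finally show ?thesis using True by (simp add: y_def)
  next
    case False
    then show ?thesis using Cons by (simp add: vact_def)
  qed
qed

lemma act_vact_ev:
  assumes "set w \<subseteq> {..n}" "j \<le> n"
  shows "foldr (reflect (cart n)) w (\<lambda>j. ev n j x) j = ev n j (act vact w x)"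
  using assms
proof (induction w arbitrary: j)
  case (Cons i w)
  then show ?case using ev_vact[of i j "act vact w x"] by (simp add: reflect_def)
qed simp

text \<open>The matrices satisfy no relations beyond those of the Coxeter group, so any family of
  involutions with the right commutations yields an action of the matrix group. Homomorphisms from H
  are obtained in this way.\<close>

theorem trivial_wmat_act:
  assumes f: "coxeter_map {..n} (cart n) f" and w: "set w \<subseteq> {..n}" "wmat n w = 1\<^sub>m n"
  shows "act f w = id"
proof (rule trivial_word_act[OF cartan_cart[OF n] _ vact_coxeter _ f w(1)])
  \<comment> \<open>At the all-ones vector every root is positive: the last one takes the value
    5.\<close>
  define x where "x = (\<lambda>u::nat. 1 :: int)"
  show "0 < (\<lambda>j. ev n j x) i" if "i \<in> {..n}" for i
    by (simp add: ev_def x_def)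
  show "\<forall>i\<in>{..n}. foldr (reflect (cart n)) u (\<lambda>j. ev n j x) i = ev n i x"
    if "set u \<subseteq> {..n}" "act vact u = id" for u
    using act_vact_ev[OF that(1), of _ x] that(2) by simp
  show "act vact w = id"
  proof (intro ext)
    fix y u
    have "act vact w y u = act vact [] y u"
      unfolding act_vact_wmat[OF w(1)] w(2) by (subst act_vact_wmat) simp_all
    then show "act vact w y u = id y u" by simp
  qed
qed

definition gens :: "nat set" where "gens = {0, 1, 2, 4} \<union> {6..<n}"

text \<open>In the names of the overview, index 0 is a, 1 is d, 2 is t and 4 is y. The indices 3 and
  5 are left out of \<open>gens\<close>: reflection 3 is the common partner in Q, and reflection 5
  enters only through d.\<close>

definition gw :: "nat \<Rightarrow> nat list" where
  "gw k = (if k = 0 then [0, 1] else if k = 1 then [0, 2, 3, 5] else if k = 2 then [n, 1] else [3, k])"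

abbreviation \<gamma> :: "nat \<Rightarrow> int mat" where "\<gamma> k \<equiv> wmat n (gw k)"

definition lg :: "nat \<Rightarrow> real mat" where
  "lg k = (if k = 0 then fmat n (Lf n 0 1)
    else if k = 1 then fmat n (\<lambda>u v. Lf n 0 2 u v + Lf n 3 5 u v)
    else if k = 2 then fmat n (Lf n n 1) else fmat n (Lf n 3 k))"

lemma gw_set: "k \<in> gens \<Longrightarrow> set (gw k) \<subseteq> {..n}"
  using n by (auto simp: gens_def gw_def)

lemma ev_real: "ev n i (\<lambda>u. real_of_int (x u)) = real_of_int (ev n i x)"
  by (simp add: ev_def)

lemma ev_lin: "ev n i (\<lambda>u. a * x u + b * y u) = a * ev n i x + b * ev n i y"
  "ev n i (\<lambda>u. a * x u - b * y u) = a * ev n i x - b * ev n i y" for a b :: real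
  by (simp_all add: ev_def algebra_simps)

lemma dot_er: "i \<le> n \<Longrightarrow> dot n (er n i) x = ev n i x"
  using dot_root[OF n, of i x] by simp

lemma fmult_Lf:
  assumes "i \<le> n" "j \<le> n"
  shows "fmult n (Lf n i j) (Lf n k l) u v =
    \<phi>r n j u * (cart n l i * er n k v - cart n k i * er n l v) -
    \<phi>r n i u * (cart n l j * er n k v - cart n k j * er n l v)"
  unfolding Lf_def fmult_outer using assms by (simp add: dot_er ev_real ev_cart)

text \<open>The square of the logarithm has all its columns proportional to the sum of the two
  coroots. Since 2 - 2 = 0, both roots vanish on that sum, and so does the logarithm.\<close>

lemma pair_unip:
  assumes ij: "i \<le> n" "j \<le> n" and c: "cart n i j = -2" "cart n j i = -2"
  shows "fmat n (Lf n i j) * (fmat n (Lf n i j) * fmat n (Lf n i j)) = 0\<^sub>m n n"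
    and "unip n (fmat n (Lf n i j)) 1 = map_mat real_of_int (rmat n i * rmat n j)"
proof -
  note c2 = cart_values(10)[OF n ij(1)] cart_values(10)[OF n ij(2)]
  define M where "M = (\<lambda>u v. (2 * \<phi>r n i u + 2 * \<phi>r n j u) * (- er n i v) - (2 * \<phi>r n i u + 2 * \<phi>r n j u) * er n j v)"
  have sq: "fmult n (Lf n i j) (Lf n i j) = M"
    using ij c c2 by (simp add: fun_eq_iff fmult_Lf M_def algebra_simps)
  have "fmult n (Lf n i j) M u v = 0" for u v
    unfolding M_def Lf_def fmult_outer using ij c c2
    by (simp add: dot_er ev_lin ev_real ev_cart)
  then show "fmat n (Lf n i j) * (fmat n (Lf n i j) * fmat n (Lf n i j)) = 0\<^sub>m n n"
    by (auto simp: fmat_mult sq intro!: eq_matI) (simp_all add: fmat_def)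
  show "unip n (fmat n (Lf n i j)) 1 = map_mat real_of_int (rmat n i * rmat n j)"
  proof (rule eq_matI)
    fix u v assume "u < dim_row (map_mat real_of_int (rmat n i * rmat n j))"
      "v < dim_col (map_mat real_of_int (rmat n i * rmat n j))"
    then have uv: "u < n" "v < n" by (simp_all add: rmat_def fmat_def)
    have "unip n (fmat n (Lf n i j)) 1 $$ (u, v) = (if u = v then 1 else 0) + (Lf n i j u v + M u v / 2)"
      using uv by (simp add: unip_def fmat_mult sq) (simp add: fmat_def)
    moreover have "map_mat real_of_int (rmat n i * rmat n j) $$ (u, v) = real_of_int (fmult n (rfun n i) (rfun n j) u v)"
      using uv unfolding rmat_def fmat_mult by (simp add: fmat_def)
    ultimately show "unip n (fmat n (Lf n i j)) 1 $$ (u, v) = map_mat real_of_int (rmat n i * rmat n j) $$ (u, v)"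
      using uv ij c by (cases "u = v") (simp_all add: fmult_rfun M_def Lf_def field_simps)
  qed (simp_all add: unip_def rmat_def fmat_def)
qed

end

text \<open>The exponential law for logarithms whose products in both orders vanish. It handles d,
  whose two factors live in P and in Q.\<close>

lemma unip_sum:
  fixes L M :: "real mat"
  assumes L: "L \<in> carrier_mat n n" "L * (L * L) = 0\<^sub>m n n" and M: "M \<in> carrier_mat n n" "M * (M * M) = 0\<^sub>m n n"
    and LM: "L * M = 0\<^sub>m n n" "M * L = 0\<^sub>m n n"
  shows "(L + M) * ((L + M) * (L + M)) = 0\<^sub>m n n" "unip n (L + M) 1 = unip n L 1 * unip n M 1"
proof -
  have sq: "(L + M) * (L + M) = L * L + M * M"
    using L M LM by (simp add: add_mult_distrib_mat[of _ n n _ _ n] mult_add_distrib_mat[of _ n n _ n])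
  have z: "L * (M * M) = 0\<^sub>m n n" "M * (L * L) = 0\<^sub>m n n" "(L * L) * M = 0\<^sub>m n n"
    using L(1) M(1) LM by (simp_all add: assoc_mult_mat[of L n n L n M n]
        flip: assoc_mult_mat[of L n n M n M n] assoc_mult_mat[of M n n L n L n])
  have z4: "(L * L) * (M * M) = 0\<^sub>m n n"
    using L(1) M(1) z(3) by (simp flip: assoc_mult_mat[of "L * L" n n M n M n])
  show "(L + M) * ((L + M) * (L + M)) = 0\<^sub>m n n"
    unfolding sq using L M z by (simp add: add_mult_distrib_mat[of _ n n _ _ n] mult_add_distrib_mat[of _ n n _ n])
  define P where "P = L + (1 / 2) \<cdot>\<^sub>m (L * L)"
  define Q where "Q = M + (1 / 2) \<cdot>\<^sub>m (M * M)"
  have P: "P \<in> carrier_mat n n" and Q: "Q \<in> carrier_mat n n" using L M by (simp_all add: P_def Q_def)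
  have u: "unip n L 1 = 1\<^sub>m n + P" "unip n M 1 = 1\<^sub>m n + Q"
    using L M by (auto simp: unip_def P_def Q_def intro!: eq_matI)
  have "P * Q = 0\<^sub>m n n"
    unfolding P_def Q_def using L(1) M(1) LM z z4
    by (simp add: add_mult_distrib_mat[of _ n n _ _ n] mult_add_distrib_mat[of _ n n _ n]
        mult_smult_assoc_mat[of _ n n _ n] mult_smult_distrib[of _ n n _ n] smult_zero_mat)
  then have "(1\<^sub>m n + P) * (1\<^sub>m n + Q) = 1\<^sub>m n + (P + Q)"
    using P Q by (simp add: add_mult_distrib_mat[of _ n n _ _ n] mult_add_distrib_mat[of _ n n _ n])
      (auto intro!: eq_matI)
  moreover have "unip n (L + M) 1 = 1\<^sub>m n + (P + Q)"
  proof -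
    have g: "1 \<cdot>\<^sub>m (L + M) + (1\<^sup>2 / 2) \<cdot>\<^sub>m (X + Y) = (L + (1 / 2) \<cdot>\<^sub>m X) + (M + (1 / 2) \<cdot>\<^sub>m Y)"
      if "X \<in> carrier_mat n n" "Y \<in> carrier_mat n n" for X Y
      using that L M by (auto intro!: eq_matI)
    show ?thesis unfolding unip_def sq P_def Q_def using g[of "L * L" "M * M"] L M by simp
  qed
  ultimately show "unip n (L + M) 1 = unip n L 1 * unip n M 1" by (simp add: u)
qed

context reflections
begin

lemma far_factors:
  assumes "set u \<subseteq> {3..<n}" "set v \<subseteq> {0, 1, 2}"
  shows "far u v"
  unfolding far_def
proof (intro ballI)
  fix i j assume "i \<in> set u" "j \<in> set v"
  then have "3 \<le> i" "i < n" "j < 3" using assms by auto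
  then show "i \<le> n \<and> j \<le> n \<and> cart n i j = 0 \<and> cart n j i = 0"
    using cart_values(8)[OF n, of j i] by simp
qed

lemma gens_cases:
  assumes "k \<in> gens"
  obtains "k = 0" | "k = 1" | "k = 2" | "k = 4" | "6 \<le> k" "k < n"
  using assms unfolding gens_def by auto

lemma gens_cases4:
  assumes "k \<in> gens"
  obtains "k = 0" | "k = 1" | "k = 2" | "3 < k" "k < n"
  using assms by (cases rule: gens_cases) (use n in auto)

lemma lg_props:
  assumes "k \<in> gens"
  shows "lg k \<in> carrier_mat n n" "lg k * (lg k * lg k) = 0\<^sub>m n n" "unip n (lg k) 1 = map_mat real_of_int (\<gamma> k)"
proof -
  note cv = cart_values(1-6)[OF n]
  have cQ: "cart n 3 j = -2" "cart n j 3 = -2" if "3 < j" "j < n" for j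
    using that cart_values(7)[OF n, of 3 j] cart_values(7)[OF n, of j 3] by auto
  have "lg k \<in> carrier_mat n n \<and> lg k * (lg k * lg k) = 0\<^sub>m n n \<and> unip n (lg k) 1 = map_mat real_of_int (\<gamma> k)"
  proof -
    from assms show ?thesis
    proof (cases rule: gens_cases4)
      case 1
      then show ?thesis using pair_unip[of 0 1] n cv by (simp add: lg_def gw_def)
    next
      case 2
      let ?L = "fmat n (Lf n 0 2)" and ?M = "fmat n (Lf n 3 5)"
      have c: "cart n 3 0 = 0" "cart n 5 0 = 0" "cart n 3 2 = 0" "cart n 5 2 = 0"
        "cart n 0 3 = 0" "cart n 0 5 = 0" "cart n 2 3 = 0" "cart n 2 5 = 0"
        using cart_values(8)[OF n, of 0 3] cart_values(8)[OF n, of 0 5]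
          cart_values(8)[OF n, of 2 3] cart_values(8)[OF n, of 2 5] n by auto
      have "?L * ?M = 0\<^sub>m n n" "?M * ?L = 0\<^sub>m n n"
        unfolding fmat_mult using n c by (auto simp: fmat_def fmult_Lf intro!: eq_matI)
      moreover have "?L * (?L * ?L) = 0\<^sub>m n n" "unip n ?L 1 = map_mat real_of_int (rmat n 0 * rmat n 2)"
        using pair_unip[of 0 2] n cv by auto
      moreover have "?M * (?M * ?M) = 0\<^sub>m n n" "unip n ?M 1 = map_mat real_of_int (rmat n 3 * rmat n 5)"
        using pair_unip[of 3 5] n cQ[of 5] by auto
      ultimately have *: "(?L + ?M) * ((?L + ?M) * (?L + ?M)) = 0\<^sub>m n n"
        "unip n (?L + ?M) 1 = map_mat real_of_int (rmat n 0 * rmat n 2) * map_mat real_of_int (rmat n 3 * rmat n 5)"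
        using unip_sum[of ?L n ?M] by simp_all
      have "map_mat real_of_int (rmat n 0 * rmat n 2 * (rmat n 3 * rmat n 5)) =
          map_mat real_of_int (rmat n 0 * rmat n 2) * map_mat real_of_int (rmat n 3 * rmat n 5)"
        by (rule of_int_hom.mat_hom_mult[of _ n n _ n]) simp_all
      moreover have "rmat n 0 * rmat n 2 * (rmat n 3 * rmat n 5) = \<gamma> k"
        using 2 by (simp add: gw_def assoc_mult_mat[of _ n n _ n _ n])
      moreover have "lg k = ?L + ?M" using 2 by (auto simp: lg_def fmat_def intro!: eq_matI)
      ultimately show ?thesis using * by simp
    next
      case 3
      then show ?thesis using pair_unip[of n 1] n cv by (simp add: lg_def gw_def)
    next
      case 4
      then show ?thesis using pair_unip[of 3 k] n cQ[of k] by (simp add: lg_def gw_def)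
    qed
  qed
  then show "lg k \<in> carrier_mat n n" "lg k * (lg k * lg k) = 0\<^sub>m n n" "unip n (lg k) 1 = map_mat real_of_int (\<gamma> k)"
    by blast+
qed

text \<open>The determinant is a unit of \<open>\<int>\<close>, and a square since a unipotent matrix has a real square root.\<close>
lemma det_\<gamma>:
  assumes "k \<in> gens"
  shows "det (\<gamma> k) = 1"
proof -
  interpret unipotent_log n "lg k" using lg_props[OF assms] by unfold_locales
  have "det (unip n (lg k) (1/2) * unip n (lg k) (1/2)) = det (unip n (lg k) (1/2)) * det (unip n (lg k) (1/2))"
    by (rule det_mult[of _ n]) simp_all
  then have "det (map_mat real_of_int (\<gamma> k)) \<ge> 0"
    using lg_props(3)[OF assms] by (simp add: unip_add)
  moreover have "det (map_mat real_of_int (\<gamma> k)) = real_of_int (det (\<gamma> k))"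
    by (rule of_int_hom.hom_det)
  ultimately have "det (\<gamma> k) \<ge> 0" by simp
  moreover have "det (\<gamma> k) * det (wmat n (rev (gw k))) = 1"
    using det_mult[of "\<gamma> k" n "wmat n (rev (gw k))"] wmat_rev[OF gw_set[OF assms]] by simp
  then have "det (\<gamma> k) dvd 1" by (metis dvd_triv_left)
  ultimately show ?thesis by (simp add: zdvd1_eq)
qed

section \<open>H inside the special linear group and its words\<close>

abbreviation G where "G \<equiv> SL_group n"

lemma G_simps [simp]: "carrier G = SL_int n" "A \<otimes>\<^bsub>G\<^esub> B = A * B" "\<one>\<^bsub>G\<^esub> = 1\<^sub>m n"
  by (simp_all add: SL_group_def)

lemma SL_carrier: "A \<in> SL_int n \<Longrightarrow> A \<in> carrier_mat n n"
  by (simp add: SL_int_def)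

lemma group_SL: "group G"
proof (rule groupI)
  fix A assume "A \<in> carrier G"
  then have A: "A \<in> carrier_mat n n" "det A = 1" by (auto simp: SL_int_def)
  note adj = adj_mat[OF A(1)]
  have "det (A * adj_mat A) = det A * det (adj_mat A)" by (rule det_mult[OF A(1) adj(1)])
  then have "adj_mat A \<in> SL_int n" using adj A by (simp add: SL_int_def)
  then show "\<exists>B\<in>carrier G. B \<otimes>\<^bsub>G\<^esub> A = \<one>\<^bsub>G\<^esub>" using adj A by (intro bexI[of _ "adj_mat A"]) auto
qed (auto simp: SL_int_def det_mult assoc_mult_mat[of _ n n _ n _ n])

sublocale G: group G by (rule group_SL)

lemma \<gamma>_SL: "k \<in> gens \<Longrightarrow> \<gamma> k \<in> SL_int n"
  using det_\<gamma> by (simp add: SL_int_def)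

definition H where "H = generate G (\<gamma> ` gens)"

lemma H_subgroup: "subgroup H G"
  unfolding H_def by (rule G.generate_is_subgroup) (use \<gamma>_SL in auto)

lemma H_carrier: "H \<subseteq> carrier_mat n n"
  using subgroup.subset[OF H_subgroup] SL_carrier by auto

lemma \<gamma>_H: "k \<in> gens \<Longrightarrow> \<gamma> k \<in> H"
  unfolding H_def by (rule generate.incl) simp

lemma gens_finite: "finite gens" by (simp add: gens_def)

lemma H_fg: "fg_subgroup G H"
  unfolding fg_subgroup_def H_def using gens_finite \<gamma>_SL by (intro exI[of _ "\<gamma> ` gens"]) auto

lemma H_dense: "zariski_dense_SL n H"
proof (rule zariski_dense_SL_lie[OF H_carrier])
  show "1\<^sub>m n \<in> H" using subgroup.one_closed[OF H_subgroup] by simp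
  show "A * B \<in> H" if "A \<in> H" "B \<in> H" for A B using subgroup.m_closed[OF H_subgroup that] by simp
  show "lg ` gens \<noteq> {}" by (simp add: gens_def)
  show "L \<in> carrier_mat n n \<and> L * (L * L) = 0\<^sub>m n n \<and> unip n L 1 \<in> map_mat real_of_int ` H" if "L \<in> lg ` gens" for L
    using that lg_props \<gamma>_H by auto
  fix S k l assume lie: "lie_subalgebra n S" and sub: "lg ` gens \<subseteq> S" and kl: "k < n" "l < n" "k \<noteq> l"
  interpret log_algebra n S using n lie by unfold_locales
  have lgS: "lg k \<in> S" if "k \<in> gens" for k using sub that by blast
  have m: "mem (Lf n 0 1)" "mem (\<lambda>u v. Lf n 0 2 u v + Lf n 3 5 u v)" "mem (Lf n n 1)"
    using lgS[of 0] lgS[of 1] lgS[of 2] by (simp_all add: mem_def lg_def gens_def)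
  have mQ: "mem (Lf n 3 j)" if "4 \<le> j" "j < n" "j \<noteq> 5" for j
  proof -
    have "j = 4 \<or> 6 \<le> j" using that by linarith
    then show ?thesis using lgS[of j] that by (auto simp: mem_def lg_def gens_def)
  qed
  show "mat_unit n k l \<in> S"
    by (rule mat_units[OF all_L[OF m(1,2) mQ m(3)] m(3) kl])
qed

definition rword :: "nat word \<Rightarrow> nat list" where
  "rword w = concat (map (\<lambda>(k, b). if b then rev (gw k) else gw k) w)"

lemma rword_simps [simp]: "rword [] = []" "rword ((k, b) # w) = (if b then rev (gw k) else gw k) @ rword w"
  by (simp_all add: rword_def)

lemma rword_set: "fst ` set w \<subseteq> gens \<Longrightarrow> set (rword w) \<subseteq> {..n}"
proof (induction w)
  case (Cons l w)
  then show ?case using gw_set[of "fst l"] by (cases l) auto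
qed simp

lemma inv_\<gamma>:
  assumes "set u \<subseteq> {..n}" "wmat n u \<in> SL_int n"
  shows "inv\<^bsub>G\<^esub> (wmat n u) = wmat n (rev u)" "wmat n (rev u) \<in> SL_int n"
proof -
  have e: "wmat n u * wmat n (rev u) = 1\<^sub>m n" by (rule wmat_rev[OF assms(1)])
  then show r: "wmat n (rev u) \<in> SL_int n"
    using assms(2) det_mult[of "wmat n u" n "wmat n (rev u)"] by (simp add: SL_int_def)
  have "wmat n (rev u) * wmat n u = 1\<^sub>m n" using wmat_rev[of "rev u"] assms(1) by simp
  then show "inv\<^bsub>G\<^esub> (wmat n u) = wmat n (rev u)"
    using G.inv_equality[of "wmat n (rev u)" "wmat n u"] r assms(2) by simp
qed

lemma eval_rword:
  assumes "fst ` set w \<subseteq> gens"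
  shows "word_eval G (gen_word \<gamma> w) = wmat n (rword w)"
  using assms
proof (induction w)
  case (Cons l w)
  obtain k b where l: "l = (k, b)" by (cases l)
  have k: "k \<in> gens" using Cons.prems l by simp
  have "letter_eval G (\<gamma> k, b) = wmat n (if b then rev (gw k) else gw k)"
    using inv_\<gamma>(1)[OF gw_set[OF k] \<gamma>_SL[OF k]] by (simp add: letter_eval_def)
  then show ?case using Cons l by (simp add: wmat_append)
qed simp

section \<open>Two actions on integer sequences\<close>

definition \<delta> :: "int \<Rightarrow> int" where "\<delta> i = (if i = 0 then 1 else 0)"

text \<open>Up to sign these reverse a sequence about 0, about 0 with a lamp switched there, and
  about -1/2. Two reversals with different centres compose to a shift, two with the same centre to a
  switched lamp.\<close>

definition \<rho> :: "nat \<Rightarrow> (int \<Rightarrow> int) \<Rightarrow> int \<Rightarrow> int" where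
  "\<rho> k f = (if k = 0 then (\<lambda>i. - f (- i)) else if k = 1 then (\<lambda>i. - f (- i) - \<delta> i)
    else if k = 2 then (\<lambda>i. - f (- i - 1)) else f)"

text \<open>The products \<open>\<rho>\<^sub>0 \<rho>\<^sub>1\<close> and \<open>\<rho>\<^sub>0 \<rho>\<^sub>2\<close> are the generators of the wreath product of \<open>\<int>\<close> by \<open>\<int>\<close>.\<close>
definition actP :: "nat \<Rightarrow> (int \<Rightarrow> int) \<Rightarrow> int \<Rightarrow> int" where
  "actP i = (if i < 3 then \<rho> i else if i = n then \<rho> 1 else id)"

text \<open>Index n goes to the identity here, as does 1, while \<open>actP\<close> sends both to
  \<open>\<rho> 1\<close>; so t acts trivially both times. Indices from 6 on share
  \<open>\<rho> 0\<close> with index 3, which makes the remaining generators [3, k] trivial as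
  well.\<close>

definition actQ :: "nat \<Rightarrow> (int \<Rightarrow> int) \<Rightarrow> int \<Rightarrow> int" where
  "actQ i = (if i < 3 \<or> i = n then id else if i < 6 then \<rho> (i - 3) else \<rho> 0)"

lemma \<rho>_involution: "\<rho> k \<circ> \<rho> k = id"
  by (auto simp: \<rho>_def \<delta>_def fun_eq_iff)

lemma actP_values: "actP 0 = \<rho> 0" "actP 1 = \<rho> 1" "actP 2 = \<rho> 2" "actP n = \<rho> 1"
  "3 \<le> k \<Longrightarrow> k < n \<Longrightarrow> actP k = id"
  using n by (simp_all add: actP_def)

lemma actQ_values: "k < 3 \<Longrightarrow> actQ k = id" "actQ n = id" "actQ 3 = \<rho> 0" "actQ 4 = \<rho> 1" "actQ 5 = \<rho> 2"
  "6 \<le> k \<Longrightarrow> k < n \<Longrightarrow> actQ k = \<rho> 0"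
  using n by (simp_all add: actQ_def One_nat_def)

text \<open>A commuting pair has one letter in Q and the other in P or equal to n. Each of the two
  actions is the identity on one of these sides, so the commutations hold automatically.\<close>

lemma cart_zero_cases:
  assumes "i \<le> n" "j \<le> n" "i \<noteq> j" "cart n i j = 0"
  shows "i < 3 \<and> 3 \<le> j \<and> j < n \<or> j < 3 \<and> 3 \<le> i \<and> i < n \<or> i = n \<and> 3 \<le> j \<and> j < n \<or> j = n \<and> 3 \<le> i \<and> i < n"
  using assms n by (auto simp: cart_def ev_def \<phi>_def split: if_splits)

lemma actP_coxeter: "coxeter_map {..n} (cart n) actP"
proof -
  have "actP i \<circ> actP i = id" for i by (simp add: actP_def \<rho>_involution)
  moreover have "actP i \<circ> actP j = actP j \<circ> actP i" if "i \<le> n" "j \<le> n" "i \<noteq> j" "cart n i j = 0" for i j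
    using cart_zero_cases[OF that] by (auto simp: actP_def)
  ultimately show ?thesis unfolding coxeter_map_def atMost_iff Ball_def by blast
qed

lemma actQ_coxeter: "coxeter_map {..n} (cart n) actQ"
proof -
  have "actQ i \<circ> actQ i = id" for i by (simp add: actQ_def \<rho>_involution)
  moreover have "actQ i \<circ> actQ j = actQ j \<circ> actQ i" if "i \<le> n" "j \<le> n" "i \<noteq> j" "cart n i j = 0" for i j
    using cart_zero_cases[OF that] by (auto simp: actQ_def)
  ultimately show ?thesis unfolding coxeter_map_def atMost_iff Ball_def by blast
qed

fun level :: "nat word \<Rightarrow> int" where
  "level [] = 0"
| "level ((k, b) # w) = (if k = 1 then if b then -1 else 1 else 0) + level w"

text \<open>The element of the wreath product represented by w is \<open>f \<mapsto> f (i - level w) + lamps c w i\<close>,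
  where c is the generator that acts by switching the lamp at 0.\<close>
fun lamps :: "nat \<Rightarrow> nat word \<Rightarrow> int \<Rightarrow> int" where
  "lamps c [] i = 0"
| "lamps c ((k, b) # w) i =
    (if k = 1 then lamps c w (if b then i + 1 else i - 1)
     else lamps c w i + (if k = c then if b then - \<delta> i else \<delta> i else 0))"

lemma actP_rword:
  "fst ` set w \<subseteq> gens \<Longrightarrow> act actP (rword w) f = (\<lambda>i. f (i - level w) + lamps 0 w i)"
proof (induction w)
  case (Cons l w)
  obtain k b where l: "l = (k, b)" by (cases l)
  have k: "k \<in> gens" and IH: "act actP (rword w) f = (\<lambda>i. f (i - level w) + lamps 0 w i)"
    using Cons l by auto
  from k show ?case
    by (cases rule: gens_cases4) (use n in \<open>auto simp: l IH gw_def actP_values \<rho>_def \<delta>_def fun_eq_iff algebra_simps\<close>)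
qed simp

lemma actQ_rword:
  "fst ` set w \<subseteq> gens \<Longrightarrow> act actQ (rword w) f = (\<lambda>i. f (i - level w) + lamps 4 w i)"
proof (induction w)
  case (Cons l w)
  obtain k b where l: "l = (k, b)" by (cases l)
  have k: "k \<in> gens" and IH: "act actQ (rword w) f = (\<lambda>i. f (i - level w) + lamps 4 w i)"
    using Cons l by auto
  from k show ?case
    by (cases rule: gens_cases) (use n in \<open>auto simp: l IH gw_def actQ_values \<rho>_def \<delta>_def fun_eq_iff algebra_simps\<close>)
qed simp

lemma lamps_support: "i > int (length w) \<Longrightarrow> lamps c w i = 0"
proof (induction w arbitrary: i)
  case (Cons l w)
  then show ?case by (cases l) (auto simp: \<delta>_def)
qed simp

lemma trivial_word_invariants:
  assumes w: "fst ` set w \<subseteq> gens" "word_eval G (gen_word \<gamma> w) = \<one>\<^bsub>G\<^esub>"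
  shows "level w = 0" "lamps 0 w = (\<lambda>i. 0)" "lamps 4 w = (\<lambda>i. 0)"
proof -
  have t: "wmat n (rword w) = 1\<^sub>m n" using w eval_rword by simp
  have P: "(\<lambda>i. f (i - level w) + lamps 0 w i) = f" for f
    using trivial_wmat_act[OF actP_coxeter rword_set[OF w(1)] t] actP_rword[OF w(1), of f] by simp
  have Q: "(\<lambda>i. f (i - level w) + lamps 4 w i) = f" for f
    using trivial_wmat_act[OF actQ_coxeter rword_set[OF w(1)] t] actQ_rword[OF w(1), of f] by simp
  show l0: "lamps 0 w = (\<lambda>i. 0)" "lamps 4 w = (\<lambda>i. 0)" using P[of "\<lambda>i. 0"] Q[of "\<lambda>i. 0"] by auto
  show "level w = 0" using fun_cong[OF P[of \<delta>], of 0] by (simp add: l0 \<delta>_def split: if_splits)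
qed

section \<open>The group is not finitely presented\<close>

text \<open>In the k-th action generator 4 commutes with the conjugate of generator 0 by the i-th power of
  generator 1 exactly when i is not \<open>k + 1\<close>.\<close>
definition \<tau> :: "nat \<Rightarrow> int \<Rightarrow> nat \<Rightarrow> (int \<Rightarrow> int) \<times> (int \<Rightarrow> int) \<Rightarrow> (int \<Rightarrow> int) \<times> (int \<Rightarrow> int)" where
  "\<tau> k s x = (\<lambda>(f, z). if x = 0 then (\<lambda>i. f i + s * \<delta> i, z)
    else if x = 1 then (\<lambda>i. f (i - s), \<lambda>i. z (i - s))
    else if x = 4 then (f, \<lambda>i. z i + s * f (int k + 1) * \<delta> i) else (f, z))"

lemma \<tau>_inverse: "\<tau> k s x \<circ> \<tau> k (- s) x = id"
  by (auto simp: \<tau>_def fun_eq_iff)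

lemma \<tau>_bij: "bij (\<tau> k 1 x)"
  using \<tau>_inverse[of k 1 x] \<tau>_inverse[of k "-1" x] by (intro o_bij[of "\<tau> k (-1) x"]) simp_all

lemma \<tau>_inv: "Hilbert_Choice.inv (\<tau> k 1 x) = \<tau> k (-1) x"
  using \<tau>_inverse[of k 1 x] \<tau>_inverse[of k "-1" x] by (intro inv_unique_comp) simp_all

text \<open>Generator 4 reads the first sequence at k + 1. Lamps start at 0 and move by at most one
  step per letter, so a word of length at most k never puts one there, and only the initial f is
  read. Level and lamps then determine the action completely.\<close>

lemma word_act_\<tau>:
  "length w \<le> k \<Longrightarrow> word_act (\<tau> k 1) w (f, z) =
    (\<lambda>i. f (i - level w) + lamps 0 w i, \<lambda>i. z (i - level w) + lamps 4 w i * f (i - level w + int k + 1))"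
proof (induction w)
  case (Cons l w)
  obtain x b where l: "l = (x, b)" by (cases l)
  have 0: "lamps 0 w (int k + 1) = 0" "lamps 0 w (1 + int k) = 0"
    using Cons.prems by (intro lamps_support; simp)+
  have IH: "word_act (\<tau> k 1) w (f, z) = (\<lambda>i. f (i - level w) + lamps 0 w i,
      \<lambda>i. z (i - level w) + lamps 4 w i * f (i - level w + int k + 1))"
    using Cons by simp
  show ?case
    by (cases b) (auto simp: l \<tau>_inv IH, auto simp: \<tau>_def 0 \<delta>_def fun_eq_iff algebra_simps)
qed simp

definition lamp_word :: "nat \<Rightarrow> nat word" where
  "lamp_word m = replicate m (1, False) @ [(0, False)] @ replicate m (1, True)"

lemma lamp_word_Suc: "lamp_word (Suc m) = (1, False) # lamp_word m @ [(1, True)]"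
  by (simp add: lamp_word_def replicate_append_same)

text \<open>Conjugates of a by powers of d stay in P, because the factor [3, 5] of d commutes with P
  and cancels. Being in Q, y therefore commutes with all of them.\<close>

lemma lamp_word_wmat: "\<exists>u. set u \<subseteq> {0, 1, 2} \<and> wmat n (rword (lamp_word m)) = wmat n u"
proof (induction m)
  case 0
  have "rword (lamp_word 0) = [0, 1]" by (simp add: lamp_word_def gw_def)
  then show ?case by (intro exI[of _ "[0, 1]"]) simp
next
  case (Suc m)
  then obtain u where u: "set u \<subseteq> {0, 1, 2}" "wmat n (rword (lamp_word m)) = wmat n u" by blast
  have app: "rword (v @ w) = rword v @ rword w" for v w by (simp add: rword_def)
  have far: "far [3, 5] u"
    by (rule far_factors) (use u(1) n in auto)
  have "wmat n (rword (lamp_word (Suc m))) = wmat n ([0, 2] @ ([3, 5] @ u @ rev [3, 5]) @ [2, 0])"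
    by (simp add: lamp_word_Suc app gw_def wmat_append u(2))
  also have "\<dots> = wmat n ([0, 2] @ u @ [2, 0])"
  proof -
    have ctx: "wmat n (p @ v @ q) = wmat n (p @ w @ q)" if "wmat n v = wmat n w" for p q v w
      using that by (simp add: wmat_append)
    show ?thesis by (rule ctx, rule wmat_conj[OF far]) (use n in simp)
  qed
  finally show ?case using u(1) by (intro exI[of _ "[0, 2] @ u @ [2, 0]"]) auto
qed

lemma H_not_fp: "\<not> finitely_presented G H"
  unfolding H_def
proof (rule G.not_finitely_presentedI[where \<theta> = "\<lambda>k. \<tau> k 1"])
  show "\<exists>k0. \<forall>k\<ge>k0. word_act (\<tau> k 1) w = id"
    if w: "fst ` set w \<subseteq> gens" "word_eval G (gen_word \<gamma> w) = \<one>\<^bsub>G\<^esub>" for w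
  proof (intro exI[of _ "length w"] allI impI ext)
    fix k p assume "length w \<le> k"
    then show "word_act (\<tau> k 1) w p = id p"
      using word_act_\<tau>[of w k "fst p" "snd p"] trivial_word_invariants[OF w] by simp
  qed
  show "\<exists>w. fst ` set w \<subseteq> gens \<and> word_eval G (gen_word \<gamma> w) = \<one>\<^bsub>G\<^esub> \<and> word_act (\<tau> k 1) w \<noteq> id" for k
  proof -
    \<comment> \<open>Of all these commutations in H, the k-th action violates exactly the one at
      position k + 1.\<close>
    define v where "v = lamp_word (Suc k)"
    define w where "w = ((4, False) # v) @ (4, True) # word_inv v"
    have v: "fst ` set v \<subseteq> gens" by (auto simp: v_def lamp_word_def gens_def)
    have 4: "4 \<in> gens" by (simp add: gens_def)
    have w: "fst ` set w \<subseteq> gens" using v 4 by (simp add: w_def image_Un)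
    define A where "A = word_eval G (gen_word \<gamma> v)"
    have A: "A = wmat n (rword v)" using eval_rword[OF v] by (simp add: A_def)
    have vG: "fst ` set (gen_word \<gamma> v) \<subseteq> carrier G" using v \<gamma>_SL by auto
    then have AG: "A \<in> carrier G" unfolding A_def by (rule G.word_eval_closed)
    have "\<gamma> 4 \<otimes>\<^bsub>G\<^esub> A = A \<otimes>\<^bsub>G\<^esub> \<gamma> 4"
    proof -
      obtain u where u: "set u \<subseteq> {0, 1, 2}" "A = wmat n u" using lamp_word_wmat[of "Suc k"] A v_def by auto
      have "far (gw 4) u" by (rule far_factors) (use u(1) n in \<open>auto simp: gw_def\<close>)
      from wmat_commute[OF this] show ?thesis by (simp add: u(2))
    qed
    then have "\<gamma> 4 \<otimes>\<^bsub>G\<^esub> A \<otimes>\<^bsub>G\<^esub> (inv\<^bsub>G\<^esub> \<gamma> 4 \<otimes>\<^bsub>G\<^esub> inv\<^bsub>G\<^esub> A) = \<one>\<^bsub>G\<^esub>"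
      using AG \<gamma>_SL[OF 4] by (metis G.inv_mult_group G.m_closed G.r_inv G_simps(1))
    moreover have "word_eval G (gen_word \<gamma> w) = \<gamma> 4 \<otimes>\<^bsub>G\<^esub> A \<otimes>\<^bsub>G\<^esub> (inv\<^bsub>G\<^esub> \<gamma> 4 \<otimes>\<^bsub>G\<^esub> inv\<^bsub>G\<^esub> A)"
    proof -
      have c: "fst ` set (gen_word \<gamma> ((4, False) # v)) \<subseteq> carrier G"
        "fst ` set (gen_word \<gamma> ((4, True) # word_inv v)) \<subseteq> carrier G"
        using v 4 \<gamma>_SL by auto
      show ?thesis unfolding w_def gen_word_simps(3) G.word_eval_append[OF c]
        by (simp add: G.word_eval_inv[OF vG] A_def[symmetric] letter_eval_def del: G_simps)
    qed
    moreover have "word_act (\<tau> k 1) w \<noteq> id"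
    proof -
      have sh: "word_act (\<tau> k 1) (lamp_word m) (f, z) = (\<lambda>i. f i + \<delta> (i - int m), z)" for m f z
        by (induction m arbitrary: f z)
          (simp_all add: lamp_word_Suc \<tau>_inv, simp_all add: lamp_word_def \<tau>_def algebra_simps)
      have "word_act (\<tau> k 1) v (\<lambda>i. f i - \<delta> (i - int (Suc k)), z) = (f, z)" for f z
        unfolding v_def sh by simp
      then have ish: "Hilbert_Choice.inv (word_act (\<tau> k 1) v) (f, z) = (\<lambda>i. f i - \<delta> (i - int (Suc k)), z)" for f z
        by (intro inv_f_eq bij_is_inj word_act_bij \<tau>_bij)
      \<comment> \<open>From zero, undoing v puts -1 at k + 1. The inverse of generator 4 subtracts
        this value, leaving a lamp at 0 in the second sequence; v clears the first sequence, so
        generator 4 then adds nothing.\<close>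
      have "word_act (\<tau> k 1) w (\<lambda>i. 0, \<lambda>i. 0) = (\<lambda>i. 0, \<delta>)"
        unfolding w_def
        by (simp add: word_act_inv_eq[OF \<tau>_bij] ish \<tau>_inv)
          (simp add: v_def \<tau>_def sh fun_eq_iff, simp add: \<delta>_def)
      moreover have "(\<lambda>i. 0, \<delta>) \<noteq> (\<lambda>i::int. 0::int, \<lambda>i. 0)" by (auto simp: fun_eq_iff \<delta>_def intro: exI[of _ 0])
      ultimately show ?thesis by (metis id_apply)
    qed
    ultimately show ?thesis using w by auto
  qed
qed (use gens_finite \<gamma>_SL \<tau>_bij in auto)

section \<open>The group is one-ended\<close>

lemma wmat_pow:
  assumes "set u \<subseteq> {..n}" "wmat n u \<in> SL_int n"
  shows "wmat n u [^]\<^bsub>G\<^esub> (j::int) = wmat n (pow_word u j)"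
proof -
  have nat: "wmat n v [^]\<^bsub>G\<^esub> (m::nat) = wmat n (concat (replicate m v))" for m v
  proof (induction m)
    case (Suc m)
    have "concat (replicate (Suc m) v) = concat (replicate m v) @ v"
      by (simp only: replicate_Suc flip: replicate_append_same) simp
    then show ?case using Suc by (simp add: wmat_append)
  qed simp
  show ?thesis
  proof (cases "0 \<le> j")
    case True
    have "wmat n u [^]\<^bsub>G\<^esub> j = wmat n u [^]\<^bsub>G\<^esub> nat j" by (rule pow_nat[OF True, symmetric])
    also have "\<dots> = wmat n (concat (replicate (nat j) u))" by (rule nat)
    also have "concat (replicate (nat j) u) = pow_word u j" using True by (simp add: pow_word_def)
    finally show ?thesis .
  next
    case False
    have "wmat n u [^]\<^bsub>G\<^esub> j = inv\<^bsub>G\<^esub> (wmat n u [^]\<^bsub>G\<^esub> nat (-j))"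
      using False by (subst int_pow_def2) (simp only: not_le if_True)
    also have "\<dots> = (inv\<^bsub>G\<^esub> wmat n u) [^]\<^bsub>G\<^esub> nat (-j)"
      by (rule G.nat_pow_inv[symmetric]) (use assms(2) in simp)
    also have "\<dots> = wmat n (concat (replicate (nat (-j)) (rev u)))"
      unfolding inv_\<gamma>(1)[OF assms] by (rule nat)
    also have "concat (replicate (nat (-j)) (rev u)) = pow_word u j" using False by (simp add: pow_word_def)
    finally show ?thesis .
  qed
qed

lemma actP_pow: "act actP (pow_word (gw 0) j) f = (\<lambda>i. f i + j * \<delta> i)"
proof -
  have a: "act actP (gw 0) g = (\<lambda>i. g i + \<delta> i)" "act actP (rev (gw 0)) g = (\<lambda>i. g i - \<delta> i)" for g
    by (simp_all add: gw_def actP_values) (simp_all add: \<rho>_def \<delta>_def fun_eq_iff)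
  have "(act actP (gw 0) ^^ m) f = (\<lambda>i. f i + int m * \<delta> i)"
    "(act actP (rev (gw 0)) ^^ m) f = (\<lambda>i. f i - int m * \<delta> i)" for m
    by (induction m) (simp_all add: a algebra_simps)
  then show ?thesis by (cases "0 \<le> j") (simp_all add: pow_word_def act_power)
qed

text \<open>\<open>actP\<close> is trivial on Q and hence on every conjugate of y, so it detects the
  exponent of a. Once that is zero, \<open>actQ\<close> detects the exponent of y.\<close>

lemma conj_free:
  assumes u: "set u \<subseteq> {..n}" "wmat n u \<in> SL_int n"
  shows "(\<forall>i j::int. wmat n (u @ gw 4 @ rev u) [^]\<^bsub>G\<^esub> (i::int) = \<gamma> 0 [^]\<^bsub>G\<^esub> (j::int) \<longrightarrow> i = 0 \<and> j = 0)"
    and "wmat n (u @ gw 4 @ rev u) \<in> SL_int n"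
proof -
  define c where "c = u @ gw 4 @ rev u"
  have g: "0 \<in> gens" "4 \<in> gens" by (auto simp: gens_def)
  have c: "set c \<subseteq> {..n}" using u gw_set[OF g(2)] by (auto simp: c_def)
  show cS: "wmat n (u @ gw 4 @ rev u) \<in> SL_int n"
    using u \<gamma>_SL[OF g(2)] inv_\<gamma>[OF u] G.m_closed by (auto simp: wmat_append)
  have inv: "act actQ u (act actQ (rev u) z) = z" "act actQ (rev u) (act actQ u z) = z" for z
    using act_rev[OF actQ_coxeter, of u] act_rev[OF actQ_coxeter, of "rev u"] u(1) by (auto simp: fun_eq_iff)
  have nonneg: "i = 0 \<and> j = 0" if ij: "wmat n c [^]\<^bsub>G\<^esub> int i = \<gamma> 0 [^]\<^bsub>G\<^esub> (j::int)" for i :: nat and j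
  proof -
    have e: "wmat n (pow_word c (int i)) = wmat n (pow_word (gw 0) j)"
      using ij wmat_pow[OF c cS[folded c_def]] wmat_pow[OF gw_set[OF g(1)] \<gamma>_SL[OF g(1)]] by simp
    have s: "set (pow_word c (int i)) \<subseteq> {..n}" "set (pow_word (gw 0) j) \<subseteq> {..n}"
      using set_pow_word[of c] set_pow_word[of "gw 0" j] c gw_set[OF g(1)] by blast+
    define w where "w = pow_word c (int i) @ rev (pow_word (gw 0) j)"
    have w: "set w \<subseteq> {..n}" "wmat n w = 1\<^sub>m n"
      using s wmat_rev[OF s(2)] by (auto simp: w_def wmat_append e)
    have same: "act h (pow_word c (int i)) = act h (pow_word (gw 0) j)"
      if h: "coxeter_map {..n} (cart n) h" for h :: "nat \<Rightarrow> (int \<Rightarrow> int) \<Rightarrow> int \<Rightarrow> int"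
    proof -
      have "act h (pow_word c (int i)) \<circ> (act h (rev (pow_word (gw 0) j)) \<circ> act h (pow_word (gw 0) j)) =
          act h w \<circ> act h (pow_word (gw 0) j)" by (simp add: w_def comp_assoc)
      then show ?thesis using trivial_wmat_act[OF h w] act_rev[OF h s(2)] by simp
    qed
    have "act actP (gw 4) = id" using n by (auto simp: gw_def actP_def)
    moreover have "act actP u \<circ> act actP (rev u) = id"
      using act_rev[OF actP_coxeter, of "rev u"] u(1) by simp
    ultimately have "act actP c = id" by (simp add: c_def)
    then have "act actP (pow_word c (int i)) = id" by (simp add: pow_word_def act_power)
    then have "(\<lambda>k. j * \<delta> k) = (\<lambda>k. 0)" using same[OF actP_coxeter] actP_pow[of j "\<lambda>k. 0"] by simp
    from fun_cong[OF this, of 0] have j: "j = 0" by (simp add: \<delta>_def)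
    have c1: "act actQ c z = act actQ u (\<lambda>k. act actQ (rev u) z k + \<delta> k)" for z
      by (simp add: c_def gw_def actQ_values) (simp add: \<rho>_def \<delta>_def add.commute)
    have "(act actQ c ^^ m) z = act actQ u (\<lambda>k. act actQ (rev u) z k + int m * \<delta> k)" for m z
      by (induction m) (simp_all add: c1 inv algebra_simps)
    moreover have "act actQ c ^^ i = id"
      using same[OF actQ_coxeter] by (simp add: j pow_word_def act_power)
    ultimately have "act actQ u (\<lambda>k. act actQ (rev u) z k + int i * \<delta> k) = z" for z by (metis id_apply)
    from this[of "act actQ u (\<lambda>k. 0)"] have "(\<lambda>k. int i * \<delta> k) = (\<lambda>k. 0)"
      by (metis (no_types, lifting) inv(2) add_0)
    from fun_cong[OF this, of 0] have "i = 0" by (simp add: \<delta>_def)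
    then show ?thesis using j by simp
  qed
  show "\<forall>i j::int. wmat n (u @ gw 4 @ rev u) [^]\<^bsub>G\<^esub> (i::int) = \<gamma> 0 [^]\<^bsub>G\<^esub> (j::int) \<longrightarrow> i = 0 \<and> j = 0"
  proof (intro allI impI)
    fix i j :: int assume ij: "wmat n (u @ gw 4 @ rev u) [^]\<^bsub>G\<^esub> i = \<gamma> 0 [^]\<^bsub>G\<^esub> j"
    show "i = 0 \<and> j = 0"
    proof (cases "0 \<le> i")
      case True
      then show ?thesis using nonneg[of "nat i" j] ij by (simp add: c_def)
    next
      case False
      have "wmat n c [^]\<^bsub>G\<^esub> (- i) = \<gamma> 0 [^]\<^bsub>G\<^esub> (- j)"
        using ij cS \<gamma>_SL[OF g(1)] by (simp add: G.int_pow_neg c_def)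
      then show ?thesis using nonneg[of "nat (- i)" "- j"] False by simp
    qed
  qed
qed

lemma H_one_ended: "one_ended G H"
proof (rule one_endedI[OF group_SL _ H_def])
  have g: "0 \<in> gens" "4 \<in> gens" by (auto simp: gens_def)
  have free: "cayley.free_pair G H (wmat n (u @ gw 4 @ rev u)) (\<gamma> 0)"
    if u: "set u \<subseteq> {..n}" "wmat n u \<in> H" and v: "wmat n (u @ gw 4 @ rev u) = wmat n v" "set v \<subseteq> {3..<n}" for u v
  proof -
    interpret cayley G H "\<gamma> ` gens" "{}"
      unfolding cayley_def cayley_axioms_def using group_SL H_subgroup \<gamma>_SL H_def by auto
    have uS: "wmat n u \<in> SL_int n" using u(2) in_carrier by simp
    have "wmat n (u @ gw 4 @ rev u) = wmat n u \<otimes>\<^bsub>G\<^esub> \<gamma> 4 \<otimes>\<^bsub>G\<^esub> inv\<^bsub>G\<^esub> wmat n u"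
      by (simp add: wmat_append inv_\<gamma>[OF u(1) uS] assoc_mult_mat[of _ n n _ n _ n])
    then have "wmat n (u @ gw 4 @ rev u) \<in> H" using u(2) \<gamma>_H[OF g(2)] mult_in inv_in by metis
    moreover have "far v (gw 0)"
      by (intro far_factors v(2)) (simp add: gw_def)
    then have "wmat n v * \<gamma> 0 = \<gamma> 0 * wmat n v" by (rule wmat_commute)
    ultimately show ?thesis
      unfolding free_pair_def using conj_free(1)[OF u(1) uS] \<gamma>_H[OF g(1)] v(1) by simp
  qed
  show "\<gamma> ` gens \<subseteq> carrier G" using \<gamma>_SL by auto
  have "1\<^sub>m n \<in> H" using subgroup.one_closed[OF H_subgroup] by simp
  then show "cayley.free_pair G H (\<gamma> 4) (\<gamma> 0)" using free[of "[]" "gw 4"] n by (simp add: gw_def)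
  fix x assume "x \<in> \<gamma> ` gens"
  then obtain k where k: "k \<in> gens" "x = \<gamma> k" by blast
  note kS = gw_set[OF k(1)] \<gamma>_SL[OF k(1)]
  have far: "far [0, 1] [3, 4]" "far [0, 2] [3, 5, 3, 4, 5, 3]" "far [n, 1] [3, 4]"
    using cart_values(8)[OF n] cart_values(9)[OF n] n by (auto simp: far_def)
  \<comment> \<open>Conjugating y by a or t changes nothing, and for d only the factor [3, 5]
    matters. The result is always an element of Q, hence commutes with a.\<close>
  from k(1) have "\<exists>v. wmat n (gw k @ gw 4 @ rev (gw k)) = wmat n v \<and> set v \<subseteq> {3..<n}"
  proof (cases rule: gens_cases4)
    case 1
    then show ?thesis using wmat_conj[OF far(1)] n by (intro exI[of _ "[3, 4]"]) (simp add: gw_def)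
  next
    case 2
    then show ?thesis using wmat_conj[OF far(2)] n by (intro exI[of _ "[3, 5, 3, 4, 5, 3]"]) (simp add: gw_def)
  next
    case 3
    then show ?thesis using wmat_conj[OF far(3)] n by (intro exI[of _ "[3, 4]"]) (simp add: gw_def)
  next
    case 4
    then show ?thesis using n by (intro exI[of _ "gw k @ gw 4 @ rev (gw k)"]) (simp add: gw_def)
  qed
  then have "cayley.free_pair G H (wmat n (gw k @ gw 4 @ rev (gw k))) (\<gamma> 0)"
    using free[OF kS(1) \<gamma>_H[OF k(1)]] by blast
  moreover have "wmat n (gw k @ gw 4 @ rev (gw k)) = x \<otimes>\<^bsub>G\<^esub> \<gamma> 4 \<otimes>\<^bsub>G\<^esub> inv\<^bsub>G\<^esub> x"
    by (simp add: k(2) wmat_append inv_\<gamma>[OF kS] assoc_mult_mat[of _ n n _ n _ n])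
  ultimately show "cayley.free_pair G H (x \<otimes>\<^bsub>G\<^esub> \<gamma> 4 \<otimes>\<^bsub>G\<^esub> inv\<^bsub>G\<^esub> x) (\<gamma> 0)" by simp
qed

end

theorem theorem1p5:
  fixes n :: nat
  assumes "n \<ge> 6"
  shows "\<exists>H. subgroup H (SL_group n) \<and> fg_subgroup (SL_group n) H \<and>
             one_ended (SL_group n) H \<and> \<not> finitely_presented (SL_group n) H \<and>
             zariski_dense_SL n H"
proof -
  interpret reflections n using assms by unfold_locales
  show ?thesis using H_subgroup H_fg H_one_ended H_not_fp H_dense by blast
qed

end
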